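(* Let $\mu$ be a singular cardinal with $\mathrm{cf}(\mu)=\aleph_0$. Then there are a coloring $c:[\mu^+]^2\rightarrow\mu^+$ and an ideal $I$ on $\mu^+$ such that (1) $I$ is a proper ideal containing all non-stationary subsets of $\mu^+$, and $I$ is $\sigma$-indecomposable for every regular uncountable cardinal $\sigma<\mu$; and (2) whenever $\langle t_\alpha:\alpha<\mu^+\rangle$ is a sequence of pairwise disjoint finite subsets of $\mu^+$, then for $I$-almost all $\beta^*<\mu^+$ there are $\alpha<\beta<\mu^+$ such that $c$ is constant with value $\beta^*$ on $t_\alpha\times t_\beta$.
   Context: An ideal on a cardinal $\kappa$ is a family of subsets of $\kappa$ closed under subsets and finite unions; by the paper's convention ideals on $\kappa$ are proper (do not contain $\kappa$) and contain all bounded subsets of $\kappa$. For a regular cardinal $\sigma$, an ideal $I$ is $\sigma$-indecomposable if it is closed under increasing unions of length $\sigma$: whenever $\langle A_i:i<\sigma\rangle$ is a $\subseteq$-increasing sequence of members of $I$, $\bigcup_{i<\sigma}A_i\in I$. "For $I$-almost all $\beta^*<\mu^+$, $P(\beta^* )$" means that $\{\beta^*<\mu^+: P(\beta^* )\text{ fails}\}\in I$. $[\mu^+]^2$ denotes the set of pairs $\{\alpha,\beta\}$ with $\alpha<\beta<\mu^+$, and $c(\alpha,\beta)$ is written for $c(\{\alpha,\beta\})$. *)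

theory Defs
  imports "HOL-Library.Ramsey" "HOL-Library.Disjoint_Sets"
begin

unbundle cardinal_syntax

text \<open>
  An infinite cardinal is a relation \<open>r\<close> with \<open>Card_order r\<close> and \<open>cinfinite r\<close>; the ordinals
  below it are the elements of \<open>Field r\<close>, and \<open>\<alpha> < \<beta>\<close> is written \<open>\<alpha> \<in> underS r \<beta>\<close>.
\<close>

text \<open>
  The cofinality: the least cardinality of a cofinal subset. It is determined up to \<open>=o\<close>.
\<close>

definition cf :: "'a rel \<Rightarrow> 'a rel" where
  "cf r = (SOME k. k \<in> {|K| |K. K \<subseteq> Field r \<and> cofinal K r} \<and>
                   (\<forall>k' \<in> {|K| |K. K \<subseteq> Field r \<and> cofinal K r}. k \<le>o k'))"

definition singular_card :: "'a rel \<Rightarrow> bool" where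
  "singular_card r \<longleftrightarrow> Card_order r \<and> cinfinite r \<and> \<not> regularCard r"

definition closed_in :: "'a rel \<Rightarrow> 'a set \<Rightarrow> bool" where
  "closed_in r C \<longleftrightarrow>
     (\<forall>\<delta> \<in> Field r. underS r \<delta> \<noteq> {} \<and>
        (\<forall>\<alpha> \<in> underS r \<delta>. \<exists>\<gamma> \<in> C. \<alpha> \<in> underS r \<gamma> \<and> \<gamma> \<in> underS r \<delta>) \<longrightarrow> \<delta> \<in> C)"

definition club :: "'a rel \<Rightarrow> 'a set \<Rightarrow> bool" where
  "club r C \<longleftrightarrow> C \<subseteq> Field r \<and> cofinal C r \<and> closed_in r C"

definition stationary :: "'a rel \<Rightarrow> 'a set \<Rightarrow> bool" where
  "stationary r S \<longleftrightarrow> S \<subseteq> Field r \<and> (\<forall>C. club r C \<longrightarrow> S \<inter> C \<noteq> {})"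

text \<open>
  Ideals on a cardinal are proper and contain all bounded sets, by convention.
\<close>

definition ideal_on :: "'a rel \<Rightarrow> 'a set set \<Rightarrow> bool" where
  "ideal_on r I \<longleftrightarrow>
     I \<subseteq> Pow (Field r) \<and>
     {} \<in> I \<and>
     (\<forall>A B. A \<in> I \<and> B \<subseteq> A \<longrightarrow> B \<in> I) \<and>
     (\<forall>A B. A \<in> I \<and> B \<in> I \<longrightarrow> A \<union> B \<in> I) \<and>
     Field r \<notin> I \<and>
     (\<forall>\<beta> \<in> Field r. \<forall>A. A \<subseteq> underS r \<beta> \<longrightarrow> A \<in> I)"

definition indecomposable :: "'b rel \<Rightarrow> 'a set set \<Rightarrow> bool" where
  "indecomposable \<sigma> I \<longleftrightarrow>
     (\<forall>A. relChain \<sigma> A \<and> (\<forall>i \<in> Field \<sigma>. A i \<in> I) \<longrightarrow> (\<Union>i \<in> Field \<sigma>. A i) \<in> I)"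

definition almost_all :: "'a rel \<Rightarrow> 'a set set \<Rightarrow> ('a \<Rightarrow> bool) \<Rightarrow> bool" where
  "almost_all r I P \<longleftrightarrow> {\<beta> \<in> Field r. \<not> P \<beta>} \<in> I"

text \<open>
  The minimum in the definition of \<open>cf\<close> is attained for every infinite cardinal.
\<close>

lemma cf_attained:
  assumes "Card_order r" "cinfinite r"
  shows "\<exists>K. K \<subseteq> Field r \<and> cofinal K r \<and> cf r = |K|"
    and "\<And>K. K \<subseteq> Field r \<Longrightarrow> cofinal K r \<Longrightarrow> cf r \<le>o |K|"
proof -
  let ?R = "{|K| |K. K \<subseteq> Field r \<and> cofinal K r}"
  have "cofinal (Field r) r"
    unfolding cofinal_def
  proof
    fix a assume "a \<in> Field r"
    moreover have "infinite (Field r)" using assms(2) by (simp add: cinfinite_def)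
    ultimately show "\<exists>b \<in> Field r. a \<noteq> b \<and> (a, b) \<in> r"
      using infinite_Card_order_limit[OF assms(1)] by simp
  qed
  then have "?R \<noteq> {}" by blast
  moreover have "\<forall>k \<in> ?R. Card_order k"
  proof
    fix k assume "k \<in> ?R"
    then obtain K where "k = |K|" by blast
    then show "Card_order k" by (simp add: card_of_Card_order)
  qed
  ultimately have "\<exists>k. k \<in> ?R \<and> (\<forall>k' \<in> ?R. k \<le>o k')"
    using exists_minim_Card_order[of ?R] unfolding Bex_def by simp
  then have *: "cf r \<in> ?R \<and> (\<forall>k' \<in> ?R. cf r \<le>o k')"
    unfolding cf_def by (rule someI_ex)
  then show "\<exists>K. K \<subseteq> Field r \<and> cofinal K r \<and> cf r = |K|" by blast
  fix K assume "K \<subseteq> Field r" "cofinal K r"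
  then show "cf r \<le>o |K|" using * by blast
qed

end

theory Submission
  imports Defs Complex_Main
begin

text \<open>
  Fix cardinals \<open>|T 0| < |T 1| < ...\<close> cofinal in \<open>\<mu>\<close> and a scale \<open>f\<close> of length \<open>\<mu>\<^sup>+\<close> in a product
  \<open>\<Prod>n. H n\<close> modulo finite, where \<open>H n\<close> has cofinality \<open>|T (n + 1)|\<close>; the scale comes from an exact
  upper bound of a sequence that increases modulo finite. For \<open>\<delta>\<close> of cofinality \<open>\<omega>\<close> and a club \<open>D\<close>, the set
  \<open>fill D \<delta> m\<close> of size at most \<open>|T m|\<close> arises from a cofinal \<open>\<omega>\<close>-sequence in \<open>\<delta>\<close> by moving points down
  to \<open>D\<close> and adding ladders below points of cofinality at most \<open>|T m|\<close>. For a suitable \<open>D\<close> these sets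
  guess clubs: every club contains, for some \<open>\<delta>\<close> in it and all \<open>m\<close>, points of \<open>fill D \<delta> m\<close> of
  cofinality above \<open>|T m|\<close> beyond the first \<open>m\<close> terms of the sequence. The ideal \<open>I\<close> consists of the
  sets for which this guessing fails on some club. It is indecomposable for uncountable regular
  \<open>\<sigma>\<close> because the failure at \<open>\<delta>\<close> is witnessed by a natural number, which can be kept constant
  on a cofinal set of indices.

  The color of a pair \<open>x < y\<close> uses the last \<open>m\<close> with \<open>f x m \<ge> f y m\<close>: walk from \<open>y\<close> towards \<open>x\<close> along
  ladders and take the least element above \<open>x\<close> of the sets \<open>fill D \<delta> m\<close> for \<open>\<delta>\<close> in the ladders met on
  the way. If \<open>b \<in> fill D \<delta> m\<close> has cofinality above \<open>|T m|\<close>, the scale provides \<open>\<alpha>\<close> with \<open>t \<alpha>\<close>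
  arbitrarily close below \<open>b\<close> and \<open>\<beta>\<close> above \<open>\<delta>\<close> such that all pairs from \<open>t \<alpha> \<times> t \<beta>\<close> yield this
  \<open>m\<close>, and then they all get the color \<open>b\<close>.
\<close>

section \<open>Cardinality of sets\<close>

text \<open>The order of the choices shapes the proof. For a color \<open>b\<close> in a set
  \<open>fill D \<delta> m\<close>, the index \<beta> is fixed from \<delta> alone, before
  \<open>b\<close>, whereas \<alpha> has to be found below \<open>b\<close> afterwards. Let the
  cofinality of \<open>b\<close> be above \<open>|T k|\<close> and at most
  \<open>|T (k + 1)|\<close>. At coordinate \<open>k\<close> the values of \<open>t \<alpha>\<close>
  have to exceed those of \<open>t \<beta>\<close>, and at every \<open>n > k\<close> they have to
  lie below them. So \<beta> must dominate in advance, beyond \<open>k\<close>, every \<alpha> that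
  may be needed later. This works because these are few: \<open>b\<close> ranges over at most
  \<open>|T k|\<close> points, the lower bound for \<alpha> over a ladder of size at most
  \<open>|T (k + 1)|\<close>, and the value to be exceeded over a cofinal part of \<open>H k\<close>
  inside \<open>T (k + 1)\<close>. At a coordinate \<open>n > k\<close> this amounts to at most
  \<open>|T n|\<close> values, fewer than the cofinality of \<open>H n\<close>. Both bounds on the
  cofinality of \<open>H n\<close> have their origin here. The exact upper bound is obtained by the
  pcf method of bounding projections.\<close>

lemma card_le_image:
  assumes "|A| \<le>o |B|"
  shows "|f ` A| \<le>o |B|"
  using card_of_image assms by (rule ordLeq_transitive)

lemma card_le_subset:
  assumes "A \<subseteq> A'" "|A'| \<le>o |B|"
  shows "|A| \<le>o |B|"
  using card_of_mono1[OF assms(1)] assms(2) by (rule ordLeq_transitive)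

lemma card_le_Un:
  assumes "infinite C" "|A| \<le>o |C|" "|B| \<le>o |C|"
  shows "|A \<union> B| \<le>o |C|"
  using card_of_Un_ordLeq_infinite_Field[OF _ assms(2,3) card_of_Card_order] assms(1)
  by (simp add: Field_card_of)

lemma card_le_countable:
  fixes N :: "'i::countable set"
  assumes "infinite B"
  shows "|N| \<le>o |B|"
proof -
  have "|N| \<le>o |UNIV :: nat set|"
    by (rule card_of_ordLeqI[of to_nat]) (auto intro: inj_on_subset[OF inj_to_nat])
  then show ?thesis
    using assms infinite_iff_card_of_nat ordLeq_transitive by blast
qed

lemma card_le_finite:
  assumes "infinite B" "finite A"
  shows "|A| \<le>o |B|"
proof -
  obtain f :: "_ \<Rightarrow> nat" and n where "f ` A = {i. i < n}" "inj_on f A"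
    using finite_imp_inj_to_nat_seg[OF assms(2)] by blast
  then have "|A| \<le>o |UNIV :: nat set|" by (intro card_of_ordLeqI[of f]) auto
  then show ?thesis
    using assms(1) infinite_iff_card_of_nat ordLeq_transitive by blast
qed

lemma card_le_insert:
  assumes "infinite B" "|A| \<le>o |B|"
  shows "|insert x A| \<le>o |B|"
  using card_le_Un[OF assms(1) card_le_finite[OF assms(1), of "{x}"] assms(2)] by simp

lemma card_le_UN:
  assumes "infinite B" "|I| \<le>o |B|" "\<And>i. i \<in> I \<Longrightarrow> |A i| \<le>o |B|"
  shows "|\<Union>i\<in>I. A i| \<le>o |B|"
  using card_of_UNION_ordLeq_infinite assms by blast

lemma card_le_total: "|A| \<le>o |B| \<or> |B| \<le>o |A|"
  by (rule ordLeq_total[OF card_of_Well_order card_of_Well_order])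

lemma card_less_iff: "|A| <o |B| \<longleftrightarrow> \<not> |B| \<le>o |A|"
  using not_ordLeq_iff_ordLess[OF card_of_Well_order card_of_Well_order] by blast

lemma subset_of_card:
  assumes "|B| \<le>o |A|"
  obtains Y where "Y \<subseteq> A" "|Y| \<le>o |B|" "|B| \<le>o |Y|"
proof -
  obtain f where "inj_on f B" "f ` B \<subseteq> A" using assms card_of_ordLeq[of B A] by auto
  moreover have "|B| \<le>o |f ` B|" by (rule card_of_ordLeqI[OF \<open>inj_on f B\<close>]) simp
  ultimately show thesis using that[of "f ` B"] card_of_image[of f B] by simp
qed

text \<open>Countably many classes of size at most \<open>|B|\<close> have a union of size at most
  \<open>|B|\<close>. The lemma serves to make an index that depends on a point constant on a set
  that is still large.\<close>

lemma card_pigeonhole: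
  fixes k :: "'a \<Rightarrow> 'i::countable"
  assumes B: "infinite B" and A: "\<not> |A| \<le>o |B|"
  shows "\<exists>n. \<not> |{x \<in> A. k x = n}| \<le>o |B|"
proof (rule ccontr)
  assume "\<not> ?thesis"
  then have "|{x \<in> A. k x = n}| \<le>o |B|" for n by blast
  then have "|\<Union>n\<in>UNIV. {x \<in> A. k x = n}| \<le>o |B|"
    by (rule card_le_UN[OF B card_le_countable[OF B]])
  moreover have "A = (\<Union>n\<in>UNIV. {x \<in> A. k x = n})" by auto
  ultimately show False using A by simp
qed

section \<open>Well-orders\<close>

text \<open>The order lives on the whole type, so that least elements, suprema and recursion need no
  membership conditions; the cardinals in question are initial segments such as
  \<open>F\<close>.\<close>

locale ordinals = wellorder le lt
  for le :: "'b \<Rightarrow> 'b \<Rightarrow> bool" (infix "\<sqsubseteq>" 50) and lt :: "'b \<Rightarrow> 'b \<Rightarrow> bool" (infix "\<sqsubset>" 50)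
begin

definition below :: "'b \<Rightarrow> 'b set" where "below x = {y. y \<sqsubset> x}"

definition least_of :: "'b set \<Rightarrow> 'b" where "least_of A = Least (\<lambda>x. x \<in> A)"

definition lub :: "'b set \<Rightarrow> 'b" where "lub X = least_of {z. \<forall>x\<in>X. x \<sqsubseteq> z}"

definition bot_elt :: 'b where "bot_elt = least_of UNIV"

definition limit_of :: "'b set \<Rightarrow> 'b \<Rightarrow> bool" where
  "limit_of C d \<longleftrightarrow> (\<exists>x. x \<sqsubset> d) \<and> (\<forall>x. x \<sqsubset> d \<longrightarrow> (\<exists>c\<in>C. x \<sqsubset> c \<and> c \<sqsubset> d))"

definition club_on :: "'b set \<Rightarrow> 'b set \<Rightarrow> bool" where
  "club_on W C \<longleftrightarrow> C \<subseteq> W \<and> (\<forall>x\<in>W. \<exists>c\<in>C. x \<sqsubset> c) \<and> (\<forall>d\<in>W. limit_of C d \<longrightarrow> d \<in> C)"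

text \<open>
  \<open>cof_le z B\<close> says that the cofinality of \<open>z\<close> is at most the cardinality of \<open>B\<close>; successors and the
  least element satisfy it for every infinite \<open>B\<close>. \<open>regular_on W B\<close> is used with \<open>W\<close> a regular
  cardinal above \<open>|B|\<close> whose initial segments have size at most \<open>|B|\<close>, and \<open>next_card B\<close> is the
  ordinal \<open>|B|\<^sup>+\<close>.
\<close>

definition cof_le :: "'b \<Rightarrow> 'c set \<Rightarrow> bool" where
  "cof_le z B \<longleftrightarrow> (\<exists>X\<subseteq>below z. (\<forall>x. x \<sqsubset> z \<longrightarrow> (\<exists>y\<in>X. x \<sqsubseteq> y)) \<and> |X| \<le>o |B| )"

definition regular_on :: "'b set \<Rightarrow> 'c set \<Rightarrow> bool" where
  "regular_on W B \<longleftrightarrow> infinite B \<and> (\<forall>x\<in>W. below x \<subseteq> W \<and> |below x| \<le>o |B| ) \<and>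
     (\<forall>X\<subseteq>W. |X| \<le>o |B| \<longrightarrow> (\<exists>b\<in>W. \<forall>x\<in>X. x \<sqsubset> b))"

definition next_card :: "'c set \<Rightarrow> 'b" where "next_card B = least_of {x. \<not> |below x| \<le>o |B|}"

lemma least_of_in: "A \<noteq> {} \<Longrightarrow> least_of A \<in> A"
  unfolding least_of_def by (metis LeastI all_not_in_conv)

lemma least_of_le: "a \<in> A \<Longrightarrow> least_of A \<sqsubseteq> a"
  unfolding least_of_def by (simp add: Least_le)

lemma below_iff[simp]: "y \<in> below x \<longleftrightarrow> y \<sqsubset> x"
  by (simp add: below_def)

lemma bot_elt_le: "bot_elt \<sqsubseteq> x"
  unfolding bot_elt_def by (simp add: least_of_le)

lemma below_mono: "x \<sqsubseteq> y \<Longrightarrow> below x \<subseteq> below y"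
  by (auto simp: below_def)

lemma lub_ub: "(\<And>x. x \<in> X \<Longrightarrow> x \<sqsubseteq> b) \<Longrightarrow> x \<in> X \<Longrightarrow> x \<sqsubseteq> lub X"
  unfolding lub_def using least_of_in[of "{z. \<forall>x\<in>X. x \<sqsubseteq> z}"] by blast

lemma lub_le: "(\<And>x. x \<in> X \<Longrightarrow> x \<sqsubseteq> b) \<Longrightarrow> lub X \<sqsubseteq> b"
  unfolding lub_def by (simp add: least_of_le)

lemma lub_gt: "y \<sqsubset> lub X \<Longrightarrow> \<exists>x\<in>X. y \<sqsubset> x"
  by (metis leD lub_le not_le)

lemma wf_lt: "wf {(x, y). x \<sqsubset> y}"
  by (rule wf)

text \<open>Recursion as an existence statement, so that a proof can define recursively objects that
  depend on its local context.\<close>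

lemma rec_exists: "\<exists>h. \<forall>i. h i = G (\<lambda>j. if j \<sqsubset> i then h j else undefined) i"
proof (intro exI allI)
  fix i
  show "wfrec {(x, y). x \<sqsubset> y} G i =
    G (\<lambda>j. if j \<sqsubset> i then wfrec {(x, y). x \<sqsubset> y} G j else undefined) i"
    using wfrec[OF wf_lt, of G i] by (simp add: cut_def)
qed

lemma limI: "x \<sqsubset> d \<Longrightarrow> (\<And>x. x \<sqsubset> d \<Longrightarrow> \<exists>c\<in>C. x \<sqsubset> c \<and> c \<sqsubset> d) \<Longrightarrow> limit_of C d"
  unfolding limit_of_def by blast

lemma limD: "limit_of C d \<Longrightarrow> x \<sqsubset> d \<Longrightarrow> \<exists>c\<in>C. x \<sqsubset> c \<and> c \<sqsubset> d"
  unfolding limit_of_def by blast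

lemma lim_mono: "limit_of C d \<Longrightarrow> C \<subseteq> C' \<Longrightarrow> limit_of C' d"
  unfolding limit_of_def by blast

lemma clubD:
  assumes "club_on W C"
  shows "C \<subseteq> W" "x \<in> W \<Longrightarrow> \<exists>c\<in>C. x \<sqsubset> c" "d \<in> W \<Longrightarrow> limit_of C d \<Longrightarrow> d \<in> C"
  using assms unfolding club_on_def by blast+

lemma regD:
  assumes "regular_on W B"
  shows "infinite B" "x \<in> W \<Longrightarrow> y \<sqsubset> x \<Longrightarrow> y \<in> W" "x \<in> W \<Longrightarrow> |below x| \<le>o |B|"
    "X \<subseteq> W \<Longrightarrow> |X| \<le>o |B| \<Longrightarrow> \<exists>b\<in>W. \<forall>x\<in>X. x \<sqsubset> b"
  using assms unfolding regular_on_def below_def by blast+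

lemma reg_ne: "regular_on W B \<Longrightarrow> W \<noteq> {}"
  using regD(4)[of W B "{}"] by (auto simp: card_of_empty)

lemma reg_next: "regular_on W B \<Longrightarrow> x \<in> W \<Longrightarrow> \<exists>y\<in>W. x \<sqsubset> y"
  using regD(4)[of W B "{x}"] card_le_finite[OF regD(1), of W B "{x}"] by auto

lemma reg_le: "regular_on W B \<Longrightarrow> x \<in> W \<Longrightarrow> y \<sqsubseteq> x \<Longrightarrow> y \<in> W"
  using regD(2) by (metis le_less)

lemma reg_bound:
  assumes "regular_on W B" "|I| \<le>o |B|" "\<And>i. i \<in> I \<Longrightarrow> g i \<in> W"
  shows "\<exists>b\<in>W. \<forall>i\<in>I. g i \<sqsubset> b"
  using regD(4)[OF assms(1), of "g ` I"] card_le_image[OF assms(2)] assms(3) by auto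

lemma reg_ub2: "regular_on W B \<Longrightarrow> x \<in> W \<Longrightarrow> y \<in> W \<Longrightarrow> \<exists>b\<in>W. x \<sqsubset> b \<and> y \<sqsubset> b"
  using regD(4)[of W B "{x, y}"] card_le_finite[OF regD(1), of W B "{x, y}"] by auto

lemma reg_club_self: "regular_on W B \<Longrightarrow> club_on W W"
  unfolding club_on_def using reg_next by blast

lemma not_cof_le_bound:
  assumes "\<not> cof_le z B" "|X| \<le>o |B|" "X \<subseteq> below z"
  shows "\<exists>b. b \<sqsubset> z \<and> (\<forall>x\<in>X. x \<sqsubset> b)"
  using assms unfolding cof_le_def by (meson not_le)

lemma cof_le_mono: "cof_le z B \<Longrightarrow> |B| \<le>o |B'| \<Longrightarrow> cof_le z B'"
  unfolding cof_le_def using ordLeq_transitive by blast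

lemma next_card_gt: "\<not> |below x| \<le>o |B| \<Longrightarrow> \<not> |below (next_card B)| \<le>o |B|"
  unfolding next_card_def using least_of_in[of "{x. \<not> |below x| \<le>o |B|}"] by blast

lemma next_card_le: "\<not> |below x| \<le>o |B| \<Longrightarrow> next_card B \<sqsubseteq> x"
  unfolding next_card_def by (simp add: least_of_le)

lemma next_card_below: "y \<sqsubset> next_card B \<Longrightarrow> |below y| \<le>o |B|"
  using next_card_le leD by blast

lemma below_Union:
  assumes "\<And>x. x \<sqsubset> z \<Longrightarrow> \<exists>y\<in>X. x \<sqsubseteq> y"
  shows "below z \<subseteq> (\<Union>y\<in>X. insert y (below y))"
proof
  fix x assume "x \<in> below z"
  then obtain y where "y \<in> X" "x \<sqsubseteq> y" using assms by auto
  then show "x \<in> (\<Union>y\<in>X. insert y (below y))" by (auto simp: le_less)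
qed

text \<open>Successor cardinals are regular: an unbounded set of size at most \<open>|B|\<close>
  would exhaust the successor by \<open>|B|\<close> many segments of size at most
  \<open>|B|\<close>.\<close>

lemma reg_nx:
  assumes "infinite B" "\<not> |below x| \<le>o |B|"
  shows "regular_on (below (next_card B)) B"
proof -
  have "\<exists>b\<in>below (next_card B). \<forall>x\<in>X. x \<sqsubset> b" if X: "X \<subseteq> below (next_card B)" "|X| \<le>o |B|" for X
  proof (rule ccontr)
    assume "\<not> ?thesis"
    then have "below (next_card B) \<subseteq> (\<Union>y\<in>X. insert y (below y))"
      by (intro below_Union) (meson below_iff not_le)
    moreover have "|\<Union>y\<in>X. insert y (below y)| \<le>o |B|"
      using X by (intro card_le_UN card_le_insert assms(1) next_card_below) auto
    ultimately show False using next_card_gt[OF assms(2)] card_le_subset by blast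
  qed
  moreover have "below y \<subseteq> below (next_card B)" if "y \<in> below (next_card B)" for y
    using that by (auto simp: below_def)
  ultimately show ?thesis unfolding regular_on_def using assms(1) next_card_below by auto
qed

text \<open>No cardinal lies strictly between \<open>|A|\<close> and its successor. A subset of the
  successor of size \<open>|B|\<close> is either bounded, hence of size at most \<open>|A|\<close>,
  or cofinal, and then \<open>|B|\<close> many small segments exhaust the successor.\<close>

lemma next_card_card:
  assumes "infinite A" "\<not> |B| \<le>o |A|"
  shows "|below (next_card A)| \<le>o |B|"
proof (rule ccontr)
  assume n: "\<not> ?thesis"
  have AB: "|A| \<le>o |B|" using assms(2) card_le_total by blast
  then have infB: "infinite B" using assms(1) card_of_ordLeq_finite by blast
  have nA: "\<not> |below (next_card A)| \<le>o |A|" using n AB ordLeq_transitive by blast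
  obtain Y where Y: "Y \<subseteq> below (next_card A)" "|Y| \<le>o |B|" "|B| \<le>o |Y|"
    using n card_le_total subset_of_card by meson
  show False
  proof (cases "\<exists>b\<in>below (next_card A). \<forall>y\<in>Y. y \<sqsubset> b")
    case True
    then obtain b where b: "b \<sqsubset> next_card A" "Y \<subseteq> below b" unfolding below_def by blast
    then have "|Y| \<le>o |A|" using next_card_below card_le_subset by blast
    then show False using assms(2) ordLeq_transitive[OF Y(3)] by blast
  next
    case False
    then have "below (next_card A) \<subseteq> (\<Union>y\<in>Y. insert y (below y))"
      by (intro below_Union) (meson below_iff not_le)
    moreover have "|\<Union>y\<in>Y. insert y (below y)| \<le>o |B|"
      using Y(1,2) ordLeq_transitive[OF next_card_below AB]
      by (intro card_le_UN card_le_insert infB) auto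
    ultimately show False using n card_le_subset by blast
  qed
qed

section \<open>Closed unbounded sets\<close>

lemma reg_lub:
  assumes "regular_on W B" "X \<subseteq> W" "|X| \<le>o |B|"
  shows "lub X \<in> W" "x \<in> X \<Longrightarrow> x \<sqsubseteq> lub X"
proof -
  obtain b where b: "b \<in> W" "\<forall>x\<in>X. x \<sqsubset> b" using regD(4)[OF assms] by blast
  then have "lub X \<sqsubseteq> b" using lub_le less_imp_le by blast
  then show "lub X \<in> W" using reg_le[OF assms(1) b(1)] by blast
  show "x \<in> X \<Longrightarrow> x \<sqsubseteq> lub X" using lub_ub b less_imp_le by blast
qed

text \<open>The source of unboundedness in \<open>club_INT\<close> and \<open>club_closure\<close>:
  countable sets are bounded in \<open>W\<close>, and since \<open>g\<close> increases, the supremum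
  of its iterates is approached strictly.\<close>

lemma omega_iterate:
  assumes "regular_on W B" "x0 \<in> W" "\<And>x. x \<in> W \<Longrightarrow> g x \<in> W \<and> x \<sqsubset> g x"
  obtains p u where "p \<in> W" "x0 \<sqsubset> p" "u 0 = x0" "\<And>k::nat. u k \<in> W \<and> u k \<sqsubset> p \<and> u (Suc k) = g (u k)"
    "\<And>y. y \<sqsubset> p \<Longrightarrow> \<exists>k. y \<sqsubset> u k"
proof -
  define u where "u k = (g ^^ k) x0" for k :: nat
  have uS: "u (Suc k) = g (u k)" and u0: "u 0 = x0" for k by (auto simp: u_def)
  have uW: "u k \<in> W" for k by (induction k) (use assms u0 uS in auto)
  have "range u \<subseteq> W" "|range u| \<le>o |B|"
    using uW card_le_image[OF card_le_countable[OF regD(1)[OF assms(1)]]] by auto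
  then have l: "lub (range u) \<in> W" "u k \<sqsubseteq> lub (range u)" for k
    using reg_lub[OF assms(1)] by auto
  have "u k \<sqsubset> lub (range u)" for k
    using l(2)[of "Suc k"] assms(3)[OF uW[of k]] uS[of k] less_le_trans by auto
  moreover have "x0 \<sqsubset> lub (range u)" using calculation[of 0] u0 by simp
  moreover have "\<exists>k. y \<sqsubset> u k" if "y \<sqsubset> lub (range u)" for y
    using lub_gt[OF that] by auto
  ultimately show thesis using that[of "lub (range u)" u] l(1) uW u0 uS by simp
qed

text \<open>The factor \<open>W\<close> gives the right value for an empty index set, which occurs
  at the first stage of \<open>club_chain\<close>.\<close>

lemma club_INT:
  assumes W: "regular_on W B" and I: "|I| \<le>o |B|" and C: "\<And>i. i \<in> I \<Longrightarrow> club_on W (C i)"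
  shows "club_on W (W \<inter> (\<Inter>i\<in>I. C i))"
  unfolding club_on_def
proof (intro conjI ballI impI)
  fix x0 assume x0: "x0 \<in> W"
  have "\<exists>b\<in>W. x \<sqsubset> b \<and> (\<forall>i\<in>I. \<exists>c\<in>C i. x \<sqsubset> c \<and> c \<sqsubset> b)" if x: "x \<in> W" for x
  proof -
    have "\<forall>i\<in>I. \<exists>c\<in>C i. x \<sqsubset> c" using C clubD(2) x by blast
    then obtain c where c: "\<And>i. i \<in> I \<Longrightarrow> c i \<in> C i \<and> x \<sqsubset> c i" by metis
    then have "\<And>i. i \<in> I \<Longrightarrow> c i \<in> W" using C clubD(1) by blast
    then obtain b where b: "b \<in> W" "\<forall>i\<in>I. c i \<sqsubset> b" using reg_bound[OF W I] by blast
    obtain b' where b': "b' \<in> W" "x \<sqsubset> b'" "b \<sqsubset> b'" using reg_ub2[OF W x b(1)] by blast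
    have "\<forall>i\<in>I. \<exists>c\<in>C i. x \<sqsubset> c \<and> c \<sqsubset> b'" using b(2) b'(3) c less_trans by blast
    then show ?thesis using b' by blast
  qed
  then obtain g where g: "\<And>x. x \<in> W \<Longrightarrow> g x \<in> W \<and> x \<sqsubset> g x \<and> (\<forall>i\<in>I. \<exists>c\<in>C i. x \<sqsubset> c \<and> c \<sqsubset> g x)"
    by metis
  obtain p u where p: "p \<in> W" "x0 \<sqsubset> p" "\<And>k::nat. u k \<in> W \<and> u k \<sqsubset> p \<and> u (Suc k) = g (u k)"
    "\<And>y. y \<sqsubset> p \<Longrightarrow> \<exists>k. y \<sqsubset> u k"
    using omega_iterate[OF W x0, of g] g by blast
  have "p \<in> C i" if i: "i \<in> I" for i
  proof -
    have "limit_of (C i) p"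
    proof (rule limI[OF p(2)])
      fix y assume "y \<sqsubset> p"
      then obtain k where k: "y \<sqsubset> u k" using p(4) by blast
      obtain c where "c \<in> C i" "u k \<sqsubset> c" "c \<sqsubset> g (u k)" using g p(3) i by blast
      moreover have "g (u k) \<sqsubset> p" using p(3)[of k] p(3)[of "Suc k"] by simp
      ultimately show "\<exists>c\<in>C i. y \<sqsubset> c \<and> c \<sqsubset> p" using k less_trans by blast
    qed
    then show ?thesis using clubD(3)[OF C[OF i] p(1)] by blast
  qed
  then show "\<exists>c\<in>W \<inter> (\<Inter>i\<in>I. C i). x0 \<sqsubset> c" using p by blast
next
  fix d assume d: "d \<in> W" "limit_of (W \<inter> (\<Inter>i\<in>I. C i)) d"
  have "d \<in> C i" if "i \<in> I" for i
    using clubD(3)[OF C[OF that] d(1)] lim_mono[OF d(2)] that by blast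
  then show "d \<in> W \<inter> (\<Inter>i\<in>I. C i)" using d by blast
qed auto

lemma club_Int:
  assumes "regular_on W B" "club_on W C" "club_on W D"
  shows "club_on W (C \<inter> D)"
proof -
  have "club_on W (W \<inter> (\<Inter>X\<in>{C, D}. X))"
    using assms by (intro club_INT[of W B "{C, D}" "\<lambda>x. x"] card_le_finite regD(1)[OF assms(1)]) auto
  moreover have "W \<inter> (\<Inter>X\<in>{C, D}. X) = C \<inter> D" using clubD(1)[OF assms(2)] by auto
  ultimately show ?thesis by simp
qed

lemma club_closure:
  assumes W: "regular_on W B" and g: "\<And>x. x \<in> W \<Longrightarrow> g x \<in> W"
  shows "club_on W {p \<in> W. \<forall>x. x \<sqsubset> p \<longrightarrow> g x \<sqsubset> p}"
  unfolding club_on_def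
proof (intro conjI ballI impI)
  fix x0 assume x0: "x0 \<in> W"
  have "\<exists>b\<in>W. x \<sqsubset> b \<and> (\<forall>y. y \<sqsubseteq> x \<longrightarrow> g y \<sqsubset> b)" if x: "x \<in> W" for x
  proof -
    have i: "|insert x (below x)| \<le>o |B|" using regD(1,3)[OF W] x by (intro card_le_insert) auto
    obtain b where b: "b \<in> W" "\<forall>i\<in>insert x (below x). g i \<sqsubset> b"
      using reg_bound[OF W i, of g] g regD(2)[OF W x] x by auto
    obtain b' where b': "b' \<in> W" "x \<sqsubset> b'" "b \<sqsubset> b'" using reg_ub2[OF W x b(1)] by blast
    have "g y \<sqsubset> b'" if "y \<sqsubseteq> x" for y
      using b(2) b'(3) that less_trans[of "g y" b b'] by (cases "y = x") (auto simp: le_less)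
    then show ?thesis using b' by blast
  qed
  then obtain h where h: "\<And>x. x \<in> W \<Longrightarrow> h x \<in> W \<and> x \<sqsubset> h x \<and> (\<forall>y. y \<sqsubseteq> x \<longrightarrow> g y \<sqsubset> h x)"
    by metis
  obtain p u where p: "p \<in> W" "x0 \<sqsubset> p" "\<And>k::nat. u k \<in> W \<and> u k \<sqsubset> p \<and> u (Suc k) = h (u k)"
    "\<And>y. y \<sqsubset> p \<Longrightarrow> \<exists>k. y \<sqsubset> u k"
    using omega_iterate[OF W x0, of h] h by blast
  have "g x \<sqsubset> p" if x: "x \<sqsubset> p" for x
  proof -
    obtain k where "x \<sqsubset> u k" using p(4) x by blast
    then have "g x \<sqsubset> u (Suc k)" using h[of "u k"] p(3)[of k] by auto
    then show ?thesis using p(3) less_trans by blast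
  qed
  then show "\<exists>c\<in>{p \<in> W. \<forall>x. x \<sqsubset> p \<longrightarrow> g x \<sqsubset> p}. x0 \<sqsubset> c" using p by blast
next
  fix d assume d: "d \<in> W" "limit_of {p \<in> W. \<forall>x. x \<sqsubset> p \<longrightarrow> g x \<sqsubset> p} d"
  have "g x \<sqsubset> d" if "x \<sqsubset> d" for x
    using limD[OF d(2) that] less_trans by blast
  then show "d \<in> {p \<in> W. \<forall>x. x \<sqsubset> p \<longrightarrow> g x \<sqsubset> p}" using d by blast
qed auto

lemma club_above:
  assumes W: "regular_on W B" and x: "x \<in> W"
  shows "club_on W {p \<in> W. x \<sqsubset> p}"
  unfolding club_on_def
proof (intro conjI ballI impI)
  fix y assume y: "y \<in> W"
  then obtain z where "z \<in> W" "x \<sqsubset> z" "y \<sqsubset> z" using reg_ub2[OF W x y] by blast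
  then show "\<exists>c\<in>{p \<in> W. x \<sqsubset> p}. y \<sqsubset> c" by blast
next
  fix d assume "d \<in> W" "limit_of {p \<in> W. x \<sqsubset> p} d"
  then show "d \<in> {p \<in> W. x \<sqsubset> p}" unfolding limit_of_def by (auto intro: less_trans)
qed auto

text \<open>One formula serves for first, successor and limit stages. The bound on
  \<open>|below \<kappa>|\<close> keeps every intersection a club, up to and including stage
  \<kappa>.\<close>

lemma club_chain:
  assumes W: "regular_on W B" and \<kappa>: "|below \<kappa>| \<le>o |B|"
    and \<Psi>: "\<And>D. club_on W D \<Longrightarrow> club_on W (\<Psi> D)"
  obtains D where "\<And>i. i \<sqsubseteq> \<kappa> \<Longrightarrow> club_on W (D i)"
    "\<And>i j. i \<sqsubset> j \<Longrightarrow> D j \<subseteq> \<Psi> (D i)" "\<And>i j. i \<sqsubseteq> j \<Longrightarrow> D j \<subseteq> D i"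
proof -
  from rec_exists[of "\<lambda>D i. W \<inter> (\<Inter>j\<in>below i. \<Psi> (D j))"] obtain D where
    D0: "\<forall>i. D i = W \<inter> (\<Inter>j\<in>below i. \<Psi> (if j \<sqsubset> i then D j else undefined))" ..
  have D: "D i = W \<inter> (\<Inter>j\<in>below i. \<Psi> (D j))" for i using D0[rule_format, of i] by simp
  show thesis
  proof
    fix i show "i \<sqsubseteq> \<kappa> \<Longrightarrow> club_on W (D i)"
    proof (induction i rule: less_induct)
      case (less i)
      have "|below i| \<le>o |B|" using below_mono[OF less.prems] \<kappa> card_le_subset by blast
      then show ?case
        unfolding D[of i] using less by (intro club_INT[OF W] \<Psi>) auto
    qed
  next
    fix i j show "i \<sqsubset> j \<Longrightarrow> D j \<subseteq> \<Psi> (D i)" by (auto simp: D[of j])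
  next
    fix i j show "i \<sqsubseteq> j \<Longrightarrow> D j \<subseteq> D i" unfolding D[of i] D[of j] by auto
  qed
qed

text \<open>The least value, once taken, can only be kept. This fixes the results of rounding down
  to a decreasing chain of clubs and of rounding up to an increasing chain of sets.\<close>

lemma antimono_stable:
  assumes "x0 \<sqsubset> \<kappa>" "\<And>i j. i \<sqsubseteq> j \<Longrightarrow> j \<sqsubset> \<kappa> \<Longrightarrow> u j \<sqsubseteq> u i"
  shows "\<exists>i. i \<sqsubset> \<kappa> \<and> (\<forall>j. i \<sqsubseteq> j \<longrightarrow> j \<sqsubset> \<kappa> \<longrightarrow> u j = u i)"
proof -
  have "u ` below \<kappa> \<noteq> {}" using assms(1) by auto
  from least_of_in[OF this] obtain i where i: "i \<sqsubset> \<kappa>" "u i = least_of (u ` below \<kappa>)" by auto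
  have "u j = u i" if j: "i \<sqsubseteq> j" "j \<sqsubset> \<kappa>" for j
  proof -
    have "u i \<sqsubseteq> u j" unfolding i(2) using j(2) by (intro least_of_le) auto
    then show ?thesis using assms(2)[OF j] by order
  qed
  then show ?thesis using i(1) by blast
qed

text \<open>The point \<rho> is the supremum of the first \<open>|B'|\<^sup>+\<close> points of
  \<open>E\<close> above \<eta>, defined as the least ordinal with more than \<open>|B'|\<close>
  such points below it. Its cofinality is that successor cardinal, which the last clause expresses
  without naming a set of this size.\<close>

lemma club_point_cofinality:
  assumes W: "regular_on W B" and E: "club_on W E" and \<eta>: "\<eta> \<in> W"
    and B': "infinite B'" "\<not> |B| \<le>o |B'|"
  obtains \<rho> where "\<rho> \<in> W" "\<eta> \<sqsubset> \<rho>" "limit_of E \<rho>" "\<not> cof_le \<rho> B'"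
    "\<And>B1::'d set. \<not> |B1| \<le>o |B'| \<Longrightarrow> cof_le \<rho> B1"
proof -
  define X where "X z = {e \<in> E. \<eta> \<sqsubset> e \<and> e \<sqsubset> z}" for z
  let ?P = "{z. \<not> |X z| \<le>o |B'|}"
  have "\<exists>z\<in>W. z \<in> ?P"
  proof -
    let ?E = "{e \<in> E. \<eta> \<sqsubset> e}"
    have EW: "E \<subseteq> W" using clubD(1)[OF E] .
    have "\<not> |?E| \<le>o |B|"
    proof
      assume "|?E| \<le>o |B|"
      then obtain b where b: "b \<in> W" "\<forall>e\<in>?E. e \<sqsubset> b" using regD(4)[OF W, of ?E] EW by blast
      obtain b' where b': "b' \<in> W" "\<eta> \<sqsubset> b'" "b \<sqsubset> b'" using reg_ub2[OF W \<eta> b(1)] by blast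
      then obtain c where c: "c \<in> E" "b' \<sqsubset> c" using clubD(2)[OF E] by blast
      have "\<eta> \<sqsubset> c" "b \<sqsubset> c" using b' c by order+
      then have "c \<sqsubset> b" using b(2) c by blast
      then show False using \<open>b \<sqsubset> c\<close> by order
    qed
    then obtain Y where Y: "Y \<subseteq> ?E" "|Y| \<le>o |B|" "|B| \<le>o |Y|"
      using card_le_total subset_of_card by meson
    obtain z where z: "z \<in> W" "\<forall>y\<in>Y. y \<sqsubset> z" using regD(4)[OF W, of Y] Y EW by blast
    have "Y \<subseteq> X z" using Y z unfolding X_def by blast
    then have "\<not> |X z| \<le>o |B'|"
      using B'(2) ordLeq_transitive[OF Y(3) card_le_subset[of Y "X z" B']] by blast
    then show ?thesis using z by blast
  qed
  then obtain z where z: "z \<in> W" "z \<in> ?P" by blast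
  define \<rho> where "\<rho> = least_of ?P"
  have \<rho>P: "\<not> |X \<rho>| \<le>o |B'|" using least_of_in[of ?P] z unfolding \<rho>_def by blast
  have \<rho>min: "|X y| \<le>o |B'|" if "y \<sqsubset> \<rho>" for y
    using that least_of_le[of y ?P] unfolding \<rho>_def using leD by blast
  have "\<rho> \<sqsubseteq> z" using least_of_le[of z ?P] z unfolding \<rho>_def by blast
  then have \<rho>W: "\<rho> \<in> W" using reg_le[OF W z(1)] by blast
  have bnd: "|{e \<in> E. \<eta> \<sqsubset> e \<and> e \<sqsubseteq> y}| \<le>o |B'|" if "y \<sqsubset> \<rho>" for y
    by (rule card_le_subset[of _ "insert y (X y)"])
       (use \<rho>min[OF that] B'(1) in \<open>auto simp: X_def le_less intro: card_le_insert\<close>)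
  have \<eta>\<rho>: "\<eta> \<sqsubset> \<rho>"
  proof (rule ccontr)
    assume "\<not> \<eta> \<sqsubset> \<rho>"
    then have "X \<rho> = {}" unfolding X_def by auto
    then show False using \<rho>P card_le_finite[OF B'(1)] by auto
  qed
  have lm: "limit_of E \<rho>"
  proof (rule limI[OF \<eta>\<rho>], rule ccontr)
    fix x assume x: "x \<sqsubset> \<rho>" "\<not> (\<exists>c\<in>E. x \<sqsubset> c \<and> c \<sqsubset> \<rho>)"
    then have "X \<rho> \<subseteq> {e \<in> E. \<eta> \<sqsubset> e \<and> e \<sqsubseteq> x}" unfolding X_def by auto
    then show False using \<rho>P bnd[OF x(1)] card_le_subset by blast
  qed
  have nc: "\<not> cof_le \<rho> B'"
  proof
    assume "cof_le \<rho> B'"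
    then obtain Y where Y: "Y \<subseteq> below \<rho>" "\<forall>x. x \<sqsubset> \<rho> \<longrightarrow> (\<exists>y\<in>Y. x \<sqsubseteq> y)" "|Y| \<le>o |B'|"
      unfolding cof_le_def by blast
    have "X \<rho> \<subseteq> (\<Union>y\<in>Y. {e \<in> E. \<eta> \<sqsubset> e \<and> e \<sqsubseteq> y})" using Y(2) unfolding X_def by blast
    moreover have "|\<Union>y\<in>Y. {e \<in> E. \<eta> \<sqsubset> e \<and> e \<sqsubseteq> y}| \<le>o |B'|"
      using Y bnd by (intro card_le_UN B'(1)) auto
    ultimately show False using \<rho>P card_le_subset by blast
  qed
  have "cof_le \<rho> B1" if B1: "\<not> |B1| \<le>o |B'|" for B1 :: "'d set"
  proof (cases "|X \<rho>| \<le>o |B1|")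
    case True
    have "\<exists>y\<in>X \<rho>. x \<sqsubseteq> y" if "x \<sqsubset> \<rho>" for x
    proof -
      have "max x \<eta> \<sqsubset> \<rho>" using that \<eta>\<rho> by simp
      then obtain c where "c \<in> E" "max x \<eta> \<sqsubset> c" "c \<sqsubset> \<rho>" using limD[OF lm] by blast
      then show ?thesis unfolding X_def by (auto intro!: bexI[of _ c])
    qed
    then show ?thesis unfolding cof_le_def using True
      by (intro exI[of _ "X \<rho>"]) (auto simp: X_def)
  next
    case False
    then obtain Y where Y: "Y \<subseteq> X \<rho>" "|Y| \<le>o |B1|" "|B1| \<le>o |Y|"
      using card_le_total subset_of_card by meson
    have "\<exists>y\<in>Y. x \<sqsubseteq> y" if x: "x \<sqsubset> \<rho>" for x
    proof (rule ccontr)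
      assume "\<not> (\<exists>y\<in>Y. x \<sqsubseteq> y)"
      then have "Y \<subseteq> {e \<in> E. \<eta> \<sqsubset> e \<and> e \<sqsubseteq> x}" using Y(1) unfolding X_def by auto
      then have "|Y| \<le>o |B'|" using bnd[OF x] card_le_subset by blast
      then show False using B1 ordLeq_transitive[OF Y(3)] by blast
    qed
    then show ?thesis unfolding cof_le_def using Y(1,2) by (intro exI[of _ Y]) (auto simp: X_def)
  qed
  then show thesis using that \<rho>W \<eta>\<rho> lm nc by blast
qed

end

section \<open>Club guessing and ladders\<close>

context ordinals
begin

text \<open>For a club \<open>D\<close> this is the last point of \<open>D\<close> at or below
  \<gamma>. Without such a point it is the supremum of the empty set, so \<open>bot_elt\<close> acts
  as the default value.\<close>

definition last_below :: "'b set \<Rightarrow> 'b \<Rightarrow> 'b" where "last_below D \<gamma> = lub {d \<in> D. d \<sqsubseteq> \<gamma>}"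

lemma last_below_le: "last_below D \<gamma> \<sqsubseteq> \<gamma>"
  unfolding last_below_def by (rule lub_le) simp

lemma last_below_ge: "d \<in> D \<Longrightarrow> d \<sqsubseteq> \<gamma> \<Longrightarrow> d \<sqsubseteq> last_below D \<gamma>"
  unfolding last_below_def by (rule lub_ub[of _ \<gamma>]) auto

lemma last_below_antimono: "D' \<subseteq> D \<Longrightarrow> last_below D' \<gamma> \<sqsubseteq> last_below D \<gamma>"
  unfolding last_below_def[of D'] by (rule lub_le) (auto intro: last_below_ge)

lemma last_below_in:
  assumes "club_on W D" "\<gamma> \<in> W" "\<And>y. y \<sqsubset> \<gamma> \<Longrightarrow> y \<in> W"
  shows "last_below D \<gamma> \<in> insert bot_elt D"
proof (rule ccontr)
  assume n: "last_below D \<gamma> \<notin> insert bot_elt D"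
  have W: "last_below D \<gamma> \<in> W" using last_below_le[of D \<gamma>] assms(2,3) by (auto simp: le_less)
  have "bot_elt \<sqsubset> last_below D \<gamma>" using n bot_elt_le[of "last_below D \<gamma>"] by (auto simp: le_less)
  moreover have "\<exists>c\<in>D. y \<sqsubset> c \<and> c \<sqsubset> last_below D \<gamma>" if yl: "y \<sqsubset> last_below D \<gamma>" for y
  proof -
    obtain d where d: "d \<in> D" "d \<sqsubseteq> \<gamma>" "y \<sqsubset> d" using lub_gt[OF yl[unfolded last_below_def]] by blast
    then have "d \<sqsubset> last_below D \<gamma>" using last_below_ge[OF d(1,2)] n by (auto simp: le_less)
    then show ?thesis using d by blast
  qed
  ultimately have "last_below D \<gamma> \<in> D" using clubD(3)[OF assms(1) W] limI by blast
  then show False using n by blast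
qed

text \<open>
  If every guess \<open>drop D\<close> failed, iterating the failure would give a decreasing chain of clubs \<open>D i\<close>
  of length above \<open>|B1|\<close>; the values \<open>last_below (D i) \<gamma>\<close> decrease with \<open>i\<close>, hence stabilize
  simultaneously for the at most \<open>|B1|\<close> many \<open>\<gamma>\<close> in a cofinal set.
\<close>

lemma club_guessing:
  assumes B: "infinite B0" "infinite B1" "\<not> |B1| \<le>o |B0|" "\<not> |B2| \<le>o |B1|"
    and x0: "\<not> |below x0| \<le>o |B1|" and W: "regular_on W B2"
  obtains C where "\<And>E. club_on W E \<Longrightarrow> \<exists>a\<in>W. C a \<subseteq> E \<and> C a \<subseteq> below a \<and>
    (\<forall>x. x \<sqsubset> a \<longrightarrow> (\<exists>c\<in>C a. x \<sqsubset> c)) \<and> \<not> cof_le a B0 \<and> bot_elt \<notin> C a"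
proof -
  \<comment> \<open>The length \<open>|B1|\<^sup>+\<close> is large enough to pass
    \<open>|B1|\<close> many stabilization indices, and at most \<open>|B2|\<close>, so that
    intersections along the chain remain clubs.\<close>
  define \<kappa> where "\<kappa> = next_card B1"
  have \<kappa>: "regular_on (below \<kappa>) B1" "|below \<kappa>| \<le>o |B2|"
    unfolding \<kappa>_def using reg_nx[OF B(2) x0] next_card_card[OF B(2,4)] by auto
  define c where "c a = (SOME X. X \<subseteq> below a \<and> (\<forall>x. x \<sqsubset> a \<longrightarrow> (\<exists>y\<in>X. x \<sqsubseteq> y)) \<and> |X| \<le>o |B1| )" for a
  have c: "c a \<subseteq> below a \<and> (\<forall>x. x \<sqsubset> a \<longrightarrow> (\<exists>y\<in>c a. x \<sqsubseteq> y)) \<and> |c a| \<le>o |B1|" if "cof_le a B1" for a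
    unfolding c_def by (rule someI_ex) (use that in \<open>auto simp: cof_le_def\<close>)
  define drop where "drop D a = last_below D ` c a - {bot_elt}" for D a
  have "\<exists>D. club_on W D \<and> (\<forall>E. club_on W E \<longrightarrow>
    (\<exists>a\<in>W. \<not> cof_le a B0 \<and> cof_le a B1 \<and> limit_of D a \<and> drop D a \<subseteq> E))"
  proof (rule ccontr)
    assume "\<not> ?thesis"
    then have "\<forall>D. \<exists>E. club_on W D \<longrightarrow> club_on W E \<and>
      (\<forall>a\<in>W. \<not> cof_le a B0 \<longrightarrow> cof_le a B1 \<longrightarrow> limit_of D a \<longrightarrow> \<not> drop D a \<subseteq> E)" by meson
    then obtain \<Phi> where \<Phi>: "\<And>D. club_on W D \<Longrightarrow> club_on W (\<Phi> D) \<and>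
      (\<forall>a\<in>W. \<not> cof_le a B0 \<longrightarrow> cof_le a B1 \<longrightarrow> limit_of D a \<longrightarrow> \<not> drop D a \<subseteq> \<Phi> D)" by metis
    obtain D where D: "\<And>i. i \<sqsubseteq> \<kappa> \<Longrightarrow> club_on W (D i)" "\<And>i j. i \<sqsubset> j \<Longrightarrow> D j \<subseteq> D i \<inter> \<Phi> (D i)"
      "\<And>i j. i \<sqsubseteq> j \<Longrightarrow> D j \<subseteq> D i"
      using club_chain[OF W \<kappa>(2), of "\<lambda>D. D \<inter> \<Phi> D"] club_Int[OF W] \<Phi> by blast
    obtain w where w: "w \<in> W" using reg_ne[OF W] by blast
    have B20: "\<not> |B2| \<le>o |B0|"
    proof
      assume "|B2| \<le>o |B0|"
      then show False using B(3,4) card_le_total[of B0 B1] ordLeq_transitive[of "|B2|" "|B0|" "|B1|"] by blast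
    qed
    \<comment> \<open>A limit point of the last club is a limit point of every \<open>D i\<close>,
      so the assumed failure applies to \<open>a\<close> at every stage.\<close>
    obtain a where a: "a \<in> W" "limit_of (D \<kappa>) a" "\<not> cof_le a B0" "cof_le a B1"
      using club_point_cofinality[OF W D(1)[OF order.refl] w B(1) B20] B(3) by metis
    have ca: "c a \<subseteq> below a" "|c a| \<le>o |B1|" using c[OF a(4)] by auto
    have gW: "y \<in> W" if "y \<in> c a" for y using ca(1) regD(2)[OF W a(1)] that by auto
    obtain z0 where z0: "z0 \<sqsubset> \<kappa>" using reg_ne[OF \<kappa>(1)] by auto
    have "\<exists>i. i \<sqsubset> \<kappa> \<and> (\<forall>j. i \<sqsubseteq> j \<longrightarrow> j \<sqsubset> \<kappa> \<longrightarrow> last_below (D j) y = last_below (D i) y)" for y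
      by (rule antimono_stable[OF z0]) (rule last_below_antimono, rule D(3))
    then obtain st where st: "\<And>y. st y \<sqsubset> \<kappa>"
      "\<And>y j. st y \<sqsubseteq> j \<Longrightarrow> j \<sqsubset> \<kappa> \<Longrightarrow> last_below (D j) y = last_below (D (st y)) y" by metis
    obtain i where i: "i \<sqsubset> \<kappa>" "\<forall>y\<in>c a. st y \<sqsubset> i"
      using reg_bound[OF \<kappa>(1) ca(2), of st] st(1) by auto
    obtain j where j: "j \<sqsubset> \<kappa>" "i \<sqsubset> j" using reg_next[OF \<kappa>(1), of i] i(1) by auto
    have "drop (D i) a \<subseteq> \<Phi> (D i)"
    proof
      fix z assume "z \<in> drop (D i) a"
      then obtain y where y: "y \<in> c a" "z = last_below (D i) y" "z \<noteq> bot_elt" unfolding drop_def by blast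
      have "st y \<sqsubset> i" using i y by blast
      \<comment> \<open>Stage \<open>j\<close> comes after \<open>i\<close>, so the common value
        lies in \<open>D j\<close> and therefore in \<open>\<Phi> (D i)\<close>.\<close>
      then have "last_below (D i) y = last_below (D j) y" using st(2)[of y i] st(2)[of y j] i(1) j by auto
      moreover have "last_below (D j) y \<in> insert bot_elt (D j)"
        by (rule last_below_in[OF D(1) gW[OF y(1)] regD(2)[OF W gW[OF y(1)]]]) (use j in auto)
      ultimately show "z \<in> \<Phi> (D i)" using y D(2)[OF j(2)] by auto
    qed
    moreover have "limit_of (D i) a" using lim_mono[OF a(2) D(3)] i(1) by auto
    moreover have "club_on W (D i)" using D(1) i(1) by auto
    ultimately show False using \<Phi>[of "D i"] a by blast
  qed
  then obtain D where D: "club_on W D" "\<And>E. club_on W E \<Longrightarrow>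
    \<exists>a\<in>W. \<not> cof_le a B0 \<and> cof_le a B1 \<and> limit_of D a \<and> drop D a \<subseteq> E" by blast
  have "drop D a \<subseteq> below a \<and> (\<forall>x. x \<sqsubset> a \<longrightarrow> (\<exists>c\<in>drop D a. x \<sqsubset> c))" if a: "cof_le a B1" "limit_of D a" for a
  proof (intro conjI allI impI)
    show "drop D a \<subseteq> below a"
    proof
      fix z assume "z \<in> drop D a"
      then obtain y where "y \<in> c a" "z = last_below D y" unfolding drop_def by blast
      then show "z \<in> below a" using c[OF a(1)] last_below_le[of D y] by (auto intro: le_less_trans)
    qed
  next
    fix x assume "x \<sqsubset> a"
    then obtain d where d: "d \<in> D" "x \<sqsubset> d" "d \<sqsubset> a" using limD[OF a(2)] by blast
    then obtain y where y: "y \<in> c a" "d \<sqsubseteq> y" using c[OF a(1)] by blast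
    have "x \<sqsubset> last_below D y" using last_below_ge[OF d(1) y(2)] d(2) by order
    moreover from this have "last_below D y \<noteq> bot_elt" using bot_elt_le[of x] by auto
    ultimately show "\<exists>c\<in>drop D a. x \<sqsubset> c" using y(1) unfolding drop_def by blast
  qed
  moreover have "bot_elt \<notin> drop D a" for a unfolding drop_def by blast
  ultimately show thesis using that[of "drop D"] D(2) by meson
qed

text \<open>A C-sequence: closed cofinal sets of size the cofinality, also at successors, where they
  contain the predecessor, so that walks can always go on. Closure is what lets a walk hit a
  prescribed ordinal. The size clause ranges over sets \<open>B\<close> of type
  \<open>'b set\<close>, as a formula cannot quantify over types.\<close>

definition ladder :: "('b \<Rightarrow> 'b set) \<Rightarrow> bool" where
  "ladder e \<longleftrightarrow> (\<forall>z. e z \<subseteq> below z \<and> (\<forall>x. x \<sqsubset> z \<longrightarrow> (\<exists>y\<in>e z. x \<sqsubseteq> y)) \<and>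
     (\<forall>d. d \<sqsubset> z \<longrightarrow> limit_of (e z) d \<longrightarrow> d \<in> e z) \<and>
     (\<forall>B::'b set. infinite B \<longrightarrow> cof_le z B \<longrightarrow> |e z| \<le>o |B| ))"

text \<open>Adding the limit points to a cofinal set of least size does not enlarge its cardinality:
  mapping a limit point to the next point of the set is injective, since a point of the set lies
  between any two limit points.\<close>

lemma ladder_exists: "\<exists>e. ladder e"
proof -
  have "\<exists>E. E \<subseteq> below z \<and> (\<forall>x. x \<sqsubset> z \<longrightarrow> (\<exists>y\<in>E. x \<sqsubseteq> y)) \<and>
     (\<forall>d. d \<sqsubset> z \<longrightarrow> limit_of E d \<longrightarrow> d \<in> E) \<and>
     (\<forall>B::'b set. infinite B \<longrightarrow> cof_le z B \<longrightarrow> |E| \<le>o |B| )" for z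
  proof -
    let ?Q = "\<lambda>X. X \<subseteq> below z \<and> (\<forall>x. x \<sqsubset> z \<longrightarrow> (\<exists>y\<in>X. x \<sqsubseteq> y))"
    let ?R = "{|X| |X. ?Q X}"
    have "?Q (below z)" by auto
    then have "?R \<noteq> {}" by blast
    moreover have "\<forall>k\<in>?R. Card_order k" using card_of_Card_order by blast
    ultimately have "\<exists>k\<in>?R. \<forall>k'\<in>?R. k \<le>o k'" using exists_minim_Card_order[of ?R] by blast
    then obtain k where k: "k \<in> ?R" "\<forall>k'\<in>?R. k \<le>o k'" ..
    then obtain X where kX: "k = |X|" and QX: "?Q X" by auto
    have minX: "|X| \<le>o |X'|" if "?Q X'" for X'
    proof -
      have "|X'| \<in> ?R" using that by auto
      then show ?thesis using k(2) kX by auto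
    qed
    note X = QX minX
    let ?L = "{d. d \<sqsubset> z \<and> limit_of X d}"
    define g where "g d = least_of {x \<in> X. d \<sqsubseteq> x}" for d
    have g: "g d \<in> X" "d \<sqsubseteq> g d" "\<And>x. x \<in> X \<Longrightarrow> d \<sqsubseteq> x \<Longrightarrow> g d \<sqsubseteq> x" if "d \<sqsubset> z" for d
    proof -
      have "{x \<in> X. d \<sqsubseteq> x} \<noteq> {}" using X(1) that by blast
      from least_of_in[OF this] show "g d \<in> X" "d \<sqsubseteq> g d" unfolding g_def by auto
      show "\<And>x. x \<in> X \<Longrightarrow> d \<sqsubseteq> x \<Longrightarrow> g d \<sqsubseteq> x" unfolding g_def by (simp add: least_of_le)
    qed
    have lt: "g d \<sqsubset> g d'" if dd: "d \<in> ?L" "d' \<in> ?L" "d \<sqsubset> d'" for d d'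
    proof -
      obtain c where "c \<in> X" "d \<sqsubset> c" "c \<sqsubset> d'" using limD[of X d' d] dd by blast
      then have "g d \<sqsubseteq> c" "d' \<sqsubseteq> g d'" using g dd by auto
      then show ?thesis using \<open>c \<sqsubset> d'\<close> by order
    qed
    have "inj_on g ?L"
    proof (rule inj_onI, rule ccontr)
      fix d d' assume "d \<in> ?L" "d' \<in> ?L" "g d = g d'" "d \<noteq> d'"
      then show False using lt[of d d'] lt[of d' d] by (metis neqE less_irrefl)
    qed
    then have L: "|?L| \<le>o |X|" using g by (intro card_of_ordLeqI[of g]) auto
    have "limit_of X d" if d: "limit_of (X \<union> ?L) d" for d
    proof -
      obtain x0 where "x0 \<sqsubset> d" using d unfolding limit_of_def by blast
      moreover have "\<exists>c\<in>X. x \<sqsubset> c \<and> c \<sqsubset> d" if x: "x \<sqsubset> d" for x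
      proof -
        obtain c where c: "c \<in> X \<union> ?L" "x \<sqsubset> c" "c \<sqsubset> d" using limD[OF d x] by blast
        show ?thesis
        proof (cases "c \<in> X")
          case False
          then obtain c' where "c' \<in> X" "x \<sqsubset> c'" "c' \<sqsubset> c" using c limD by blast
          then show ?thesis using c(3) less_trans by blast
        qed (use c in blast)
      qed
      ultimately show ?thesis by (rule limI)
    qed
    moreover have "|X \<union> ?L| \<le>o |B|" if B: "infinite B" "cof_le z B" for B :: "'b set"
    proof -
      obtain X' where "?Q X'" "|X'| \<le>o |B|" using B(2) unfolding cof_le_def by blast
      then have "|X| \<le>o |B|" using ordLeq_transitive[OF X(2)] by blast
      then show ?thesis using card_le_Un[OF B(1)] ordLeq_transitive[OF L] by blast
    qed
    ultimately show ?thesis using X(1) by (intro exI[of _ "X \<union> ?L"]) auto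
  qed
  then obtain e where "\<And>z. e z \<subseteq> below z \<and> (\<forall>x. x \<sqsubset> z \<longrightarrow> (\<exists>y\<in>e z. x \<sqsubseteq> y)) \<and>
     (\<forall>d. d \<sqsubset> z \<longrightarrow> limit_of (e z) d \<longrightarrow> d \<in> e z) \<and>
     (\<forall>B::'b set. infinite B \<longrightarrow> cof_le z B \<longrightarrow> |e z| \<le>o |B| )" by metis
  then show ?thesis unfolding ladder_def by blast
qed

lemma ladderD:
  assumes "ladder e"
  shows "y \<in> e z \<Longrightarrow> y \<sqsubset> z" "x \<sqsubset> z \<Longrightarrow> \<exists>y\<in>e z. x \<sqsubseteq> y"
    "d \<sqsubset> z \<Longrightarrow> limit_of (e z) d \<Longrightarrow> d \<in> e z"
    "infinite (B :: 'b set) \<Longrightarrow> cof_le z B \<Longrightarrow> |e z| \<le>o |B|"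
  using assms unfolding ladder_def below_def by blast+

text \<open>\<open>W\<close> has more than \<open>|M|\<close> points, and any \<open>|M|\<close> of
  them lie below a single point of \<open>W\<close>.\<close>

lemma reg_big:
  assumes W: "regular_on W M" and B: "\<not> |M| \<le>o |B|"
  shows "\<exists>x\<in>W. \<not> |below x| \<le>o |B|"
proof -
  have "\<not> |W| \<le>o |M|" using regD(4)[OF W, of W] by auto
  then obtain Y where Y: "Y \<subseteq> W" "|Y| \<le>o |M|" "|M| \<le>o |Y|"
    using card_le_total subset_of_card by meson
  then obtain x where x: "x \<in> W" "\<forall>y\<in>Y. y \<sqsubset> x" using regD(4)[OF W] by blast
  then have "Y \<subseteq> below x" by auto
  then have "\<not> |below x| \<le>o |B|"
    using B ordLeq_transitive[OF Y(3) card_le_subset[of Y "below x"]] by blast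
  then show ?thesis using x by blast
qed

end

text \<open>\<open>F\<close> plays the role of \<open>\<mu>\<^sup>+\<close>, and the union of the
  \<open>K n\<close> that of \<mu>, exhausted by countably many sets of strictly increasing
  size.\<close>

locale filtered = ordinals le lt
  for le :: "'b \<Rightarrow> 'b \<Rightarrow> bool" (infix "\<sqsubseteq>" 50) and lt :: "'b \<Rightarrow> 'b \<Rightarrow> bool" (infix "\<sqsubset>" 50) +
  fixes F :: "'b set" and K :: "nat \<Rightarrow> 'b set"
  assumes K_inf: "infinite (K n)" and K_Suc: "K n \<subseteq> K (Suc n)"
    and K_less: "\<not> |K (Suc n)| \<le>o |K n|" and F_reg: "regular_on F (\<Union>n. K n)"
begin

lemma K_mono: "m \<le> n \<Longrightarrow> K m \<subseteq> K n"
  by (induction n rule: dec_induct) (use K_Suc in blast)+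

lemma K_le: "m \<le> n \<Longrightarrow> |K m| \<le>o |K n|"
  using K_mono card_of_mono1 by blast

lemma K_le_M: "|K n| \<le>o |\<Union>n. K n|"
  by (rule card_of_mono1) blast

lemma M_not_le: "\<not> |\<Union>n. K n| \<le>o |K n|"
  using K_less ordLeq_transitive[OF K_le_M] by blast

lemma F_big: "\<exists>x\<in>F. \<not> |below x| \<le>o |K n|"
  by (rule reg_big[OF F_reg M_not_le])

lemma nxK:
  shows "next_card (K n) \<in> F" "regular_on (below (next_card (K n))) (K n)" "|below (next_card (K n))| \<le>o |K (Suc n)|"
proof -
  obtain x where x: "x \<in> F" "\<not> |below x| \<le>o |K n|" using F_big by blast
  show "next_card (K n) \<in> F" using reg_le[OF F_reg x(1) next_card_le[OF x(2)]] .
  show "regular_on (below (next_card (K n))) (K n)" using reg_nx[OF K_inf x(2)] .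
  show "|below (next_card (K n))| \<le>o |K (Suc n)|" by (rule next_card_card[OF K_inf K_less])
qed

lemma F_dn: "x \<in> F \<Longrightarrow> y \<sqsubset> x \<Longrightarrow> y \<in> F"
  using regD(2)[OF F_reg] .

lemma F_inj: "x \<in> F \<Longrightarrow> \<exists>g. inj_on g (below x) \<and> g ` below x \<subseteq> (\<Union>n. K n)"
  unfolding card_of_ordLeq by (rule regD(3)[OF F_reg])

lemma card_preimage_inj:
  assumes "inj_on g A"
  shows "|{y \<in> A. g y \<in> B}| \<le>o |B|"
  by (rule card_of_ordLeqI[of g]) (auto intro: inj_on_subset[OF assms])

text \<open>Here the countable cofinality of \<mu> enters. If the cofinality of \<open>x\<close>
  exceeded every \<open>|K n|\<close>, each part of \<open>below x\<close> that \<open>g\<close>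
  maps into \<open>K n\<close> would be bounded. The countably many bounds would be cofinal, and
  \<open>x\<close> would have countable cofinality after all.\<close>

lemma F_cofle:
  assumes "x \<in> F"
  shows "\<exists>n. cof_le x (K n)"
proof (rule ccontr)
  assume n: "\<not> ?thesis"
  obtain g where g: "inj_on g (below x)" "g ` below x \<subseteq> (\<Union>n. K n)" using F_inj[OF assms] by blast
  have "\<exists>b. b \<sqsubset> x \<and> (\<forall>y\<in>{y \<in> below x. g y \<in> K n}. y \<sqsubset> b)" for n
    by (rule not_cof_le_bound[OF _ card_preimage_inj[OF g(1)]]) (use n in auto)
  then obtain b where b: "\<And>n. b n \<sqsubset> x" "\<And>n y. y \<sqsubset> x \<Longrightarrow> g y \<in> K n \<Longrightarrow> y \<sqsubset> b n"
    by (metis (mono_tags, lifting) below_iff mem_Collect_eq)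
  have "\<exists>y\<in>range b. z \<sqsubseteq> y" if z: "z \<sqsubset> x" for z
  proof -
    obtain n where "g z \<in> K n" using subsetD[OF g(2), of "g z"] z by auto
    then show ?thesis using b(2)[OF z, of n] less_imp_le by blast
  qed
  moreover have "|range b| \<le>o |K 0|" by (intro card_le_image card_le_countable K_inf)
  ultimately have "cof_le x (K 0)" unfolding cof_le_def using b(1) by (intro exI[of _ "range b"]) auto
  then show False using n by blast
qed

end

section \<open>Strongly increasing sequences\<close>

text \<open>The extra strength is in \<open>f_ladder\<close>: one index serves the whole ladder at
  \<delta>. Increase modulo finite alone does not guarantee an exact upper bound; this uniformity
  supplies it.\<close>

locale increasing_seq = filtered le lt F K
  for le :: "'b \<Rightarrow> 'b \<Rightarrow> bool" (infix "\<sqsubseteq>" 50) and lt :: "'b \<Rightarrow> 'b \<Rightarrow> bool" (infix "\<sqsubset>" 50)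
    and F :: "'b set" and K :: "nat \<Rightarrow> 'b set" +
  fixes e :: "'b \<Rightarrow> 'b set" and f :: "'b \<Rightarrow> nat \<Rightarrow> 'b"
  assumes e: "ladder e"
    and f_less: "\<And>\<gamma> \<delta>. \<delta> \<in> F \<Longrightarrow> \<gamma> \<sqsubset> \<delta> \<Longrightarrow> \<exists>n. \<forall>k\<ge>n. f \<gamma> k \<sqsubset> f \<delta> k"
    and f_ladder: "\<And>\<delta>. \<delta> \<in> F \<Longrightarrow> \<exists>n. \<forall>\<gamma>\<in>e \<delta>. \<forall>k\<ge>n. f \<gamma> k \<sqsubset> f \<delta> k"
    and f_nx: "\<And>\<delta> k. \<delta> \<in> F \<Longrightarrow> f \<delta> k \<sqsubset> next_card (K k)"

context filtered
begin

text \<open>The value \<open>f \<delta> k\<close> is the least strict bound of the earlier values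
  over a set \<open>A k \<delta>\<close> of at most \<open>|K k|\<close> indices, hence stays below
  the regular \<open>|K k|\<^sup>+\<close>. These sets increase with \<open>k\<close>, exhaust
  \<open>below \<delta>\<close>, and from some \<open>k\<close> on contain the whole ladder.\<close>

lemma inc_exists: "\<exists>e f. increasing_seq le lt F K e f"
proof -
  obtain e where e: "ladder e" using ladder_exists by blast
  have "\<forall>x. \<exists>g. x \<in> F \<longrightarrow> inj_on g (below x) \<and> g ` below x \<subseteq> (\<Union>n. K n)" using F_inj by blast
  then obtain g where g: "\<And>x. x \<in> F \<Longrightarrow> inj_on (g x) (below x) \<and> g x ` below x \<subseteq> (\<Union>n. K n)" by metis
  define A where "A n \<delta> = {\<gamma> \<in> e \<delta>. |e \<delta>| \<le>o |K n|} \<union> {\<gamma> \<in> below \<delta>. g \<delta> \<gamma> \<in> K n}" for n \<delta>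
  have A_dn: "\<gamma> \<sqsubset> \<delta>" if "\<gamma> \<in> A n \<delta>" for \<gamma> n \<delta>
    using that ladderD(1)[OF e] unfolding A_def by auto
  have A_card: "|A n \<delta>| \<le>o |K n|" if "\<delta> \<in> F" for n \<delta>
  proof -
    have "|{\<gamma> \<in> e \<delta>. |e \<delta>| \<le>o |K n|}| \<le>o |K n|"
      by (cases "|e \<delta>| \<le>o |K n|") (simp_all add: card_of_empty)
    then show ?thesis unfolding A_def
      using g[OF that] by (intro card_le_Un K_inf card_preimage_inj) auto
  qed
  from rec_exists[of "\<lambda>f \<delta> k. least_of {z. \<forall>\<gamma>\<in>A k \<delta>. f \<gamma> k \<sqsubset> z}"]
  obtain f where f0: "\<forall>\<delta>. f \<delta> = (\<lambda>k. least_of {z. \<forall>\<gamma>\<in>A k \<delta>. (if \<gamma> \<sqsubset> \<delta> then f \<gamma> else undefined) k \<sqsubset> z})" ..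
  have f: "f \<delta> k = least_of {z. \<forall>\<gamma>\<in>A k \<delta>. f \<gamma> k \<sqsubset> z}" for \<delta> k
    using fun_cong[OF f0[rule_format, of \<delta>], of k] A_dn[of _ k \<delta>] by (simp cong: ball_cong)
  have next_card: "f \<delta> k \<sqsubset> next_card (K k) \<and> (\<forall>\<gamma>\<in>A k \<delta>. f \<gamma> k \<sqsubset> f \<delta> k)" if "\<delta> \<in> F" for \<delta> k
    using that
  proof (induction \<delta> rule: less_induct)
    case (less \<delta>)
    have "\<exists>b\<in>below (next_card (K k)). \<forall>\<gamma>\<in>A k \<delta>. f \<gamma> k \<sqsubset> b"
      by (rule reg_bound[OF nxK(2) A_card[OF less.prems]])
         (use less.IH A_dn F_dn[OF less.prems] in auto)
    then obtain b where b: "b \<sqsubset> next_card (K k)" "b \<in> {z. \<forall>\<gamma>\<in>A k \<delta>. f \<gamma> k \<sqsubset> z}" by auto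
    then have "f \<delta> k \<sqsubseteq> b" "f \<delta> k \<in> {z. \<forall>\<gamma>\<in>A k \<delta>. f \<gamma> k \<sqsubset> z}"
      unfolding f[of \<delta>] by (auto intro: least_of_le simp del: mem_Collect_eq intro!: least_of_in)
    then show ?case using b(1) by auto
  qed
  have "increasing_seq le lt F K e f"
  proof
    show "ladder e" by (rule e)
  next
    fix \<gamma> \<delta> assume \<delta>: "\<delta> \<in> F" "\<gamma> \<sqsubset> \<delta>"
    then obtain n where n: "g \<delta> \<gamma> \<in> K n" using subsetD[OF conjunct2[OF g[OF \<delta>(1)]], of "g \<delta> \<gamma>"] by auto
    have "\<gamma> \<in> A k \<delta>" if "k \<ge> n" for k using K_mono[OF that] n \<delta>(2) unfolding A_def by auto
    then show "\<exists>n. \<forall>k\<ge>n. f \<gamma> k \<sqsubset> f \<delta> k" using next_card[OF \<delta>(1)] by blast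
  next
    fix \<delta> assume \<delta>: "\<delta> \<in> F"
    then obtain n where "cof_le \<delta> (K n)" using F_cofle by blast
    then have n: "|e \<delta>| \<le>o |K n|" using ladderD(4)[OF e K_inf] by blast
    have "e \<delta> \<subseteq> A k \<delta>" if "k \<ge> n" for k
      using ordLeq_transitive[OF n K_le[OF that]] unfolding A_def by auto
    then show "\<exists>n. \<forall>\<gamma>\<in>e \<delta>. \<forall>k\<ge>n. f \<gamma> k \<sqsubset> f \<delta> k" using next_card[OF \<delta>] by blast
  next
    show "\<And>\<delta> k. \<delta> \<in> F \<Longrightarrow> f \<delta> k \<sqsubset> next_card (K k)" using next_card by blast
  qed
  then show ?thesis by blast
qed

end

context increasing_seq
begin

lemma f_le:
  assumes "\<delta> \<in> F" "\<gamma> \<sqsubseteq> \<delta>"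
  shows "\<exists>n. \<forall>k\<ge>n. f \<gamma> k \<sqsubseteq> f \<delta> k"
proof (cases "\<gamma> = \<delta>")
  case False
  then have "\<gamma> \<sqsubset> \<delta>" using assms(2) by simp
  then show ?thesis using f_less[OF assms(1)] less_imp_le by blast
qed auto

text \<open>
  The points \<open>\<xi> i\<close> are chosen so that \<open>f (\<xi> i)\<close> bounds the family
  \<open>{f (lub (\<xi> ` below j)) | j \<in> C a, j \<le> i}\<close> whenever that family has a bound at all. Guessing the indices
  that the ladder at \<open>\<delta> = sup \<xi>\<close> catches shows that, for some \<open>a\<close>, a bound always exists: \<open>f \<delta>\<close>.
\<close>

lemma strongly_increasing:
  assumes D: "club_on F D"
  shows "\<exists>X N. X \<subseteq> D \<and> \<not> |X| \<le>o |K m| \<and> (\<forall>x\<in>X. \<forall>y\<in>X. x \<sqsubset> y \<longrightarrow> (\<forall>k\<ge>N. f x k \<sqsubseteq> f y k))"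
proof -
  \<comment> \<open>Club guessing takes three sizes in a row: cofinality above \<open>|K m|\<close>,
    cofinal sets of size at most \<open>|K (Suc m)|\<close>, and chains of clubs of length at most
    \<open>|K (Suc (Suc m))|\<close>.\<close>
  define \<nu> where "\<nu> = next_card (K (Suc (Suc m)))"
  have \<nu>: "regular_on (below \<nu>) (K (Suc (Suc m)))" "|below \<nu>| \<le>o |\<Union>n. K n|"
    unfolding \<nu>_def using nxK(2) regD(3)[OF F_reg nxK(1)] by auto
  obtain x0 where x0: "\<not> |below x0| \<le>o |K (Suc m)|" using F_big by blast
  obtain C where C: "\<And>E. club_on (below \<nu>) E \<Longrightarrow> \<exists>a\<in>below \<nu>. C a \<subseteq> E \<and> C a \<subseteq> below a \<and>
    (\<forall>x. x \<sqsubset> a \<longrightarrow> (\<exists>c\<in>C a. x \<sqsubset> c)) \<and> \<not> cof_le a (K m) \<and> bot_elt \<notin> C a"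
    using club_guessing[OF K_inf K_inf K_less K_less x0 \<nu>(1)] by blast
  define P where "P \<xi> a i \<gamma> \<longleftrightarrow>
    (\<exists>n. \<forall>j\<in>C a. j \<sqsubseteq> i \<longrightarrow> (\<forall>k\<ge>n. f (lub (\<xi> ` below j)) k \<sqsubseteq> f \<gamma> k))" for \<xi> :: "'b \<Rightarrow> 'b" and a i \<gamma>
  \<comment> \<open>Only bounds that exist are demanded, so \<open>Z\<close> is nonempty: there are
    at most \<open>|\<Union>n. K n|\<close> many \<open>a\<close>, and a point of \<open>D\<close>
    lies above one bound for each of them.\<close>
  define Z where "Z \<xi> i = {z \<in> D. (\<forall>j. j \<sqsubset> i \<longrightarrow> \<xi> j \<sqsubset> z) \<and>
    (\<forall>a. a \<sqsubset> \<nu> \<longrightarrow> (\<exists>\<gamma>\<in>F. P \<xi> a i \<gamma>) \<longrightarrow> (\<exists>\<gamma>\<in>F. \<gamma> \<sqsubseteq> z \<and> P \<xi> a i \<gamma>))}" for \<xi> :: "'b \<Rightarrow> 'b" and i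
  from rec_exists[of "\<lambda>\<xi> i. least_of (Z \<xi> i)"] obtain \<xi> where
    \<xi>0: "\<forall>i. \<xi> i = least_of (Z (\<lambda>j. if j \<sqsubset> i then \<xi> j else undefined) i)" ..
  have Zc: "Z (\<lambda>j. if j \<sqsubset> i then \<xi> j else undefined) i = Z \<xi> i" for i
  proof -
    have "(\<lambda>j. if j \<sqsubset> i then \<xi> j else undefined) ` below j = \<xi> ` below j" if "j \<sqsubseteq> i" for j
      using that by (intro image_cong) auto
    then have "P (\<lambda>j. if j \<sqsubset> i then \<xi> j else undefined) a i \<gamma> = P \<xi> a i \<gamma>" for a \<gamma>
      unfolding P_def by (simp cong: imp_cong)
    then show ?thesis unfolding Z_def by (simp cong: imp_cong)
  qed
  have \<xi>Z: "\<xi> i \<in> Z \<xi> i" if "i \<sqsubset> \<nu>" for i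
    using that
  proof (induction i rule: less_induct)
    case (less i)
    have F\<xi>: "\<xi> j \<in> F" if "j \<sqsubset> i" for j
      using less.IH[OF that] less.prems that clubD(1)[OF D] unfolding Z_def by (auto intro: less_trans)
    have "|below i| \<le>o |\<Union>n. K n|" using card_le_subset[OF below_mono \<nu>(2)] less.prems by auto
    then obtain b1 where b1: "b1 \<in> F" "\<forall>j\<in>below i. \<xi> j \<sqsubset> b1"
      using reg_bound[OF F_reg, of "below i" \<xi>] F\<xi> by auto
    define h where "h a = (if \<exists>\<gamma>\<in>F. P \<xi> a i \<gamma> then SOME \<gamma>. \<gamma> \<in> F \<and> P \<xi> a i \<gamma> else b1)" for a
    have h: "h a \<in> F" "(\<exists>\<gamma>\<in>F. P \<xi> a i \<gamma>) \<Longrightarrow> P \<xi> a i (h a)" for a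
      using someI_ex[of "\<lambda>\<gamma>. \<gamma> \<in> F \<and> P \<xi> a i \<gamma>"] b1(1) unfolding h_def by auto
    obtain b2 where b2: "b2 \<in> F" "\<forall>a\<in>below \<nu>. h a \<sqsubset> b2"
      using reg_bound[OF F_reg \<nu>(2), of h] h(1) by auto
    obtain b3 where b3: "b3 \<in> F" "b1 \<sqsubset> b3" "b2 \<sqsubset> b3" using reg_ub2[OF F_reg b1(1) b2(1)] by blast
    obtain z where z: "z \<in> D" "b3 \<sqsubset> z" using clubD(2)[OF D b3(1)] by blast
    have "\<xi> j \<sqsubset> z" if "j \<sqsubset> i" for j
    proof -
      have "\<xi> j \<sqsubset> b1" using b1 that by auto
      then show ?thesis using b3 z by order
    qed
    moreover have "h a \<sqsubseteq> z" if "a \<sqsubset> \<nu>" for a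
    proof -
      have "h a \<sqsubset> b2" using b2 that by auto
      then show ?thesis using b3 z by order
    qed
    ultimately have "z \<in> Z \<xi> i" unfolding Z_def using z(1) h by blast
    then have "least_of (Z \<xi> i) \<in> Z \<xi> i" using least_of_in by blast
    then show ?case using \<xi>0[rule_format, of i] Zc[of i] by simp
  qed
  have \<xi>D: "\<xi> i \<in> D" "\<xi> i \<in> F" if "i \<sqsubset> \<nu>" for i
    using \<xi>Z[OF that] clubD(1)[OF D] unfolding Z_def by auto
  have \<xi>mono: "\<xi> j \<sqsubset> \<xi> i" if "j \<sqsubset> i" "i \<sqsubset> \<nu>" for i j
    using \<xi>Z[OF that(2)] that(1) unfolding Z_def by auto
  have \<xi>P: "\<exists>\<gamma>\<in>F. \<gamma> \<sqsubseteq> \<xi> i \<and> P \<xi> a i \<gamma>" if "i \<sqsubset> \<nu>" "a \<sqsubset> \<nu>" "\<gamma> \<in> F" "P \<xi> a i \<gamma>" for i a \<gamma>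
    using \<xi>Z[OF that(1)] that(2-4) unfolding Z_def by blast
  define \<delta> where "\<delta> = lub (\<xi> ` below \<nu>)"
  have \<xi>img: "\<xi> ` below \<nu> \<subseteq> F" "|\<xi> ` below \<nu>| \<le>o |\<Union>n. K n|"
    using \<xi>D(2) card_le_image[OF \<nu>(2)] by auto
  have \<delta>: "\<delta> \<in> F" and \<xi>\<delta>0: "\<And>i. i \<sqsubset> \<nu> \<Longrightarrow> \<xi> i \<sqsubseteq> \<delta>"
    using reg_lub[OF F_reg \<xi>img] unfolding \<delta>_def by auto
  have \<xi>\<delta>: "\<xi> i \<sqsubset> \<delta>" if i: "i \<sqsubset> \<nu>" for i
  proof -
    obtain j where j: "j \<sqsubset> \<nu>" "i \<sqsubset> j" using reg_next[OF \<nu>(1), of i] i by auto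
    then show ?thesis using \<xi>mono[OF j(2,1)] \<xi>\<delta>0[OF j(1)] by order
  qed
  have lubi: "lub (\<xi> ` below i) \<sqsubseteq> \<xi> i" if "i \<sqsubset> \<nu>" for i
    by (rule lub_le) (use \<xi>mono[OF _ that] less_imp_le in auto)
  have lubj: "\<xi> j \<sqsubseteq> lub (\<xi> ` below i)" if "j \<sqsubset> i" "i \<sqsubset> \<nu>" for i j
    by (rule lub_ub[of _ "\<xi> i"]) (use \<xi>mono[OF _ that(2)] that(1) less_imp_le in auto)
  \<comment> \<open>The ladder at \<delta> and the points \<xi> interleave. For an index closed
    under this interleaving, the supremum of the earlier \<xi> is a limit of
    \<open>e \<delta>\<close>, hence by closure an element of it.\<close>
  have "\<exists>j'. j' \<sqsubset> \<nu> \<and> (\<exists>\<epsilon>\<in>e \<delta>. \<xi> j \<sqsubset> \<epsilon> \<and> \<epsilon> \<sqsubset> \<xi> j')" if j: "j \<sqsubset> \<nu>" for j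
  proof -
    obtain j1 where j1: "j1 \<sqsubset> \<nu>" "j \<sqsubset> j1" using reg_next[OF \<nu>(1), of j] j by auto
    obtain \<epsilon> where \<epsilon>: "\<epsilon> \<in> e \<delta>" "\<xi> j1 \<sqsubseteq> \<epsilon>" using ladderD(2)[OF e \<xi>\<delta>[OF j1(1)]] by blast
    have "\<epsilon> \<sqsubset> \<delta>" using ladderD(1)[OF e \<epsilon>(1)] .
    then obtain j' where "j' \<sqsubset> \<nu>" "\<epsilon> \<sqsubset> \<xi> j'" using lub_gt[of \<epsilon> "\<xi> ` below \<nu>"] unfolding \<delta>_def by auto
    moreover have "\<xi> j \<sqsubset> \<epsilon>" using \<xi>mono[OF j1(2,1)] \<epsilon>(2) by order
    ultimately show ?thesis using \<epsilon>(1) by blast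
  qed
  then obtain g where g: "\<And>j. j \<sqsubset> \<nu> \<Longrightarrow> g j \<sqsubset> \<nu> \<and> (\<exists>\<epsilon>\<in>e \<delta>. \<xi> j \<sqsubset> \<epsilon> \<and> \<epsilon> \<sqsubset> \<xi> (g j))" by metis
  let ?E = "{p \<in> below \<nu>. \<forall>x. x \<sqsubset> p \<longrightarrow> g x \<sqsubset> p}"
  have "club_on (below \<nu>) ?E" by (rule club_closure[OF \<nu>(1)]) (use g in auto)
  from C[OF this] obtain a where a: "a \<sqsubset> \<nu>" "C a \<subseteq> ?E" "C a \<subseteq> below a"
    "\<And>x. x \<sqsubset> a \<Longrightarrow> \<exists>c\<in>C a. x \<sqsubset> c" "\<not> cof_le a (K m)" "bot_elt \<notin> C a" by auto
  have Ca: "i \<sqsubset> \<nu>" "i \<sqsubset> a" if "i \<in> C a" for i using that a(2,3) by auto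
  have p_e: "lub (\<xi> ` below i) \<in> e \<delta>" if i: "i \<in> C a" for i
  proof (rule ladderD(3)[OF e])
    show "lub (\<xi> ` below i) \<sqsubset> \<delta>" using lubi \<xi>\<delta> Ca(1)[OF i] le_less_trans by blast
    have btlt: "bot_elt \<sqsubset> i" using a(6) i bot_elt_le[of i] by (auto simp: le_less)
    have st: "\<exists>\<epsilon>\<in>e \<delta>. \<xi> j \<sqsubset> \<epsilon> \<and> \<epsilon> \<sqsubset> lub (\<xi> ` below i)" if j: "j \<sqsubset> i" for j
    proof -
      have "j \<sqsubset> \<nu>" "g j \<sqsubset> i" using a(2) i j Ca(1)[OF i] by (auto intro: less_trans)
      then obtain \<epsilon> where \<epsilon>: "\<epsilon> \<in> e \<delta>" "\<xi> j \<sqsubset> \<epsilon>" "\<epsilon> \<sqsubset> \<xi> (g j)" using g by blast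
      moreover have "\<epsilon> \<sqsubset> lub (\<xi> ` below i)" using \<epsilon>(3) lubj[OF \<open>g j \<sqsubset> i\<close> Ca(1)[OF i]] by order
      ultimately show ?thesis by blast
    qed
    then have "\<xi> bot_elt \<sqsubset> lub (\<xi> ` below i)" using btlt less_trans by blast
    then show "limit_of (e \<delta>) (lub (\<xi> ` below i))"
    proof (rule limI)
      fix x assume "x \<sqsubset> lub (\<xi> ` below i)"
      then obtain j where "j \<sqsubset> i" "x \<sqsubset> \<xi> j" using lub_gt[of x "\<xi> ` below i"] by auto
      then show "\<exists>c\<in>e \<delta>. x \<sqsubset> c \<and> c \<sqsubset> lub (\<xi> ` below i)" using st less_trans by blast
    qed
  qed
  obtain n\<delta> where n\<delta>: "\<forall>\<gamma>\<in>e \<delta>. \<forall>k\<ge>n\<delta>. f \<gamma> k \<sqsubset> f \<delta> k" using f_ladder[OF \<delta>] by blast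
  have P\<delta>: "P \<xi> a i \<delta>" for i unfolding P_def using p_e n\<delta> less_imp_le by blast
  define nt where "nt i = least_of {c \<in> C a. i \<sqsubset> c}" for i
  have nt: "nt i \<in> C a" "i \<sqsubset> nt i" "\<And>c. c \<in> C a \<Longrightarrow> i \<sqsubset> c \<Longrightarrow> nt i \<sqsubseteq> c" if i: "i \<in> C a" for i
  proof -
    have "{c \<in> C a. i \<sqsubset> c} \<noteq> {}" using a(4)[OF Ca(2)[OF i]] by blast
    from least_of_in[OF this] show "nt i \<in> C a" "i \<sqsubset> nt i" unfolding nt_def by auto
    show "\<And>c. c \<in> C a \<Longrightarrow> i \<sqsubset> c \<Longrightarrow> nt i \<sqsubseteq> c" unfolding nt_def by (rule least_of_le) auto
  qed
  \<comment> \<open>A sandwich: \<open>f (\<xi> i)\<close> is at most \<open>f\<close> at the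
    supremum that belongs to the next index \<open>nt i\<close>, and this is at most
    \<open>f (\<xi> j)\<close> for every later \<open>j\<close> in \<open>C a\<close>. The two
    comparisons depend on \<open>N i\<close> and \<open>N j\<close> only, so it remains to make
    \<open>N\<close> constant.\<close>
  have "\<exists>N. (\<forall>j\<in>C a. j \<sqsubseteq> i \<longrightarrow> (\<forall>k\<ge>N. f (lub (\<xi> ` below j)) k \<sqsubseteq> f (\<xi> i) k)) \<and>
      (\<forall>k\<ge>N. f (\<xi> i) k \<sqsubseteq> f (lub (\<xi> ` below (nt i))) k)" if i: "i \<in> C a" for i
  proof -
    obtain \<gamma> where \<gamma>: "\<gamma> \<in> F" "\<gamma> \<sqsubseteq> \<xi> i" "P \<xi> a i \<gamma>" using \<xi>P[OF Ca(1)[OF i] a(1) \<delta> P\<delta>] by blast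
    obtain n1 where n1: "\<forall>j\<in>C a. j \<sqsubseteq> i \<longrightarrow> (\<forall>k\<ge>n1. f (lub (\<xi> ` below j)) k \<sqsubseteq> f \<gamma> k)"
      using \<gamma>(3) unfolding P_def by blast
    obtain n2 where n2: "\<forall>k\<ge>n2. f \<gamma> k \<sqsubseteq> f (\<xi> i) k" using f_le[OF \<xi>D(2)[OF Ca(1)[OF i]] \<gamma>(2)] by blast
    have nti: "nt i \<sqsubset> \<nu>" using Ca(1)[OF nt(1)[OF i]] .
    have "lub (\<xi> ` below (nt i)) \<in> F" using reg_le[OF F_reg \<xi>D(2)[OF nti] lubi[OF nti]] .
    then obtain n3 where n3: "\<forall>k\<ge>n3. f (\<xi> i) k \<sqsubseteq> f (lub (\<xi> ` below (nt i))) k"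
      using f_le lubj[OF nt(2)[OF i] nti] by blast
    let ?N = "n1 + n2 + n3"
    have "f (lub (\<xi> ` below j)) k \<sqsubseteq> f (\<xi> i) k" if "j \<in> C a" "j \<sqsubseteq> i" "k \<ge> ?N" for j k
    proof -
      have "f (lub (\<xi> ` below j)) k \<sqsubseteq> f \<gamma> k" "f \<gamma> k \<sqsubseteq> f (\<xi> i) k" using n1 n2 that by auto
      then show ?thesis by order
    qed
    then show ?thesis using n3 by (intro exI[of _ ?N]) auto
  qed
  then obtain N where N: "\<And>i j k. i \<in> C a \<Longrightarrow> j \<in> C a \<Longrightarrow> j \<sqsubseteq> i \<Longrightarrow> k \<ge> N i \<Longrightarrow> f (lub (\<xi> ` below j)) k \<sqsubseteq> f (\<xi> i) k"
    "\<And>i k. i \<in> C a \<Longrightarrow> k \<ge> N i \<Longrightarrow> f (\<xi> i) k \<sqsubseteq> f (lub (\<xi> ` below (nt i))) k" by metis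
  have "\<not> |C a| \<le>o |K m|"
    using a(3,4,5) unfolding cof_le_def by (meson less_imp_le)
  from card_pigeonhole[OF K_inf this, of N] obtain n where n: "\<not> |{i \<in> C a. N i = n}| \<le>o |K m|" ..
  let ?Y = "{i \<in> C a. N i = n}"
  have inj: "inj_on \<xi> ?Y"
  proof (rule inj_onI, rule ccontr)
    fix x y assume "x \<in> ?Y" "y \<in> ?Y" "\<xi> x = \<xi> y" "x \<noteq> y"
    then show False using \<xi>mono[of x y] \<xi>mono[of y x] Ca(1) by (metis (mono_tags, lifting) less_irrefl mem_Collect_eq neqE)
  qed
  have "\<not> |\<xi> ` ?Y| \<le>o |K m|"
    using n ordLeq_transitive[of "|?Y|" "|\<xi> ` ?Y|" "|K m|"] card_of_ordLeqI[OF inj, of "\<xi> ` ?Y"] by blast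
  moreover have "f (\<xi> i) k \<sqsubseteq> f (\<xi> j) k" if ij: "i \<in> ?Y" "j \<in> ?Y" "\<xi> i \<sqsubset> \<xi> j" "k \<ge> n" for i j k
  proof -
    have CC: "i \<in> C a" "j \<in> C a" using ij by auto
    have "i \<sqsubset> j" using \<xi>mono[of j i] ij(3) Ca(1)[OF CC(1)] by (metis less_asym neqE)
    then have "nt i \<sqsubseteq> j" using nt(3) CC by blast
    then have "f (lub (\<xi> ` below (nt i))) k \<sqsubseteq> f (\<xi> j) k"
      using N(1)[OF CC(2) nt(1)[OF CC(1)]] ij by auto
    moreover have "f (\<xi> i) k \<sqsubseteq> f (lub (\<xi> ` below (nt i))) k" using N(2)[OF CC(1)] ij by auto
    ultimately show ?thesis by order
  qed
  moreover have "\<xi> ` ?Y \<subseteq> D" using \<xi>D(1) Ca(1) by auto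
  ultimately show ?thesis by (intro exI[of _ "\<xi> ` ?Y"] exI[of _ n]) auto
qed

end

section \<open>Exact upper bounds and scales\<close>

context ordinals
begin

text \<open>Rounding up to \<open>A\<close>, meaningful when \<open>A\<close> has a point at or
  above \<open>x\<close>. This is why every set used later contains
  \<open>next_card (K n)\<close>.\<close>

definition proj :: "'b set \<Rightarrow> 'b \<Rightarrow> 'b" where
  "proj A x = least_of {s \<in> A. x \<sqsubseteq> s}"

lemma proj:
  assumes "t \<in> A" "x \<sqsubseteq> t"
  shows "proj A x \<in> A" "x \<sqsubseteq> proj A x"
proof -
  have "{s \<in> A. x \<sqsubseteq> s} \<noteq> {}" using assms by blast
  from least_of_in[OF this] show "proj A x \<in> A" "x \<sqsubseteq> proj A x" unfolding proj_def by auto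
qed

lemma proj_le: "s \<in> A \<Longrightarrow> x \<sqsubseteq> s \<Longrightarrow> proj A x \<sqsubseteq> s"
  unfolding proj_def by (rule least_of_le) auto

end

context increasing_seq
begin

lemma proj_f:
  assumes "next_card (K n) \<in> A" "\<alpha> \<in> F"
  shows "proj A (f \<alpha> n) \<in> A" "f \<alpha> n \<sqsubseteq> proj A (f \<alpha> n)" "x \<sqsubseteq> f \<alpha> n \<Longrightarrow> proj A x \<sqsubseteq> proj A (f \<alpha> n)"
proof -
  show *: "proj A (f \<alpha> n) \<in> A" "f \<alpha> n \<sqsubseteq> proj A (f \<alpha> n)"
    using proj[OF assms(1) less_imp_le[OF f_nx[OF assms(2)]]] by auto
  show "proj A x \<sqsubseteq> proj A (f \<alpha> n)" if "x \<sqsubseteq> f \<alpha> n"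
    using *(2) that by (intro proj_le *(1)) order
qed

lemma ev_f_less: "\<delta> \<in> F \<Longrightarrow> \<gamma> \<sqsubset> \<delta> \<Longrightarrow> \<forall>\<^sub>F k in sequentially. f \<gamma> k \<sqsubset> f \<delta> k"
  using f_less unfolding eventually_sequentially by blast

lemma ev_f_le: "\<delta> \<in> F \<Longrightarrow> \<gamma> \<sqsubseteq> \<delta> \<Longrightarrow> \<forall>\<^sub>F k in sequentially. f \<gamma> k \<sqsubseteq> f \<delta> k"
  using f_le unfolding eventually_sequentially by blast

text \<open>The bounding projection property. If it fails, take a strongly increasing set of more
  than \<open>|K m|\<close> indices closed under the failure: any two of them show a strict increase
  of projections at some coordinate. Fixing this coordinate yields more than \<open>|K m|\<close>
  values inside one \<open>S n\<close>.\<close>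

lemma bounding_projection:
  assumes S: "\<And>n. |S n| \<le>o |K m|" "\<And>n. next_card (K n) \<in> S n"
  shows "\<exists>\<alpha>\<in>F. \<forall>\<beta>\<in>F. \<alpha> \<sqsubseteq> \<beta> \<longrightarrow> (\<forall>\<^sub>F n in sequentially. proj (S n) (f \<beta> n) = proj (S n) (f \<alpha> n))"
proof (rule ccontr)
  assume "\<not> ?thesis"
  then have "\<forall>\<alpha>. \<exists>\<beta>. \<alpha> \<in> F \<longrightarrow> \<beta> \<in> F \<and> \<alpha> \<sqsubseteq> \<beta> \<and> \<not> (\<forall>\<^sub>F n in sequentially. proj (S n) (f \<beta> n) = proj (S n) (f \<alpha> n))"
    by blast
  then obtain g where g: "\<And>\<alpha>. \<alpha> \<in> F \<Longrightarrow> g \<alpha> \<in> F \<and> \<alpha> \<sqsubseteq> g \<alpha> \<and>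
      \<not> (\<forall>\<^sub>F n in sequentially. proj (S n) (f (g \<alpha>) n) = proj (S n) (f \<alpha> n))" by metis
  let ?D = "{p \<in> F. \<forall>x. x \<sqsubset> p \<longrightarrow> g x \<sqsubset> p}"
  have "club_on F ?D" by (rule club_closure[OF F_reg]) (use g in blast)
  from strongly_increasing[OF this, of m] obtain X N where X: "X \<subseteq> ?D" "\<not> |X| \<le>o |K m|"
    and mono: "\<And>x y k. x \<in> X \<Longrightarrow> y \<in> X \<Longrightarrow> x \<sqsubset> y \<Longrightarrow> k \<ge> N \<Longrightarrow> f x k \<sqsubseteq> f y k" by blast
  have XF: "x \<in> F" if "x \<in> X" for x using X(1) that by blast
  \<comment> \<open>Modulo finite, \<open>f (g x)\<close> lies between \<open>f x\<close> and
    \<open>f y\<close>, so equal projections at \<open>x\<close> and \<open>y\<close> would force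
    the same projection at \<open>g x\<close>.\<close>
  have strict: "\<exists>k\<ge>N. proj (S k) (f x k) \<sqsubset> proj (S k) (f y k)" if xy: "x \<in> X" "y \<in> X" "x \<sqsubset> y" for x y
  proof (rule ccontr)
    assume n: "\<not> ?thesis"
    have F3: "x \<in> F" "y \<in> F" "g x \<in> F" using XF xy g by auto
    have gy: "g x \<sqsubset> y" using X(1) xy by blast
    have "\<forall>\<^sub>F k in sequentially. f x k \<sqsubseteq> f (g x) k" using ev_f_le g F3 by blast
    moreover have "\<forall>\<^sub>F k in sequentially. f (g x) k \<sqsubset> f y k" using ev_f_less[OF F3(2) gy] .
    ultimately have "\<forall>\<^sub>F k in sequentially. proj (S k) (f (g x) k) = proj (S k) (f x k)"
      using eventually_ge_at_top[of N]
    proof eventually_elim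
      case (elim k)
      have "proj (S k) (f x k) \<sqsubseteq> proj (S k) (f (g x) k)"
        using proj_f(3)[OF S(2) F3(3)] elim(1) by blast
      moreover have "proj (S k) (f (g x) k) \<sqsubseteq> proj (S k) (f y k)"
        using proj_f(3)[OF S(2) F3(2)] elim(2) by auto
      moreover have "\<not> proj (S k) (f x k) \<sqsubset> proj (S k) (f y k)" using n elim(3) by blast
      ultimately show ?case by order
    qed
    then show False using g F3(1) by blast
  qed
  \<comment> \<open>A last point of \<open>X\<close>, if there is one, has no next point in
    \<open>X\<close>; removing it leaves more than \<open>|K m|\<close> points.\<close>
  define X' where "X' = {x \<in> X. \<exists>y\<in>X. x \<sqsubset> y}"
  have "\<exists>t. X \<subseteq> insert t X'"
  proof (cases "X \<subseteq> X'")
    case False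
    then obtain t where t: "t \<in> X" "t \<notin> X'" by blast
    have "x \<in> insert t X'" if x: "x \<in> X" for x
      using t x neq_iff[of x t] unfolding X'_def by blast
    then show ?thesis by blast
  qed blast
  then have X'card: "\<not> |X'| \<le>o |K m|"
    using X(2) card_le_insert[OF K_inf] card_le_subset by metis
  define nt where "nt x = least_of {y \<in> X. x \<sqsubset> y}" for x
  have nt: "nt x \<in> X" "x \<sqsubset> nt x" "\<And>y. y \<in> X \<Longrightarrow> x \<sqsubset> y \<Longrightarrow> nt x \<sqsubseteq> y" if x: "x \<in> X'" for x
  proof -
    have "{y \<in> X. x \<sqsubset> y} \<noteq> {}" using x unfolding X'_def by blast
    from least_of_in[OF this] show "nt x \<in> X" "x \<sqsubset> nt x" unfolding nt_def by auto
    show "\<And>y. y \<in> X \<Longrightarrow> x \<sqsubset> y \<Longrightarrow> nt x \<sqsubseteq> y" unfolding nt_def by (rule least_of_le) auto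
  qed
  have X'X: "x \<in> X" if "x \<in> X'" for x using that unfolding X'_def by blast
  have "\<exists>k. k \<ge> N \<and> proj (S k) (f x k) \<sqsubset> proj (S k) (f (nt x) k)" if x: "x \<in> X'" for x
    using strict[OF X'X[OF x] nt(1,2)[OF x]] by blast
  then obtain k where k: "\<And>x. x \<in> X' \<Longrightarrow> k x \<ge> N \<and> proj (S (k x)) (f x (k x)) \<sqsubset> proj (S (k x)) (f (nt x) (k x))" by metis
  from card_pigeonhole[OF K_inf X'card, of k] obtain n where n: "\<not> |{x \<in> X'. k x = n}| \<le>o |K m|" ..
  let ?Y = "{x \<in> X'. k x = n}"
  have lt: "proj (S n) (f x n) \<sqsubset> proj (S n) (f y n)" if xy: "x \<in> ?Y" "y \<in> ?Y" "x \<sqsubset> y" for x y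
  proof -
    have "nt x \<in> X" "y \<in> X" "nt x \<sqsubseteq> y" "n \<ge> N" "proj (S n) (f x n) \<sqsubset> proj (S n) (f (nt x) n)"
      using xy nt[of x] X'X k[of x] by auto
    moreover from this have "f (nt x) n \<sqsubseteq> f y n"
      using mono[of "nt x" y n] by (cases "nt x = y") auto
    then have "proj (S n) (f (nt x) n) \<sqsubseteq> proj (S n) (f y n)"
      using proj_f(3)[OF S(2) XF] \<open>y \<in> X\<close> by blast
    ultimately show ?thesis by order
  qed
  have inj: "inj_on (\<lambda>x. proj (S n) (f x n)) ?Y"
  proof (rule inj_onI, rule ccontr)
    fix x y assume xy: "x \<in> ?Y" "y \<in> ?Y" "proj (S n) (f x n) = proj (S n) (f y n)" "x \<noteq> y"
    then show False using lt[of x y] lt[of y x] by (metis less_irrefl neqE)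
  qed
  have YS: "|?Y| \<le>o |S n|"
  proof (rule card_of_ordLeqI[OF inj])
    fix x assume "x \<in> ?Y"
    then have "x \<in> F" using X'X XF by blast
    then show "proj (S n) (f x n) \<in> S n" by (rule proj_f(1)[OF S(2)])
  qed
  show False by (rule notE[OF n ordLeq_transitive[OF YS S(1)]])
qed

text \<open>Stable projections to small sets are upper bounds of the sequence. If none is exact, the
  counterexamples \<open>gg i\<close> are fed into the later sets. The projections of one late
  \<open>f \<alpha>\<close> then decrease with \<open>i\<close> and stabilize; a value
  \<open>gg i n\<close> below the projection but not below \<open>f \<alpha> n\<close> would lower
  it once more. Hence \<open>gg i\<close> is below \<open>f \<alpha>\<close> almost
  everywhere.\<close>

lemma exact_upper_bound:
  "\<exists>h. (\<forall>n. h n \<sqsubseteq> next_card (K n)) \<and> (\<forall>\<alpha>\<in>F. \<forall>\<^sub>F n in sequentially. f \<alpha> n \<sqsubset> h n) \<and>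
    (\<forall>g. (\<forall>\<^sub>F n in sequentially. g n \<sqsubset> h n) \<longrightarrow> (\<exists>\<alpha>\<in>F. \<forall>\<^sub>F n in sequentially. g n \<sqsubset> f \<alpha> n))"
proof (rule ccontr)
  assume not_exact: "\<not> ?thesis"
  define G where "G h = (SOME g. (\<forall>\<^sub>F n in sequentially. g n \<sqsubset> h n) \<and>
    (\<forall>\<alpha>\<in>F. \<not> (\<forall>\<^sub>F n in sequentially. g n \<sqsubset> f \<alpha> n)))" for h
  have G: "(\<forall>\<^sub>F n in sequentially. G h n \<sqsubset> h n) \<and> (\<forall>\<alpha>\<in>F. \<not> (\<forall>\<^sub>F n in sequentially. G h n \<sqsubset> f \<alpha> n))"
    if "\<forall>n. h n \<sqsubseteq> next_card (K n)" "\<forall>\<alpha>\<in>F. \<forall>\<^sub>F n in sequentially. f \<alpha> n \<sqsubset> h n" for h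
  proof -
    have "\<exists>g. (\<forall>\<^sub>F n in sequentially. g n \<sqsubset> h n) \<and>
      (\<forall>\<alpha>\<in>F. \<not> (\<forall>\<^sub>F n in sequentially. g n \<sqsubset> f \<alpha> n))"
    proof (rule ccontr)
      assume n: "\<not> ?thesis"
      have "\<exists>\<alpha>\<in>F. \<forall>\<^sub>F n in sequentially. g n \<sqsubset> f \<alpha> n" if "\<forall>\<^sub>F n in sequentially. g n \<sqsubset> h n" for g
        by (rule ccontr, rule notE[OF n], intro exI[of _ g]) (use that in simp)
      then show False using not_exact that by (elim notE, intro exI[of _ h]) simp
    qed
    from someI_ex[OF this] show ?thesis unfolding G_def .
  qed
  define A where "A S = (SOME \<alpha>. \<alpha> \<in> F \<and> (\<forall>\<beta>\<in>F. \<alpha> \<sqsubseteq> \<beta> \<longrightarrow>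
    (\<forall>\<^sub>F n in sequentially. proj (S n) (f \<beta> n) = proj (S n) (f \<alpha> n))))" for S :: "nat \<Rightarrow> 'b set"
  define hh where "hh S n = proj (S n) (f (A S) n)" for S :: "nat \<Rightarrow> 'b set" and n
  define SS where "SS gg i n = insert (next_card (K n)) ((\<lambda>j. gg j n) ` below i)" for gg :: "'b \<Rightarrow> nat \<Rightarrow> 'b" and i n
  from rec_exists[of "\<lambda>gg i. G (hh (SS gg i))"] obtain gg where
    gg0: "\<forall>i. gg i = G (hh (SS (\<lambda>j. if j \<sqsubset> i then gg j else undefined) i))" ..
  have "SS (\<lambda>j. if j \<sqsubset> i then gg j else undefined) i = SS gg i" for i
    unfolding SS_def by (intro ext arg_cong2[of _ _ _ _ insert] image_cong) auto
  then have gg: "gg i = G (hh (SS gg i))" for i using gg0[rule_format, of i] by simp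
  \<comment> \<open>Regular and uncountable, so that the countably many indices \<open>st n\<close>
    have a bound below it; the sets built at stages below it have size at most
    \<open>|K 0|\<close>.\<close>
  define \<kappa> where "\<kappa> = next_card (K 0)"
  have \<kappa>: "regular_on (below \<kappa>) (K 0)" "|below \<kappa>| \<le>o |\<Union>n. K n|"
    unfolding \<kappa>_def using nxK(2) regD(3)[OF F_reg nxK(1)] by auto
  have SK: "next_card (K n) \<in> SS gg i n" for i n unfolding SS_def by simp
  have Smono: "SS gg i n \<subseteq> SS gg j n" if "i \<sqsubseteq> j" for i j n
    using below_mono[OF that] unfolding SS_def by auto
  have Scard: "|SS gg i n| \<le>o |K 0|" if "i \<sqsubset> \<kappa>" for i n
    unfolding SS_def by (intro card_le_insert K_inf card_le_image) (use regD(3)[OF \<kappa>(1)] that in auto)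
  have A: "A (SS gg i) \<in> F \<and> (\<forall>\<beta>\<in>F. A (SS gg i) \<sqsubseteq> \<beta> \<longrightarrow>
    (\<forall>\<^sub>F n in sequentially. proj (SS gg i n) (f \<beta> n) = hh (SS gg i) n))" if "i \<sqsubset> \<kappa>" for i
    unfolding hh_def unfolding A_def
    by (rule someI_ex) (use bounding_projection[of "SS gg i" 0] Scard[OF that] SK in blast)
  have h1: "hh (SS gg i) n \<sqsubseteq> next_card (K n)" if "i \<sqsubset> \<kappa>" for i n
    unfolding hh_def using A[OF that] f_nx by (intro proj_le SK) (auto intro: less_imp_le)
  have h2: "\<forall>\<^sub>F n in sequentially. f \<alpha> n \<sqsubset> hh (SS gg i) n" if i: "i \<sqsubset> \<kappa>" and \<alpha>: "\<alpha> \<in> F" for i \<alpha>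
  proof -
    obtain \<beta> where \<beta>: "\<beta> \<in> F" "\<alpha> \<sqsubset> \<beta>" "A (SS gg i) \<sqsubset> \<beta>" using reg_ub2[OF F_reg \<alpha>] A[OF i] by blast
    have "\<forall>\<^sub>F n in sequentially. proj (SS gg i n) (f \<beta> n) = hh (SS gg i) n" using A[OF i] \<beta> by auto
    then show ?thesis using ev_f_less[OF \<beta>(1,2)]
    proof eventually_elim
      case (elim n)
      then show ?case using proj_f(2)[OF SK \<beta>(1), of n i] by order
    qed
  qed
  have G': "\<forall>\<^sub>F n in sequentially. gg i n \<sqsubset> hh (SS gg i) n"
    "\<And>\<alpha>. \<alpha> \<in> F \<Longrightarrow> \<not> (\<forall>\<^sub>F n in sequentially. gg i n \<sqsubset> f \<alpha> n)" if "i \<sqsubset> \<kappa>" for i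
    using G[of "hh (SS gg i)"] h1[OF that] h2[OF that] unfolding gg[of i] by auto
  obtain \<alpha> where \<alpha>: "\<alpha> \<in> F" "\<forall>i\<in>below \<kappa>. A (SS gg i) \<sqsubset> \<alpha>"
    using reg_bound[OF F_reg \<kappa>(2), of "\<lambda>i. A (SS gg i)"] A by auto
  obtain z0 where z0: "z0 \<sqsubset> \<kappa>" using reg_ne[OF \<kappa>(1)] by auto
  have anti: "proj (SS gg j n) (f \<alpha> n) \<sqsubseteq> proj (SS gg i n) (f \<alpha> n)" if "i \<sqsubseteq> j" for i j n
    by (intro proj_le subsetD[OF Smono[OF that]] proj_f(1,2)[OF SK \<alpha>(1)])
  have "\<exists>i. i \<sqsubset> \<kappa> \<and> (\<forall>j. i \<sqsubseteq> j \<longrightarrow> j \<sqsubset> \<kappa> \<longrightarrow> proj (SS gg j n) (f \<alpha> n) = proj (SS gg i n) (f \<alpha> n))" for n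
    by (rule antimono_stable[OF z0]) (rule anti)
  then obtain st where st: "\<And>n. st n \<sqsubset> \<kappa>"
    "\<And>n j. st n \<sqsubseteq> j \<Longrightarrow> j \<sqsubset> \<kappa> \<Longrightarrow> proj (SS gg j n) (f \<alpha> n) = proj (SS gg (st n) n) (f \<alpha> n)" by metis
  obtain i where i: "i \<sqsubset> \<kappa>" "\<And>n. st n \<sqsubset> i"
    using reg_bound[OF \<kappa>(1) card_le_countable[OF K_inf], of UNIV st] st(1) by auto
  obtain j where j: "j \<sqsubset> \<kappa>" "i \<sqsubset> j" using reg_next[OF \<kappa>(1), of i] i(1) by auto
  have "\<forall>\<^sub>F n in sequentially. proj (SS gg i n) (f \<alpha> n) = hh (SS gg i) n" 
  proof -
    have "A (SS gg i) \<sqsubseteq> \<alpha>" using \<alpha>(2) i(1) less_imp_le by auto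
    then show ?thesis using conjunct2[OF A[OF i(1)], rule_format, OF \<alpha>(1)] by blast
  qed
  then have "\<forall>\<^sub>F n in sequentially. gg i n \<sqsubset> f \<alpha> n" using G'(1)[OF i(1)]
  proof eventually_elim
    case (elim n)
    have "st n \<sqsubseteq> i" "st n \<sqsubseteq> j" using i(2)[of n] j(2) by order+
    then have eq: "proj (SS gg j n) (f \<alpha> n) = proj (SS gg i n) (f \<alpha> n)"
      using st(2)[of n i] st(2)[of n j] i j(1) by auto
    have "gg i n \<in> SS gg j n" using j(2) unfolding SS_def by auto
    then have "\<not> f \<alpha> n \<sqsubseteq> gg i n"
      using proj_le[of "gg i n" "SS gg j n" "f \<alpha> n"] eq elim by (metis leD)
    then show ?case by order
  qed
  then show False using G'(2)[OF i(1) \<alpha>(1)] by blast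
qed

text \<open>Project onto the ladders of those \<open>h n\<close> that have cofinality at most
  \<open>|K m|\<close>. The stable projection lies below \<open>h\<close>, so by exactness some
  \<open>f \<beta>\<close> passes it almost everywhere, although a projection is never below the
  projected value.\<close>

lemma exact_upper_bound_cofinality:
  assumes h: "\<And>\<alpha>. \<alpha> \<in> F \<Longrightarrow> \<forall>\<^sub>F n in sequentially. f \<alpha> n \<sqsubset> h n"
    and exact: "\<And>g. \<forall>\<^sub>F n in sequentially. g n \<sqsubset> h n \<Longrightarrow> \<exists>\<alpha>\<in>F. \<forall>\<^sub>F n in sequentially. g n \<sqsubset> f \<alpha> n"
  shows "\<forall>\<^sub>F n in sequentially. \<not> cof_le (h n) (K m)"
proof -
  define S where "S n = insert (next_card (K n)) (if cof_le (h n) (K m) then e (h n) else {})" for n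
  have "|S n| \<le>o |K m|" for n unfolding S_def
    using ladderD(4)[OF e K_inf, of "h n" m] by (intro card_le_insert K_inf) (auto simp: card_of_empty)
  moreover have SK: "next_card (K n) \<in> S n" for n unfolding S_def by simp
  ultimately obtain \<alpha> where \<alpha>: "\<alpha> \<in> F" "\<And>\<beta>. \<beta> \<in> F \<Longrightarrow> \<alpha> \<sqsubseteq> \<beta> \<Longrightarrow>
    \<forall>\<^sub>F n in sequentially. proj (S n) (f \<beta> n) = proj (S n) (f \<alpha> n)" using bounding_projection[of S m] by blast
  define g where "g n = (if cof_le (h n) (K m) \<and> proj (S n) (f \<alpha> n) \<sqsubset> h n then proj (S n) (f \<alpha> n) else bot_elt)" for n
  have "\<forall>\<^sub>F n in sequentially. g n \<sqsubset> h n"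
    using h[OF \<alpha>(1)]
  proof eventually_elim
    case (elim n)
    then show ?case using bot_elt_le[of "f \<alpha> n"] unfolding g_def by (auto intro: le_less_trans)
  qed
  then obtain \<beta> where \<beta>: "\<beta> \<in> F" "\<forall>\<^sub>F n in sequentially. g n \<sqsubset> f \<beta> n" using exact by blast
  obtain \<gamma> where \<gamma>: "\<gamma> \<in> F" "\<alpha> \<sqsubset> \<gamma>" "\<beta> \<sqsubset> \<gamma>" using reg_ub2[OF F_reg \<alpha>(1) \<beta>(1)] by blast
  show ?thesis
    using \<beta>(2) ev_f_less[OF \<gamma>(1,3)] h[OF \<gamma>(1)] \<alpha>(2)[OF \<gamma>(1) less_imp_le[OF \<gamma>(2)]]
  proof eventually_elim
    case (elim n)
    show ?case
    proof
      assume c: "cof_le (h n) (K m)"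
      obtain y where y: "y \<in> e (h n)" "f \<gamma> n \<sqsubseteq> y" using ladderD(2)[OF e elim(3)] by blast
      have "proj (S n) (f \<gamma> n) \<sqsubseteq> y" using proj_le[of y "S n" "f \<gamma> n"] y c unfolding S_def by auto
      then have "proj (S n) (f \<alpha> n) \<sqsubset> h n" using ladderD(1)[OF e y(1)] elim(4) by order
      then have "g n = proj (S n) (f \<gamma> n)" using c elim(4) unfolding g_def by simp
      moreover have "f \<gamma> n \<sqsubseteq> proj (S n) (f \<gamma> n)" using proj_f(2)[OF SK \<gamma>(1)] .
      ultimately show False using elim(1,2) by order
    qed
  qed
qed

end

text \<open>\<open>H_cofle\<close> and \<open>T_H\<close> place the cofinality of \<open>H n\<close>
  above \<open>|T n|\<close> and at most at \<open>|T (Suc n)|\<close>. Moreover \<open>T_H\<close>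
  provides the cofinal set inside \<open>T (Suc n)\<close> itself, so that its elements can serve as
  an index set.\<close>

locale scale = ordinals le lt
  for le :: "'b \<Rightarrow> 'b \<Rightarrow> bool" (infix "\<sqsubseteq>" 50) and lt :: "'b \<Rightarrow> 'b \<Rightarrow> bool" (infix "\<sqsubset>" 50) +
  fixes F :: "'b set" and M :: "'b set" and T :: "nat \<Rightarrow> 'b set" and e :: "'b \<Rightarrow> 'b set"
    and H :: "nat \<Rightarrow> 'b" and f :: "'b \<Rightarrow> nat \<Rightarrow> 'b"
  assumes F_reg: "regular_on F M" and e: "ladder e"
    and T_inf: "infinite (T n)" and T_less: "\<not> |T (Suc n)| \<le>o |T n|" and T_M: "|T n| \<le>o |M|" "\<not> |M| \<le>o |T n|"
    and F_cofle: "x \<in> F \<Longrightarrow> \<exists>n. cof_le x (T n)"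
    and T_H: "x \<sqsubset> H n \<Longrightarrow> \<exists>y\<in>T (Suc n). x \<sqsubseteq> y \<and> y \<sqsubset> H n" and H_cofle: "\<not> cof_le (H n) (T n)"
    and f_H: "\<alpha> \<in> F \<Longrightarrow> f \<alpha> n \<sqsubset> H n"
    and f_less: "\<beta> \<in> F \<Longrightarrow> \<alpha> \<sqsubset> \<beta> \<Longrightarrow> \<forall>\<^sub>F n in sequentially. f \<alpha> n \<sqsubset> f \<beta> n"
    and f_cofinal: "(\<And>n. g n \<sqsubset> H n) \<Longrightarrow> \<exists>\<alpha>\<in>F. \<forall>\<^sub>F n in sequentially. g n \<sqsubset> f \<alpha> n"

context increasing_seq
begin

lemma scale_from_inc: "\<exists>T H f'. scale le lt F (\<Union>n. K n) T e H f'"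
proof -
  obtain h where h: "\<And>n. h n \<sqsubseteq> next_card (K n)" "\<And>\<alpha>. \<alpha> \<in> F \<Longrightarrow> \<forall>\<^sub>F n in sequentially. f \<alpha> n \<sqsubset> h n"
    "\<And>g. \<forall>\<^sub>F n in sequentially. g n \<sqsubset> h n \<Longrightarrow> \<exists>\<alpha>\<in>F. \<forall>\<^sub>F n in sequentially. g n \<sqsubset> f \<alpha> n"
    using exact_upper_bound by blast
  have hF: "h n \<in> F" for n using reg_le[OF F_reg nxK(1) h(1)] .
  have cof: "\<exists>n>N. \<not> cof_le (h n) (K m)" for N m
  proof -
    obtain N' where "\<And>n. n \<ge> N' \<Longrightarrow> \<not> cof_le (h n) (K m)"
      using exact_upper_bound_cofinality[OF h(2,3), of m] unfolding eventually_sequentially by blast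
    then show ?thesis by (intro exI[of _ "Suc (N + N')"]) simp
  qed
  have not_le: "\<not> |e (h n)| \<le>o |K m|" if "\<not> cof_le (h n) (K m)" for n m
  proof
    assume "|e (h n)| \<le>o |K m|"
    then have "cof_le (h n) (K m)"
      unfolding cof_le_def using ladderD(1,2)[OF e] by (intro exI[of _ "e (h n)"]) auto
    then show False using that by blast
  qed
  have e_inf: "infinite (e (h n))" if "\<not> cof_le (h n) (K m)" for n m
    using not_le[OF that] card_le_finite[OF K_inf] by blast
  \<comment> \<open>A subsequence along which the ladders at the exact upper bound strictly grow in
    size; passing \<open>|K j|\<close> at stage \<open>j\<close> keeps the sizes cofinal.\<close>
  have "\<exists>b. \<forall>j. \<not> cof_le (h (b j)) (K j) \<and> (b j < b (Suc j) \<and> \<not> |e (h (b (Suc j)))| \<le>o |e (h (b j))| )"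
  proof (rule dependent_nat_choice)
    show "\<exists>x. \<not> cof_le (h x) (K 0)" using cof by blast
  next
    fix x j assume "\<not> cof_le (h x) (K j)"
    obtain m where m: "cof_le (h x) (K m)" using F_cofle[OF hF] by blast
    then have em: "|e (h x)| \<le>o |K m|" using ladderD(4)[OF e K_inf] by blast
    obtain y where y: "y > x" "\<not> cof_le (h y) (K (m + Suc j))" using cof by blast
    have "\<not> cof_le (h y) (K (Suc j))" using y(2) cof_le_mono[OF _ K_le[of "Suc j" "m + Suc j"]] by auto
    moreover have "\<not> |e (h y)| \<le>o |e (h x)|"
    proof
      assume "|e (h y)| \<le>o |e (h x)|"
      then have "|e (h y)| \<le>o |K (m + Suc j)|"
        using ordLeq_transitive[OF ordLeq_transitive[OF _ em] K_le[of m "m + Suc j"]] by auto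
      then show False using not_le[OF y(2)] by blast
    qed
    ultimately show "\<exists>y. \<not> cof_le (h y) (K (Suc j)) \<and> (x < y \<and> \<not> |e (h y)| \<le>o |e (h x)| )" using y(1) by blast
  qed
  then obtain b where b: "\<And>j. \<not> cof_le (h (b j)) (K j)" "\<And>j. b j < b (Suc j)"
    "\<And>j. \<not> |e (h (b (Suc j)))| \<le>o |e (h (b j))|" by blast
  have b_ge: "j \<le> b (Suc j)" for j
  proof (induction j)
    case (Suc j)
    then show ?case using b(2)[of "Suc j"] by simp
  qed simp
  have sub: "\<forall>\<^sub>F j in sequentially. P (b (Suc j))" if PP: "\<forall>\<^sub>F n in sequentially. P n" for P
  proof -
    obtain N where "\<And>n. n \<ge> N \<Longrightarrow> P n" using PP unfolding eventually_sequentially by blast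
    then show ?thesis unfolding eventually_sequentially using b_ge le_trans by blast
  qed
  define T where "T j = e (h (b j))" for j
  \<comment> \<open>The shift makes \<open>T (Suc j)\<close> the ladder at \<open>H j\<close>, so
    that the cofinality of \<open>H j\<close> exceeds \<open>|T j|\<close>.\<close>
  define H where "H j = h (b (Suc j))" for j
  \<comment> \<open>Repairs the finitely many coordinates at which \<open>f \<alpha>\<close> is not
    below the bound.\<close>
  define f' where "f' \<alpha> j = (if f \<alpha> (b (Suc j)) \<sqsubset> H j then f \<alpha> (b (Suc j)) else bot_elt)" for \<alpha> j
  have T_inf: "infinite (T j)" for j unfolding T_def using e_inf[OF b(1)] .
  have f'_ev: "\<forall>\<^sub>F j in sequentially. f' \<alpha> j = f \<alpha> (b (Suc j))" if "\<alpha> \<in> F" for \<alpha>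
    using sub[OF h(2)[OF that]] by eventually_elim (simp add: f'_def H_def)
  have H_bt: "bot_elt \<sqsubset> H j" for j
  proof -
    have "e (H j) \<noteq> {}" using T_inf[of "Suc j"] unfolding T_def H_def by auto
    then show ?thesis using ladderD(1)[OF e] bot_elt_le le_less_trans by blast
  qed
  have "scale le lt F (\<Union>n. K n) T e H f'"
  proof
    show "regular_on F (\<Union>n. K n)" by (rule F_reg)
    show "ladder e" by (rule e)
    show "infinite (T n)" for n by (rule T_inf)
    show "\<not> |T (Suc n)| \<le>o |T n|" for n unfolding T_def by (rule b(3))
    show "|T n| \<le>o |\<Union>n. K n|" for n
      unfolding T_def using ladderD(1)[OF e] by (intro card_le_subset[OF _ regD(3)[OF F_reg hF[of "b n"]]]) auto
    show "\<not> |\<Union>n. K n| \<le>o |T n|" for n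
    proof
      assume *: "|\<Union>n. K n| \<le>o |T n|"
      obtain m where "cof_le (h (b n)) (K m)" using F_cofle[OF hF] by blast
      then have "|T n| \<le>o |K m|" unfolding T_def using ladderD(4)[OF e K_inf] by blast
      then show False using M_not_le ordLeq_transitive[OF *] by blast
    qed
    show "\<exists>n. cof_le x (T n)" if xF: "x \<in> F" for x
    proof -
      obtain m where "cof_le x (K m)" using F_cofle[OF xF] by blast
      moreover have "|K m| \<le>o |T m|"
        using not_le[OF b(1), of m] card_le_total unfolding T_def by blast
      ultimately show ?thesis using cof_le_mono by blast
    qed
    show "\<exists>y\<in>T (Suc n). x \<sqsubseteq> y \<and> y \<sqsubset> H n" if "x \<sqsubset> H n" for x n
      using ladderD(1,2)[OF e] that unfolding T_def H_def by blast
    show "\<not> cof_le (H n) (T n)" for n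
      using ladderD(4)[OF e T_inf, of "H n" n] b(3)[of n] unfolding H_def T_def by blast
    show "f' \<alpha> n \<sqsubset> H n" for \<alpha> n unfolding f'_def using H_bt by simp
    show "\<forall>\<^sub>F n in sequentially. f' \<alpha> n \<sqsubset> f' \<beta> n" if "\<beta> \<in> F" "\<alpha> \<sqsubset> \<beta>" for \<alpha> \<beta>
      using f'_ev[OF that(1)] f'_ev[OF F_dn[OF that]] sub[OF ev_f_less[OF that]]
      by eventually_elim simp
    show "\<exists>\<alpha>\<in>F. \<forall>\<^sub>F n in sequentially. g n \<sqsubset> f' \<alpha> n" if g: "\<And>n. g n \<sqsubset> H n" for g
    proof -
      \<comment> \<open>Extends \<open>g\<close> from the subsequence to all coordinates, so that
        exactness of \<open>h\<close> can be applied.\<close>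
      define g' where "g' n = (if \<exists>j. n = b (Suc j) then g (THE j. n = b (Suc j)) else bot_elt)" for n
      have "b i < b j" if "i < j" for i j
        using that
      proof (induction j)
        case (Suc j)
        then show ?case using b(2)[of j] by (cases "i = j") auto
      qed simp
      then have "(THE j'. b (Suc j) = b (Suc j')) = j" for j
        by (intro the_equality) (auto, metis Suc_less_eq nat_neq_iff)
      then have g'b: "g' (b (Suc j)) = g j" for j unfolding g'_def by auto
      have "\<forall>\<^sub>F n in sequentially. g' n \<sqsubset> h n"
      proof -
        obtain \<alpha> where "\<alpha> \<in> F" using reg_ne[OF F_reg] by blast
        from h(2)[OF this] show ?thesis
        proof eventually_elim
          case (elim n)
          show ?case
          proof (cases "\<exists>j. n = b (Suc j)")
            case True
            then obtain j where "n = b (Suc j)" ..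
            then show ?thesis using g'b g[of j] unfolding H_def by simp
          next
            case False
            then show ?thesis unfolding g'_def using elim bot_elt_le[of "f \<alpha> n"] by auto
          qed
        qed
      qed
      then obtain \<alpha> where \<alpha>: "\<alpha> \<in> F" "\<forall>\<^sub>F n in sequentially. g' n \<sqsubset> f \<alpha> n" using h(3) by blast
      have "\<forall>\<^sub>F j in sequentially. g j \<sqsubset> f' \<alpha> j"
        using sub[OF \<alpha>(2)] f'_ev[OF \<alpha>(1)] by eventually_elim (simp add: g'b)
      then show ?thesis using \<alpha>(1) by blast
    qed
  qed
  then show ?thesis by blast
qed

end

lemma (in filtered) scale_exists: "\<exists>T e H f. scale le lt F (\<Union>n. K n) T e H f"
  using inc_exists increasing_seq.scale_from_inc by blast

section \<open>The club guessing ideal\<close>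

context scale
begin

lemma F_dn: "x \<in> F \<Longrightarrow> y \<sqsubset> x \<Longrightarrow> y \<in> F"
  using regD(2)[OF F_reg] .

lemma T_Suc: "|T n| \<le>o |T (Suc n)|"
  using T_less card_le_total by blast

lemma T_mono: "m \<le> n \<Longrightarrow> |T m| \<le>o |T n|"
proof (induction n rule: dec_induct)
  case base
  show ?case by (rule ordLeq_reflexive[OF card_of_Well_order])
next
  case (step n)
  then show ?case using ordLeq_transitive[OF _ T_Suc] by blast
qed

section \<open>Filled omega-sequences that guess clubs\<close>

definition omega_seq :: "'b \<Rightarrow> nat \<Rightarrow> 'b" where
  "omega_seq \<delta> = (SOME s. (\<forall>i. s i \<sqsubset> \<delta>) \<and> (\<forall>x. x \<sqsubset> \<delta> \<longrightarrow> (\<exists>i. x \<sqsubset> s i)))"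

definition cof_omega :: "'b set" where
  "cof_omega = {\<delta> \<in> F. (\<forall>i. omega_seq \<delta> i \<sqsubset> \<delta>) \<and> (\<forall>x. x \<sqsubset> \<delta> \<longrightarrow> (\<exists>i. x \<sqsubset> omega_seq \<delta> i))}"

lemma SC_I:
  assumes "\<delta> \<in> F" "\<And>i::nat. s i \<sqsubset> \<delta>" "\<And>x. x \<sqsubset> \<delta> \<Longrightarrow> \<exists>i. x \<sqsubset> s i"
  shows "\<delta> \<in> cof_omega"
proof -
  have "\<exists>s. (\<forall>i::nat. s i \<sqsubset> \<delta>) \<and> (\<forall>x. x \<sqsubset> \<delta> \<longrightarrow> (\<exists>i. x \<sqsubset> s i))"
    using assms(2,3) by (intro exI[of _ s]) simp
  from someI_ex[OF this] show ?thesis unfolding cof_omega_def omega_seq_def using assms(1) by blast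
qed

lemma SC_D:
  assumes "\<delta> \<in> cof_omega"
  shows "\<delta> \<in> F" "omega_seq \<delta> i \<sqsubset> \<delta>" "x \<sqsubset> \<delta> \<Longrightarrow> \<exists>i. x \<sqsubset> omega_seq \<delta> i"
  using assms unfolding cof_omega_def by auto

primrec fill_step :: "'b set \<Rightarrow> 'b \<Rightarrow> nat \<Rightarrow> nat \<Rightarrow> 'b set" where
  "fill_step D \<delta> m 0 = range (\<lambda>i. last_below D (omega_seq \<delta> i))"
| "fill_step D \<delta> m (Suc k) = fill_step D \<delta> m k \<union>
     (\<Union>\<beta>\<in>{\<beta> \<in> fill_step D \<delta> m k. cof_le \<beta> (T m)}. last_below D ` e \<beta>)"

definition fill :: "'b set \<Rightarrow> 'b \<Rightarrow> nat \<Rightarrow> 'b set" where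
  "fill D \<delta> m = (\<Union>k. fill_step D \<delta> m k)"

lemma fill_card: "|fill D \<delta> m| \<le>o |T m|"
proof -
  have "|fill_step D \<delta> m k| \<le>o |T m|" for k
  proof (induction k)
    case 0
    then show ?case by (simp add: card_le_image card_le_countable T_inf)
  next
    case (Suc k)
    have "|\<Union>\<beta>\<in>{\<beta> \<in> fill_step D \<delta> m k. cof_le \<beta> (T m)}. last_below D ` e \<beta>| \<le>o |T m|"
    proof (rule card_le_UN[OF T_inf])
      show "|{\<beta> \<in> fill_step D \<delta> m k. cof_le \<beta> (T m)}| \<le>o |T m|"
        by (rule card_le_subset[OF _ Suc.IH]) blast
      show "|last_below D ` e \<beta>| \<le>o |T m|" if "\<beta> \<in> {\<beta> \<in> fill_step D \<delta> m k. cof_le \<beta> (T m)}" for \<beta>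
        using that by (intro card_le_image ladderD(4)[OF e T_inf]) auto
    qed
    then show ?case using Suc.IH by (simp add: card_le_Un T_inf)
  qed
  then show ?thesis unfolding fill_def by (intro card_le_UN T_inf card_le_countable)
qed

lemma fill_mono:
  assumes "m \<le> n"
  shows "fill D \<delta> m \<subseteq> fill D \<delta> n"
proof -
  have "fill_step D \<delta> m k \<subseteq> fill_step D \<delta> n k" for k
  proof (induction k)
    case (Suc k)
    have "{\<beta> \<in> fill_step D \<delta> m k. cof_le \<beta> (T m)} \<subseteq> {\<beta> \<in> fill_step D \<delta> n k. cof_le \<beta> (T n)}"
      using Suc.IH cof_le_mono[OF _ T_mono[OF assms]] by blast
    then show ?case using Suc.IH by (simp only: fill_step.simps) blast
  qed simp
  then show ?thesis unfolding fill_def by blast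
qed

lemma fill_seq: "last_below D (omega_seq \<delta> i) \<in> fill D \<delta> m"
  unfolding fill_def by (rule UN_I[of 0]) auto

lemma fill_ladder: "\<beta> \<in> fill D \<delta> m \<Longrightarrow> cof_le \<beta> (T m) \<Longrightarrow> \<gamma> \<in> e \<beta> \<Longrightarrow> last_below D \<gamma> \<in> fill D \<delta> m"
proof -
  assume *: "\<beta> \<in> fill D \<delta> m" "cof_le \<beta> (T m)" "\<gamma> \<in> e \<beta>"
  then obtain k where "\<beta> \<in> fill_step D \<delta> m k" unfolding fill_def by blast
  then have "last_below D \<gamma> \<in> fill_step D \<delta> m (Suc k)" using *(2,3) by auto
  then show ?thesis unfolding fill_def by blast
qed

text \<open>
  The values \<open>last_below (D i) \<gamma>\<close> decrease with \<open>i\<close>, so they stabilize along a chain of clubs; since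
  all of them stay above \<open>\<rho>\<close>, the descent along ladders ends at a point of large cofinality.
\<close>

lemma fill_descent:
  assumes \<kappa>: "regular_on (below \<kappa>) B" and D: "\<And>i. i \<sqsubseteq> \<kappa> \<Longrightarrow> club_on F (D i)" "\<And>i j. i \<sqsubseteq> j \<Longrightarrow> D j \<subseteq> D i"
    and \<rho>: "\<not> cof_le \<rho> (T m)" "\<And>i. i \<sqsubset> \<kappa> \<Longrightarrow> \<rho> \<in> D i" "bot_elt \<sqsubset> \<rho>"
    and \<beta>: "\<rho> \<sqsubseteq> \<beta>" "\<beta> \<in> F" "i0 \<sqsubset> \<kappa>" "\<And>i. i0 \<sqsubseteq> i \<Longrightarrow> i \<sqsubset> \<kappa> \<Longrightarrow> \<beta> \<in> D i \<and> \<beta> \<in> fill (D i) \<delta> m"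
  shows "\<exists>\<beta>'. \<rho> \<sqsubseteq> \<beta>' \<and> \<not> cof_le \<beta>' (T m) \<and>
    (\<exists>i0. i0 \<sqsubset> \<kappa> \<and> (\<forall>i. i0 \<sqsubseteq> i \<longrightarrow> i \<sqsubset> \<kappa> \<longrightarrow> \<beta>' \<in> D i \<and> \<beta>' \<in> fill (D i) \<delta> m))"
  using \<beta>
proof (induction \<beta> arbitrary: i0 rule: less_induct)
  case (less \<beta>)
  show ?case
  proof (cases "cof_le \<beta> (T m)")
    case False
    then show ?thesis using less.prems by blast
  next
    case True
    then have "\<rho> \<sqsubset> \<beta>" using less.prems(1) \<rho>(1) by (cases "\<rho> = \<beta>") auto
    then obtain \<gamma> where \<gamma>: "\<gamma> \<in> e \<beta>" "\<rho> \<sqsubseteq> \<gamma>" using ladderD(2)[OF e] by blast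
    have \<gamma>\<beta>: "\<gamma> \<sqsubset> \<beta>" using ladderD(1)[OF e \<gamma>(1)] .
    have "\<exists>i. i \<sqsubset> \<kappa> \<and> (\<forall>j. i \<sqsubseteq> j \<longrightarrow> j \<sqsubset> \<kappa> \<longrightarrow> last_below (D j) \<gamma> = last_below (D i) \<gamma>)"
      by (rule antimono_stable[OF less.prems(3)]) (rule last_below_antimono, rule D(2))
    then obtain i1 where i1: "i1 \<sqsubset> \<kappa>" "\<And>j. i1 \<sqsubseteq> j \<Longrightarrow> j \<sqsubset> \<kappa> \<Longrightarrow> last_below (D j) \<gamma> = last_below (D i1) \<gamma>" by blast
    obtain i2 where i2: "i2 \<sqsubset> \<kappa>" "i0 \<sqsubset> i2" "i1 \<sqsubset> i2"
      using reg_ub2[OF \<kappa>, of i0 i1] less.prems(3) i1(1) by auto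
    define \<beta>' where "\<beta>' = last_below (D i1) \<gamma>"
    have \<rho>\<beta>': "\<rho> \<sqsubseteq> \<beta>'" unfolding \<beta>'_def by (rule last_below_ge[OF \<rho>(2)[OF i1(1)] \<gamma>(2)])
    have \<gamma>F: "\<gamma> \<in> F" using F_dn[OF less.prems(2) \<gamma>\<beta>] .
    have "\<beta>' \<in> D i \<and> \<beta>' \<in> fill (D i) \<delta> m" if i: "i2 \<sqsubseteq> i" "i \<sqsubset> \<kappa>" for i
    proof -
      have le: "i1 \<sqsubseteq> i" "i0 \<sqsubseteq> i" using i i2 by order+
      have eq: "last_below (D i) \<gamma> = \<beta>'" unfolding \<beta>'_def using i1(2)[OF le(1) i(2)] .
      have "last_below (D i) \<gamma> \<in> insert bot_elt (D i)"
        by (rule last_below_in[OF D(1) \<gamma>F F_dn[OF \<gamma>F]]) (use i in auto)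
      moreover have "\<beta>' \<noteq> bot_elt" using \<rho>(3) \<rho>\<beta>' by auto
      moreover have "last_below (D i) \<gamma> \<in> fill (D i) \<delta> m"
        using fill_ladder[OF _ True \<gamma>(1)] less.prems(4)[OF le(2) i(2)] by blast
      ultimately show ?thesis using eq by auto
    qed
    moreover have "\<beta>' \<sqsubset> \<beta>" unfolding \<beta>'_def using last_below_le \<gamma>\<beta> by (rule le_less_trans)
    ultimately show ?thesis using less.IH[of \<beta>' i2] \<rho>\<beta>' i2(1) F_dn[OF less.prems(2)] by blast
  qed
qed

text \<open>The iteration of failures is that of ordinary club guessing, but \<delta> has to see
  arbitrarily large cofinalities. It is the limit of points \<open>u (Suc m)\<close> of the last
  club with cofinality above \<open>|T m|\<close>. For each \<open>N\<close>, rounding a term of its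
  sequence down to the clubs and descending along ladders ends above such a point, at a place that
  is stable along the chain.\<close>

lemma fill_guessing:
  "\<exists>D. club_on F D \<and> (\<forall>E. club_on F E \<longrightarrow> (\<exists>\<delta>\<in>cof_omega \<inter> E. \<forall>N. \<exists>\<beta>\<in>E \<inter> fill D \<delta> N.
     (\<forall>i\<le>N. omega_seq \<delta> i \<sqsubset> \<beta>) \<and> \<not> cof_le \<beta> (T N)))"
proof (rule ccontr)
  assume "\<not> ?thesis"
  then have "\<forall>D. \<exists>E. club_on F D \<longrightarrow> club_on F E \<and> \<not> (\<exists>\<delta>\<in>cof_omega \<inter> E. \<forall>N. \<exists>\<beta>\<in>E \<inter> fill D \<delta> N.
     (\<forall>i\<le>N. omega_seq \<delta> i \<sqsubset> \<beta>) \<and> \<not> cof_le \<beta> (T N))" by meson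
  then obtain \<Phi> where \<Phi>: "\<And>D. club_on F D \<Longrightarrow> club_on F (\<Phi> D)"
    "\<And>D. club_on F D \<Longrightarrow> \<not> (\<exists>\<delta>\<in>cof_omega \<inter> \<Phi> D. \<forall>N. \<exists>\<beta>\<in>\<Phi> D \<inter> fill D \<delta> N.
     (\<forall>i\<le>N. omega_seq \<delta> i \<sqsubset> \<beta>) \<and> \<not> cof_le \<beta> (T N))" by metis
  \<comment> \<open>Any uncountable regular length works, as only countably many indices, one for
    each \<open>N\<close>, have to be passed.\<close>
  define \<kappa> where "\<kappa> = next_card (T 0)"
  obtain x0 where x0: "x0 \<in> F" "\<not> |below x0| \<le>o |T 0|" using reg_big[OF F_reg T_M(2)] by blast
  have \<kappa>F: "\<kappa> \<in> F" unfolding \<kappa>_def using reg_le[OF F_reg x0(1) next_card_le[OF x0(2)]] .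
  have \<kappa>: "regular_on (below \<kappa>) (T 0)" "|below \<kappa>| \<le>o |M|"
    unfolding \<kappa>_def using reg_nx[OF T_inf x0(2)] regD(3)[OF F_reg \<kappa>F[unfolded \<kappa>_def]] by auto
  obtain D where D: "\<And>i. i \<sqsubseteq> \<kappa> \<Longrightarrow> club_on F (D i)" "\<And>i j. i \<sqsubset> j \<Longrightarrow> D j \<subseteq> D i \<inter> \<Phi> (D i)"
    "\<And>i j. i \<sqsubseteq> j \<Longrightarrow> D j \<subseteq> D i"
    using club_chain[OF F_reg \<kappa>(2), of "\<lambda>D. D \<inter> \<Phi> D"] club_Int[OF F_reg] \<Phi>(1) by blast
  let ?E = "D \<kappa>"
  have E: "club_on F ?E" using D(1) by blast
  have "\<exists>\<rho>\<in>F. \<eta> \<sqsubset> \<rho> \<and> \<rho> \<in> ?E \<and> \<not> cof_le \<rho> (T m)" if \<eta>: "\<eta> \<in> F" for \<eta> m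
  proof -
    obtain \<rho> where "\<rho> \<in> F" "\<eta> \<sqsubset> \<rho>" "limit_of ?E \<rho>" "\<not> cof_le \<rho> (T m)"
      using club_point_cofinality[OF F_reg E \<eta> T_inf T_M(2)] by metis
    then show ?thesis using clubD(3)[OF E] by blast
  qed
  then obtain r where r: "\<And>\<eta> m. \<eta> \<in> F \<Longrightarrow> r \<eta> m \<in> F \<and> \<eta> \<sqsubset> r \<eta> m \<and> r \<eta> m \<in> ?E \<and> \<not> cof_le (r \<eta> m) (T m)"
    by metis
  define u where "u = rec_nat bot_elt (\<lambda>m \<eta>. r \<eta> m)"
  have u0: "u 0 = bot_elt" and uS: "u (Suc m) = r (u m) m" for m unfolding u_def by auto
  obtain y0 where "y0 \<in> F" using reg_ne[OF F_reg] by blast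
  then have "bot_elt \<in> F" using reg_le[OF F_reg _ bot_elt_le] by blast
  then have uF: "u m \<in> F" for m by (induction m) (use r u0 uS in auto)
  have uSm: "u m \<sqsubset> u (Suc m)" "u (Suc m) \<in> ?E" "\<not> cof_le (u (Suc m)) (T m)" for m
    using r[OF uF[of m], of m] uS by auto
  define \<delta> where "\<delta> = lub (range u)"
  have "range u \<subseteq> F" "|range u| \<le>o |M|"
    using uF card_le_image[OF card_le_countable[OF regD(1)[OF F_reg]], of u UNIV] by auto
  from reg_lub[OF F_reg this] have \<delta>F: "\<delta> \<in> F" and "u m \<sqsubseteq> \<delta>" for m unfolding \<delta>_def by auto
  then have u\<delta>: "u m \<sqsubset> \<delta>" for m using uSm(1) less_le_trans by blast
  have \<delta>u: "\<exists>m. x \<sqsubset> u m" if "x \<sqsubset> \<delta>" for x using lub_gt[of x "range u"] that unfolding \<delta>_def by auto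
  have \<delta>S: "\<delta> \<in> cof_omega" by (rule SC_I[OF \<delta>F, of u]) (use u\<delta> \<delta>u in auto)
  have \<delta>E: "\<delta> \<in> ?E"
  proof (rule clubD(3)[OF E \<delta>F limI[OF u\<delta>]])
    fix x assume "x \<sqsubset> \<delta>"
    then obtain m where "x \<sqsubset> u m" using \<delta>u by blast
    then have "x \<sqsubset> u (Suc m)" using uSm(1)[of m] by order
    then show "\<exists>c\<in>?E. x \<sqsubset> c \<and> c \<sqsubset> \<delta>" using uSm(2) u\<delta> by blast
  qed
  have u_mono: "u i \<sqsubseteq> u j" if "i \<le> j" for i j
    using that
  proof (induction j rule: dec_induct)
    case (step n)
    then show ?case using uSm(1)[of n] by order
  qed simp
  have pt: "\<exists>\<beta> i0. (\<forall>i\<le>N. omega_seq \<delta> i \<sqsubset> \<beta>) \<and> \<not> cof_le \<beta> (T N) \<and> i0 \<sqsubset> \<kappa> \<and>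
    (\<forall>i. i0 \<sqsubseteq> i \<longrightarrow> i \<sqsubset> \<kappa> \<longrightarrow> \<beta> \<in> D i \<and> \<beta> \<in> fill (D i) \<delta> N)" for N
  proof -
    obtain a where a: "\<And>i. omega_seq \<delta> i \<sqsubset> u (a i)" using \<delta>u[OF SC_D(2)[OF \<delta>S]] by metis
    \<comment> \<open>The sum is at least every \<open>a i\<close> with \<open>i \<le> N\<close>;
      the summand \<open>N\<close> makes the cofinality of \<rho> exceed
      \<open>|T N|\<close>.\<close>
    define q where "q = (\<Sum>i\<le>N. a i) + N"
    define \<rho> where "\<rho> = u (Suc q)"
    have below: "omega_seq \<delta> i \<sqsubset> \<rho>" if "i \<le> N" for i
    proof -
      have "a i \<le> (\<Sum>i\<le>N. a i)" using that by (intro member_le_sum) auto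
      then have "u (a i) \<sqsubseteq> \<rho>" unfolding \<rho>_def q_def by (intro u_mono) auto
      then show ?thesis using a[of i] by order
    qed
    have \<rho>c: "\<not> cof_le \<rho> (T N)"
      using uSm(3)[of q] cof_le_mono[OF _ T_mono[of N q]] unfolding \<rho>_def q_def by auto
    have \<rho>D: "\<rho> \<in> D i" if "i \<sqsubset> \<kappa>" for i
      using uSm(2)[of q] D(3)[OF less_imp_le[OF that]] unfolding \<rho>_def by blast
    have bot_elt\<rho>: "bot_elt \<sqsubset> \<rho>" using uSm(1)[of q] bot_elt_le[of "u q"] unfolding \<rho>_def by order
    obtain l where l: "\<rho> \<sqsubset> omega_seq \<delta> l" using SC_D(3)[OF \<delta>S u\<delta>] unfolding \<rho>_def by blast
    let ?\<gamma> = "omega_seq \<delta> l"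
    have \<gamma>F: "?\<gamma> \<in> F" using F_dn[OF \<delta>F SC_D(2)[OF \<delta>S]] .
    obtain z0 where z0: "z0 \<sqsubset> \<kappa>" using reg_ne[OF \<kappa>(1)] by auto
    have "\<exists>i. i \<sqsubset> \<kappa> \<and> (\<forall>j. i \<sqsubseteq> j \<longrightarrow> j \<sqsubset> \<kappa> \<longrightarrow> last_below (D j) ?\<gamma> = last_below (D i) ?\<gamma>)"
      by (rule antimono_stable[OF z0]) (rule last_below_antimono, rule D(3))
    then obtain i1 where i1: "i1 \<sqsubset> \<kappa>" "\<And>j. i1 \<sqsubseteq> j \<Longrightarrow> j \<sqsubset> \<kappa> \<Longrightarrow> last_below (D j) ?\<gamma> = last_below (D i1) ?\<gamma>" by blast
    define \<beta> where "\<beta> = last_below (D i1) ?\<gamma>"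
    have \<rho>\<beta>: "\<rho> \<sqsubseteq> \<beta>" unfolding \<beta>_def by (rule last_below_ge[OF \<rho>D[OF i1(1)] less_imp_le[OF l]])
    have st: "\<beta> \<in> D i \<and> \<beta> \<in> fill (D i) \<delta> N" if i: "i1 \<sqsubseteq> i" "i \<sqsubset> \<kappa>" for i
    proof -
      have eq: "last_below (D i) ?\<gamma> = \<beta>" unfolding \<beta>_def using i1(2)[OF i] .
      have "last_below (D i) ?\<gamma> \<in> insert bot_elt (D i)"
        by (rule last_below_in[OF D(1) \<gamma>F F_dn[OF \<gamma>F]]) (use i in auto)
      moreover have "\<beta> \<noteq> bot_elt" using bot_elt\<rho> \<rho>\<beta> by auto
      ultimately show ?thesis using eq fill_seq[of "D i" \<delta> l N] by auto
    qed
    have \<beta>F: "\<beta> \<in> F" using reg_le[OF F_reg \<gamma>F last_below_le] unfolding \<beta>_def .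
    obtain \<beta>' i0 where "\<rho> \<sqsubseteq> \<beta>'" "\<not> cof_le \<beta>' (T N)" "i0 \<sqsubset> \<kappa>"
      "\<forall>i. i0 \<sqsubseteq> i \<longrightarrow> i \<sqsubset> \<kappa> \<longrightarrow> \<beta>' \<in> D i \<and> \<beta>' \<in> fill (D i) \<delta> N"
      using fill_descent[where D = D and \<delta> = \<delta>, OF \<kappa>(1) D(1) D(3) \<rho>c \<rho>D bot_elt\<rho> \<rho>\<beta> \<beta>F i1(1) st] by blast
    then show ?thesis using below less_le_trans by blast
  qed
  then obtain b i0 where b: "\<And>N i. i \<le> N \<Longrightarrow> omega_seq \<delta> i \<sqsubset> b N" "\<And>N. \<not> cof_le (b N) (T N)" "\<And>N. i0 N \<sqsubset> \<kappa>"
    "\<And>N i. i0 N \<sqsubseteq> i \<Longrightarrow> i \<sqsubset> \<kappa> \<Longrightarrow> b N \<in> D i \<and> b N \<in> fill (D i) \<delta> N" by metis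
  obtain i where i: "i \<sqsubset> \<kappa>" "\<And>N. i0 N \<sqsubset> i"
    using reg_bound[OF \<kappa>(1) card_le_countable[OF T_inf], of UNIV i0] b(3) by auto
  obtain j where j: "j \<sqsubset> \<kappa>" "i \<sqsubset> j" using reg_next[OF \<kappa>(1), of i] i(1) by auto
  have "b N \<in> \<Phi> (D i) \<and> b N \<in> fill (D i) \<delta> N" for N
  proof -
    have "i0 N \<sqsubseteq> i" "i0 N \<sqsubseteq> j" using i(2)[of N] j(2) by order+
    then show ?thesis using b(4)[of N i] b(4)[of N j] i(1) j D(2)[OF j(2)] by blast
  qed
  moreover have "\<delta> \<in> \<Phi> (D i)" using \<delta>E D(2)[OF i(1)] by blast
  ultimately show False using \<Phi>(2)[OF D(1)[OF less_imp_le[OF i(1)]]] \<delta>S b(1,2) by blast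
qed

text \<open>One number \<open>N\<close> governs both the levels \<open>m\<close> and the terms of
  the sequence to be passed, and enlarging it weakens the condition. Hence sums of witnesses serve
  for finite unions.\<close>

definition guess_null :: "'b set \<Rightarrow> 'b set \<Rightarrow> 'b set \<Rightarrow> bool" where
  "guess_null D A E \<longleftrightarrow> (\<forall>\<delta>\<in>cof_omega \<inter> E. \<exists>N. \<forall>m\<ge>N. \<forall>\<beta>\<in>A \<inter> E \<inter> fill D \<delta> m.
     (\<forall>i\<le>N. omega_seq \<delta> i \<sqsubset> \<beta>) \<longrightarrow> cof_le \<beta> (T m))"

definition guess_ideal :: "'b set \<Rightarrow> 'b set set" where
  "guess_ideal D = {A. A \<subseteq> F \<and> (\<exists>E. club_on F E \<and> guess_null D A E)}"

end

section \<open>The coloring\<close>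

context scale
begin

lemma fill_below:
  assumes "\<delta> \<in> cof_omega"
  shows "fill D \<delta> m \<subseteq> below \<delta>"
proof -
  have "fill_step D \<delta> m k \<subseteq> below \<delta>" for k
  proof (induction k)
    case 0
    show ?case using le_less_trans[OF last_below_le SC_D(2)[OF assms]] by auto
  next
    case (Suc k)
    have "last_below D \<gamma> \<sqsubset> \<delta>" if "\<beta> \<in> fill_step D \<delta> m k" "\<gamma> \<in> e \<beta>" for \<beta> \<gamma>
    proof -
      have "\<beta> \<sqsubset> \<delta>" "\<gamma> \<sqsubset> \<beta>" using Suc.IH that ladderD(1)[OF e] by auto
      then show ?thesis using last_below_le[of D \<gamma>] by order
    qed
    then show ?case using Suc.IH by auto
  qed
  then show ?thesis unfolding fill_def by blast
qed

section \<open>Walks along ladders and the color of a pair\<close>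

definition step :: "nat \<Rightarrow> 'b \<Rightarrow> 'b \<Rightarrow> 'b" where
  "step m x z = (if x \<sqsubset> z \<and> cof_le z (T m) then least_of {y \<in> e z. x \<sqsubseteq> y} else z)"

definition node :: "nat \<Rightarrow> 'b \<Rightarrow> 'b \<Rightarrow> nat \<Rightarrow> 'b" where
  "node m x y i = (step m x ^^ i) y"

text \<open>
  The walk from \<open>y\<close> towards \<open>x\<close> stops at the first node of cofinality above \<open>|T m|\<close>. The color is the
  least candidate above \<open>x\<close>: if \<open>x\<close> is close enough below a point \<open>b\<close> of cofinality above \<open>|T m|\<close>, no
  candidate lies in between, since all sets involved have size at most \<open>|T m|\<close>.
\<close>

definition fill_union :: "'b set \<Rightarrow> nat \<Rightarrow> 'b \<Rightarrow> 'b set" where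
  "fill_union D m z = (\<Union>\<delta>\<in>cof_omega \<inter> e z. fill D \<delta> m)"

definition candidates :: "'b set \<Rightarrow> nat \<Rightarrow> 'b \<Rightarrow> 'b \<Rightarrow> 'b set" where
  "candidates D m x y = {z. x \<sqsubseteq> z \<and> (\<exists>i. z = node m x y i \<or>
     (cof_le (node m x y i) (T m) \<and> z \<in> fill_union D m (node m x y i)))}"

text \<open>The value is arbitrary if \<open>f x\<close> is below \<open>f y\<close> everywhere;
  \<open>color_in\<close> holds whatever it is.\<close>

definition crossing :: "'b \<Rightarrow> 'b \<Rightarrow> nat" where
  "crossing x y = (SOME m. \<not> f x m \<sqsubset> f y m \<and> (\<forall>n>m. f x n \<sqsubset> f y n))"

definition color :: "'b set \<Rightarrow> 'b \<Rightarrow> 'b \<Rightarrow> 'b" where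
  "color D x y = least_of (candidates D (crossing x y) x y)"

lemma node_0 [simp]: "node m x y 0 = y"
  by (simp add: node_def)

lemma node_Suc: "node m x y (Suc i) = step m x (node m x y i)"
  by (simp add: node_def)

lemma node_Suc': "node m x y (Suc i) = node m x (step m x y) i"
  by (simp add: node_def funpow_swap1)

lemma step_ge: "x \<sqsubseteq> z \<Longrightarrow> x \<sqsubseteq> step m x z"
  unfolding step_def using least_of_in[of "{y \<in> e z. x \<sqsubseteq> y}"] ladderD(2)[OF e, of x z] by auto

lemma node_ge: "x \<sqsubseteq> y \<Longrightarrow> x \<sqsubseteq> node m x y i"
  by (induction i) (auto simp: node_Suc step_ge)

lemma color_in:
  assumes "y \<in> F" "x \<sqsubset> y"
  shows "color D x y \<in> F"
proof -
  have "y \<in> candidates D (crossing x y) x y"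
    unfolding candidates_def using assms(2) node_0[of "crossing x y" x y] by (auto intro!: exI[of _ 0])
  then show ?thesis unfolding color_def using reg_le[OF F_reg assms(1) least_of_le] by blast
qed

lemma crossing_eq:
  assumes "\<not> f x m \<sqsubset> f y m" "\<And>n. n > m \<Longrightarrow> f x n \<sqsubset> f y n"
  shows "crossing x y = m"
  unfolding crossing_def
proof (rule some_equality)
  fix k assume "\<not> f x k \<sqsubset> f y k \<and> (\<forall>n>k. f x n \<sqsubset> f y n)"
  then show "k = m" using assms by (metis nat_neq_iff)
qed (use assms in blast)

lemma fill_union_card: "cof_le z (T m) \<Longrightarrow> |fill_union D m z| \<le>o |T m|"
  unfolding fill_union_def
  by (intro card_le_UN T_inf fill_card card_le_subset[OF _ ladderD(4)[OF e T_inf]]) auto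

text \<open>The walk has countably many nodes, and those of cofinality at most \<open>|T m|\<close>
  contribute at most \<open>|T m|\<close> ladder points and candidates. Since \<open>b\<close> has
  larger cofinality, the ones below \<open>b\<close> are bounded by some \<eta> below
  \<open>b\<close>. Beyond \<eta>, walking towards \<open>x\<close> and towards \<open>b\<close>
  makes no difference.\<close>

lemma walk_near:
  assumes b: "b \<sqsubset> y" "\<not> cof_le b (T m)"
  shows "\<exists>\<eta>. \<eta> \<sqsubset> b \<and> (\<forall>x. \<eta> \<sqsubseteq> x \<longrightarrow> x \<sqsubset> b \<longrightarrow>
    (\<forall>i. node m x y i = node m b y i \<and> (cof_le (node m b y i) (T m) \<longrightarrow>
       (\<forall>z\<in>fill_union D m (node m b y i). x \<sqsubseteq> z \<longrightarrow> b \<sqsubseteq> z))))"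
proof -
  let ?I = "{i. cof_le (node m b y i) (T m)}"
  define B where "B = (\<Union>i\<in>?I. e (node m b y i) \<union> fill_union D m (node m b y i)) \<inter> below b"
  have "|\<Union>i\<in>?I. e (node m b y i) \<union> fill_union D m (node m b y i)| \<le>o |T m|"
    by (rule card_le_UN[OF T_inf card_le_countable[OF T_inf]])
       (auto intro!: card_le_Un T_inf fill_union_card ladderD(4)[OF e T_inf])
  then have "|B| \<le>o |T m|" unfolding B_def by (intro card_le_subset[OF Int_lower1])
  then obtain \<eta> where \<eta>: "\<eta> \<sqsubset> b" "\<forall>w\<in>B. w \<sqsubset> \<eta>"
    using not_cof_le_bound[OF b(2), of B] unfolding B_def by auto
  have far: "b \<sqsubseteq> w" if "cof_le (node m b y i) (T m)" "w \<in> e (node m b y i) \<union> fill_union D m (node m b y i)" "\<eta> \<sqsubseteq> x" "x \<sqsubseteq> w"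
    for i w x
  proof (rule ccontr)
    assume "\<not> b \<sqsubseteq> w"
    then have "w \<in> B" unfolding B_def using that(1,2) by auto
    then have "w \<sqsubset> \<eta>" using \<eta>(2) by blast
    then show False using that(3,4) by order
  qed
  have "node m x y i = node m b y i" if x: "\<eta> \<sqsubseteq> x" "x \<sqsubset> b" for x i
  proof (induction i)
    case (Suc i)
    let ?z = "node m b y i"
    have ge: "b \<sqsubseteq> ?z" by (rule node_ge[OF less_imp_le[OF b(1)]])
    have "step m x ?z = step m b ?z"
    proof (cases "cof_le ?z (T m)")
      case True
      then have "b \<sqsubset> ?z" using ge b(2) by (cases "b = ?z") auto
      moreover from this have "x \<sqsubset> ?z" using x(2) by order
      moreover have "{w \<in> e ?z. x \<sqsubseteq> w} = {w \<in> e ?z. b \<sqsubseteq> w}"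
        using far[OF True _ x(1)] x(2) by (auto intro: order_trans less_imp_le)
      ultimately show ?thesis unfolding step_def by simp
    qed (simp add: step_def)
    then show ?case using Suc.IH by (simp add: node_Suc)
  qed simp
  then show ?thesis using \<eta>(1) far by blast
qed

lemma color_near:
  assumes b: "b \<sqsubset> y" and x: "x \<sqsubset> b"
    and near: "\<And>i. node m x y i = node m b y i"
      "\<And>i z. cof_le (node m b y i) (T m) \<Longrightarrow> z \<in> fill_union D m (node m b y i) \<Longrightarrow> x \<sqsubseteq> z \<Longrightarrow> b \<sqsubseteq> z"
    and hit: "cof_le (node m b y j) (T m)" "\<delta> \<in> cof_omega" "\<delta> \<in> e (node m b y j)" "b \<in> fill D \<delta> m"
    and crossing: "crossing x y = m"
  shows "color D x y = b"
proof -
  have "b \<in> fill_union D m (node m b y j)" unfolding fill_union_def using hit by blast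
  then have "b \<in> candidates D m x y" unfolding candidates_def using near(1) hit(1) x less_imp_le by auto
  moreover have "b \<sqsubseteq> z" if "z \<in> candidates D m x y" for z
    using that near node_ge[OF less_imp_le[OF b]] unfolding candidates_def by auto
  ultimately have "least_of (candidates D m x y) = b"
    using least_of_in[of "candidates D m x y"] least_of_le[of b "candidates D m x y"] by (metis empty_iff order.antisym)
  then show ?thesis unfolding color_def crossing .
qed

text \<open>If \<delta> is not in \<open>e y\<close>, closure bounds the points of
  \<open>e y\<close> below \<delta> strictly below \<delta>. Once \<open>x\<close> passes a suitable
  term of the sequence, the step towards \<open>x\<close> is the step towards \<delta>. The nodes
  decrease, so finitely many such conditions, and those on the cofinalities of the nodes, combine
  into one \<open>N\<close>.\<close>

lemma walk_reaches:
  assumes \<delta>: "\<delta> \<in> cof_omega"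
  shows "y \<in> F \<Longrightarrow> \<delta> \<sqsubset> y \<Longrightarrow> \<exists>N. \<forall>m\<ge>N. \<forall>x. (\<forall>i\<le>N. omega_seq \<delta> i \<sqsubset> x) \<longrightarrow> x \<sqsubset> \<delta> \<longrightarrow>
    (\<exists>j. cof_le (node m x y j) (T m) \<and> \<delta> \<in> e (node m x y j))"
proof (induction y rule: less_induct)
  case (less y)
  obtain n where n: "cof_le y (T n)" using F_cofle[OF less.prems(1)] by blast
  have cy: "cof_le y (T m)" if "m \<ge> n" for m using cof_le_mono[OF n T_mono[OF that]] .
  show ?case
  proof (cases "\<delta> \<in> e y")
    case True
    then show ?thesis using cy node_0 by (intro exI[of _ n]) metis
  next
    case False
    then have "\<not> limit_of (e y) \<delta>" using ladderD(3)[OF e less.prems(2)] by blast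
    then obtain x1 where x1: "x1 \<sqsubset> \<delta>" "\<And>c. c \<in> e y \<Longrightarrow> x1 \<sqsubset> c \<Longrightarrow> \<not> c \<sqsubset> \<delta>"
      unfolding limit_of_def using SC_D(2)[OF \<delta>] by blast
    obtain N1 where N1: "x1 \<sqsubset> omega_seq \<delta> N1" using SC_D(3)[OF \<delta> x1(1)] by blast
    define y' where "y' = least_of {c \<in> e y. \<delta> \<sqsubseteq> c}"
    have "{c \<in> e y. \<delta> \<sqsubseteq> c} \<noteq> {}" using ladderD(2)[OF e less.prems(2)] by blast
    from least_of_in[OF this] have y': "y' \<in> e y" "\<delta> \<sqsubseteq> y'" unfolding y'_def by auto
    then have y'2: "y' \<sqsubset> y" "\<delta> \<sqsubset> y'" using ladderD(1)[OF e] False by (auto simp: le_less)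
    obtain N2 where N2: "\<And>m x. m \<ge> N2 \<Longrightarrow> (\<forall>i\<le>N2. omega_seq \<delta> i \<sqsubset> x) \<Longrightarrow> x \<sqsubset> \<delta> \<Longrightarrow>
      \<exists>j. cof_le (node m x y' j) (T m) \<and> \<delta> \<in> e (node m x y' j)"
      using less.IH[OF y'2(1) F_dn[OF less.prems(1) y'2(1)] y'2(2)] by blast
    have "\<exists>j. cof_le (node m x y j) (T m) \<and> \<delta> \<in> e (node m x y j)"
      if mx: "m \<ge> n + N1 + N2" "\<forall>i\<le>n + N1 + N2. omega_seq \<delta> i \<sqsubset> x" "x \<sqsubset> \<delta>" for m x
    proof -
      have "x1 \<sqsubset> x" using N1 mx(2) less_trans by auto
      have "{c \<in> e y. x \<sqsubseteq> c} = {c \<in> e y. \<delta> \<sqsubseteq> c}"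
      proof (intro Collect_cong conj_cong refl iffI)
        fix c assume c: "c \<in> e y"
        show "\<delta> \<sqsubseteq> c" if "x \<sqsubseteq> c"
        proof -
          have "x1 \<sqsubset> c" using \<open>x1 \<sqsubset> x\<close> that by order
          then have "\<not> c \<sqsubset> \<delta>" by (rule x1(2)[OF c])
          then show ?thesis by order
        qed
        show "x \<sqsubseteq> c" if "\<delta> \<sqsubseteq> c" using mx(3) that by order
      qed
      moreover have "x \<sqsubset> y" using mx(3) less.prems(2) by order
      ultimately have "step m x y = y'" unfolding step_def y'_def using cy mx(1) by auto
      then have "node m x y (Suc j) = node m x y' j" for j by (simp add: node_Suc')
      moreover obtain j where "cof_le (node m x y' j) (T m) \<and> \<delta> \<in> e (node m x y' j)"
        using N2[of m x] mx by auto
      ultimately show ?thesis by metis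
    qed
    then show ?thesis by blast
  qed
qed

section \<open>Disjoint families of finite sets against the scale\<close>

lemma family_above:
  assumes t: "\<And>\<alpha>. \<alpha> \<in> F \<Longrightarrow> t \<alpha> \<subseteq> F" "disjoint_family_on t F" and x: "x \<in> F"
  shows "\<exists>\<alpha>\<in>F. x \<sqsubset> \<alpha> \<and> (\<forall>z\<in>t \<alpha>. x \<sqsubset> z)"
proof -
  let ?A = "{\<alpha> \<in> F. \<exists>z\<in>t \<alpha>. z \<sqsubseteq> x}"
  have "\<forall>\<alpha>\<in>?A. \<exists>z. z \<in> t \<alpha> \<and> z \<sqsubseteq> x" by auto
  from bchoice[OF this] obtain z where "\<forall>\<alpha>\<in>?A. z \<alpha> \<in> t \<alpha> \<and> z \<alpha> \<sqsubseteq> x" ..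
  note z = bspec[OF this]
  \<comment> \<open>By disjointness, each of the at most \<open>|M|\<close> points up to
    \<open>x\<close> spoils only one index.\<close>
  have "inj_on z ?A"
  proof (rule inj_onI, rule ccontr)
    fix \<alpha> \<beta> assume ab: "\<alpha> \<in> ?A" "\<beta> \<in> ?A" "z \<alpha> = z \<beta>" "\<alpha> \<noteq> \<beta>"
    then have "t \<alpha> \<inter> t \<beta> = {}" using t(2) unfolding disjoint_family_on_def by blast
    then show False using z[OF ab(1)] z[OF ab(2)] ab(3) by auto
  qed
  then have "|?A| \<le>o |insert x (below x)|"
    by (rule card_of_ordLeqI) (use z in \<open>auto simp: le_less\<close>)
  moreover have "|insert x (below x)| \<le>o |M|"
    by (intro card_le_insert regD(1)[OF F_reg] regD(3)[OF F_reg x])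
  ultimately have "|?A| \<le>o |M|" by (rule ordLeq_transitive)
  then obtain b where b: "b \<in> F" "\<forall>\<alpha>\<in>?A. \<alpha> \<sqsubset> b" using regD(4)[OF F_reg, of ?A] by auto
  obtain \<alpha> where \<alpha>: "\<alpha> \<in> F" "x \<sqsubset> \<alpha>" "b \<sqsubset> \<alpha>" using reg_ub2[OF F_reg x b(1)] by blast
  then have "\<alpha> \<notin> ?A" using b(2) less_asym by blast
  then show ?thesis using \<alpha> by (intro bexI[of _ \<alpha>]) auto
qed

lemma bot_elt_H: "bot_elt \<sqsubset> H n"
proof -
  obtain \<alpha> where "\<alpha> \<in> F" using reg_ne[OF F_reg] by blast
  then show ?thesis using f_H bot_elt_le le_less_trans by blast
qed

text \<open>The point is that \<open>n0\<close> does not depend on \<eta> and \<xi>. Counterexamples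
  at infinitely many \<open>n\<close> are merged: their \<eta> have a common bound in
  \<open>F\<close>, their \<xi> form one function dominated by the scale, and a single
  \<open>t \<alpha>\<close> far enough up refutes almost all of them.\<close>

lemma family_large:
  assumes t: "\<And>\<alpha>. \<alpha> \<in> F \<Longrightarrow> finite (t \<alpha>) \<and> t \<alpha> \<subseteq> F" "disjoint_family_on t F"
  shows "\<exists>n0. \<forall>n\<ge>n0. \<forall>\<eta>\<in>F. \<forall>\<xi>. \<xi> \<sqsubset> H n \<longrightarrow> (\<exists>\<alpha>\<in>F. \<eta> \<sqsubset> \<alpha> \<and> (\<forall>z\<in>t \<alpha>. \<eta> \<sqsubset> z \<and> \<xi> \<sqsubset> f z n))"
proof (rule ccontr)
  define good where "good n \<eta> \<xi> \<longleftrightarrow> (\<exists>\<alpha>\<in>F. \<eta> \<sqsubset> \<alpha> \<and> (\<forall>z\<in>t \<alpha>. \<eta> \<sqsubset> z \<and> \<xi> \<sqsubset> f z n))" for n \<eta> \<xi>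
  assume "\<not> ?thesis"
  then have bad: "\<exists>n\<ge>n0. \<exists>\<eta>\<in>F. \<exists>\<xi>. \<xi> \<sqsubset> H n \<and> \<not> good n \<eta> \<xi>" for n0
    unfolding good_def[symmetric] by blast
  obtain y0 where y0: "y0 \<in> F" using reg_ne[OF F_reg] by blast
  have "\<exists>\<eta> \<xi>. \<eta> \<in> F \<and> \<xi> \<sqsubset> H n \<and> ((\<exists>\<eta>\<in>F. \<exists>\<xi>. \<xi> \<sqsubset> H n \<and> \<not> good n \<eta> \<xi>) \<longrightarrow> \<not> good n \<eta> \<xi>)" for n
    using y0 bot_elt_H[of n] by blast
  then obtain \<eta> \<xi> where \<eta>\<xi>: "\<And>n. \<eta> n \<in> F" "\<And>n. \<xi> n \<sqsubset> H n"
    "\<And>n. \<exists>\<eta>\<in>F. \<exists>\<xi>. \<xi> \<sqsubset> H n \<and> \<not> good n \<eta> \<xi> \<Longrightarrow> \<not> good n (\<eta> n) (\<xi> n)" by metis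
  obtain \<eta>' where \<eta>': "\<eta>' \<in> F" "\<And>n. \<eta> n \<sqsubset> \<eta>'"
    using reg_bound[OF F_reg card_le_countable[OF regD(1)[OF F_reg]], of UNIV \<eta>] \<eta>\<xi>(1) by auto
  obtain \<gamma> where \<gamma>: "\<gamma> \<in> F" "\<forall>\<^sub>F n in sequentially. \<xi> n \<sqsubset> f \<gamma> n" using f_cofinal[of \<xi>] \<eta>\<xi>(2) by blast
  obtain x where x: "x \<in> F" "\<eta>' \<sqsubset> x" "\<gamma> \<sqsubset> x" using reg_ub2[OF F_reg \<eta>'(1) \<gamma>(1)] by blast
  obtain \<alpha> where \<alpha>: "\<alpha> \<in> F" "x \<sqsubset> \<alpha>" "\<forall>z\<in>t \<alpha>. x \<sqsubset> z" using family_above[OF _ t(2) x(1)] t(1) by blast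
  have "\<forall>\<^sub>F n in sequentially. \<xi> n \<sqsubset> f z n" if z: "z \<in> t \<alpha>" for z
  proof -
    have "z \<in> F" "\<gamma> \<sqsubset> z" using t(1)[OF \<alpha>(1)] \<alpha>(3) z x(3) by (auto intro: less_trans)
    from \<gamma>(2) f_less[OF this] show ?thesis by eventually_elim order
  qed
  then have "\<forall>\<^sub>F n in sequentially. \<forall>z\<in>t \<alpha>. \<xi> n \<sqsubset> f z n"
    using t(1)[OF \<alpha>(1)] by (simp add: eventually_ball_finite)
  then obtain n0 where n0: "\<And>n. n \<ge> n0 \<Longrightarrow> \<forall>z\<in>t \<alpha>. \<xi> n \<sqsubset> f z n" unfolding eventually_sequentially by blast
  obtain n where n: "n \<ge> n0" "\<not> good n (\<eta> n) (\<xi> n)" using bad[of n0] \<eta>\<xi>(3) by blast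
  have "\<eta> n \<sqsubset> x" using \<eta>'(2)[of n] x(2) by order
  then have "good n (\<eta> n) (\<xi> n)" unfolding good_def using n0[OF n(1)] \<alpha> less_trans by blast
  then show False using n(2) by blast
qed

lemma cof_le_level:
  assumes "b \<in> F" "\<not> cof_le b (T m)"
  obtains k where "m \<le> k" "\<not> cof_le b (T k)" "cof_le b (T (Suc k))"
proof -
  have "\<exists>k\<ge>m. \<not> cof_le b (T k) \<and> cof_le b (T (Suc k))"
  proof (rule ccontr)
    assume n: "\<not> ?thesis"
    have no: "\<not> cof_le b (T k)" if "m \<le> k" for k
      using that by (induction k rule: dec_induct) (use assms(2) n in auto)
    obtain n where n: "cof_le b (T n)" using F_cofle[OF assms(1)] by blast
    then show False using no[of "m + n"] cof_le_mono[OF n T_mono[of n "m + n"]] by simp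
  qed
  then show thesis using that by blast
qed

lemma coloring_hits:
  assumes t: "\<And>\<alpha>. \<alpha> \<in> F \<Longrightarrow> finite (t \<alpha>) \<and> t \<alpha> \<subseteq> F" "disjoint_family_on t F"
  shows "{b \<in> F. \<not> (\<exists>\<beta>\<in>F. \<exists>\<alpha>. \<alpha> \<sqsubset> \<beta> \<and> (\<forall>x\<in>t \<alpha>. \<forall>y\<in>t \<beta>. x \<sqsubset> y \<and> color D x y = b))} \<in> guess_ideal D"
proof -
  define hit where "hit b \<longleftrightarrow> (\<exists>\<beta>\<in>F. \<exists>\<alpha>. \<alpha> \<sqsubset> \<beta> \<and> (\<forall>x\<in>t \<alpha>. \<forall>y\<in>t \<beta>. x \<sqsubset> y \<and> color D x y = b))" for b
  obtain n0 where n0: "\<And>n \<eta> \<xi>. n \<ge> n0 \<Longrightarrow> \<eta> \<in> F \<Longrightarrow> \<xi> \<sqsubset> H n \<Longrightarrow>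
      \<exists>\<alpha>. \<alpha> \<in> F \<and> \<eta> \<sqsubset> \<alpha> \<and> (\<forall>z\<in>t \<alpha>. \<eta> \<sqsubset> z \<and> \<xi> \<sqsubset> f z n)" using family_large[OF t] by blast
  obtain y0 where y0: "y0 \<in> F" using reg_ne[OF F_reg] by blast
  \<comment> \<open>The choice is fixed once and for all, so that only one \<alpha> per triple has
    to be dominated later. The default \<open>y0\<close> keeps \<open>a\<close> inside
    \<open>F\<close> for all arguments, which spares case distinctions in the size
    estimates.\<close>
  define a where "a \<eta> n \<xi> = (if n \<ge> n0 \<and> \<eta> \<in> F \<and> \<xi> \<sqsubset> H n
    then SOME \<alpha>. \<alpha> \<in> F \<and> \<eta> \<sqsubset> \<alpha> \<and> (\<forall>z\<in>t \<alpha>. \<eta> \<sqsubset> z \<and> \<xi> \<sqsubset> f z n) else y0)" for \<eta> n \<xi>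
  have a: "a \<eta> n \<xi> \<in> F \<and> \<eta> \<sqsubset> a \<eta> n \<xi> \<and> (\<forall>z\<in>t (a \<eta> n \<xi>). \<eta> \<sqsubset> z \<and> \<xi> \<sqsubset> f z n)"
    if "n \<ge> n0" "\<eta> \<in> F" "\<xi> \<sqsubset> H n" for \<eta> n \<xi>
  proof -
    have eq: "a \<eta> n \<xi> = (SOME \<alpha>. \<alpha> \<in> F \<and> \<eta> \<sqsubset> \<alpha> \<and> (\<forall>z\<in>t \<alpha>. \<eta> \<sqsubset> z \<and> \<xi> \<sqsubset> f z n))"
      unfolding a_def using that by simp
    show ?thesis unfolding eq by (rule someI_ex[OF n0[OF that]])
  qed
  have aF: "a \<eta> n \<xi> \<in> F" for \<eta> n \<xi>
  proof (cases "n \<ge> n0 \<and> \<eta> \<in> F \<and> \<xi> \<sqsubset> H n")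
    case True
    then show ?thesis using a[of n \<eta> \<xi>] by simp
  next
    case False
    then have "a \<eta> n \<xi> = y0" unfolding a_def by (rule if_not_P)
    then show ?thesis using y0 by simp
  qed
  \<comment> \<open>Everything ever chosen for \<eta>, at all coordinates. A closure point
    \<open>b\<close> of \<open>g\<close> above \<eta> has all of it below \<open>b\<close>.\<close>
  define Y where "Y \<eta> = (\<Union>n. \<Union>\<xi>\<in>T (Suc n). insert (a \<eta> n \<xi>) (t (a \<eta> n \<xi>)))" for \<eta>
  have Minf: "infinite M" using regD(1)[OF F_reg] .
  have "\<exists>b\<in>F. \<forall>y\<in>Y \<eta>. y \<sqsubset> b" for \<eta>
  proof (rule regD(4)[OF F_reg])
    show "Y \<eta> \<subseteq> F" unfolding Y_def using aF t(1) by blast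
    show "|Y \<eta>| \<le>o |M|" unfolding Y_def
      by (intro card_le_UN Minf card_le_countable T_M(1) card_le_finite) (use t(1)[OF aF] in simp)
  qed
  then obtain g where g: "\<And>\<eta>. g \<eta> \<in> F" "\<And>\<eta> y. y \<in> Y \<eta> \<Longrightarrow> y \<sqsubset> g \<eta>" by metis
  define E where "E = {p \<in> F. \<forall>x. x \<sqsubset> p \<longrightarrow> g x \<sqsubset> p}"
  have E: "club_on F E" unfolding E_def by (rule club_closure[OF F_reg g(1)])
  have main: "\<exists>N. \<forall>m\<ge>N. \<forall>b\<in>E \<inter> fill D \<delta> m. (\<forall>i\<le>N. omega_seq \<delta> i \<sqsubset> b) \<longrightarrow> \<not> cof_le b (T m) \<longrightarrow> hit b"
    if \<delta>: "\<delta> \<in> cof_omega" for \<delta>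
  proof -
    have \<delta>F: "\<delta> \<in> F" using SC_D(1)[OF \<delta>] .
    \<comment> \<open>All values at coordinate \<open>n\<close> of points that may be chosen at a
      level \<open>k < n\<close>, collected before \<open>b\<close>, \<eta> and \<xi> are known.
      From \<open>Suc k \<le> n\<close> the size is at most \<open>|T n|\<close>, so
      \<open>V n\<close> is bounded below \<open>H n\<close>.\<close>
    define V where "V n = (\<Union>k\<in>{k. n0 \<le> k \<and> k < n}. \<Union>b\<in>{b \<in> fill D \<delta> k. cof_le b (T (Suc k))}.
      \<Union>\<eta>\<in>e b. \<Union>\<xi>\<in>T (Suc k). (\<lambda>x. f x n) ` t (a \<eta> k \<xi>))" for n
    have "\<exists>w. w \<sqsubset> H n \<and> (\<forall>v\<in>V n. v \<sqsubset> w)" for n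
    proof (rule not_cof_le_bound[OF H_cofle])
      show "V n \<subseteq> below (H n)"
      proof
        fix v assume "v \<in> V n"
        then obtain k \<eta> \<xi> x where x: "x \<in> t (a \<eta> k \<xi>)" "v = f x n" unfolding V_def by blast
        then have "x \<in> F" using t(1)[OF aF] by blast
        then show "v \<in> below (H n)" using x(2) f_H by simp
      qed
      have kT: "|A| \<le>o |T n|" if "|A| \<le>o |T (Suc k)|" "k < n" for k and A :: "'b set"
        using ordLeq_transitive[OF that(1) T_mono[of "Suc k" n]] that(2) by simp
      have kT': "|A| \<le>o |T n|" if "|A| \<le>o |T k|" "k < n" for k and A :: "'b set"
        using ordLeq_transitive[OF that(1) T_mono[of k n]] that(2) by simp
      show "|V n| \<le>o |T n|" unfolding V_def
      proof (intro card_le_UN T_inf card_le_countable)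
        fix k b assume k: "k \<in> {k. n0 \<le> k \<and> k < n}"
        show "|{b \<in> fill D \<delta> k. cof_le b (T (Suc k))}| \<le>o |T n|"
          by (rule kT'[OF card_le_subset[OF _ fill_card]]) (use k in auto)
        assume b: "b \<in> {b \<in> fill D \<delta> k. cof_le b (T (Suc k))}"
        show "|e b| \<le>o |T n|"
          by (rule kT[OF ladderD(4)[OF e T_inf]]) (use k b in auto)
      next
        fix k assume k: "k \<in> {k. n0 \<le> k \<and> k < n}"
        show "|T (Suc k)| \<le>o |T n|" by (rule T_mono) (use k in auto)
      next
        fix k \<eta> \<xi>
        show "|(\<lambda>x. f x n) ` t (a \<eta> k \<xi>)| \<le>o |T n|"
          by (rule card_le_finite[OF T_inf]) (use t(1)[OF aF] in simp)
      qed
    qed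
    then obtain w where w: "\<And>n. w n \<sqsubset> H n" "\<And>n v. v \<in> V n \<Longrightarrow> v \<sqsubset> w n" by metis
    obtain \<gamma> where \<gamma>: "\<gamma> \<in> F" "\<forall>\<^sub>F n in sequentially. w n \<sqsubset> f \<gamma> n" using f_cofinal[of w] w(1) by blast
    obtain z where z: "z \<in> F" "\<delta> \<sqsubset> z" "\<gamma> \<sqsubset> z" using reg_ub2[OF F_reg \<delta>F \<gamma>(1)] by blast
    obtain \<beta> where \<beta>: "\<beta> \<in> F" "z \<sqsubset> \<beta>" "\<forall>y\<in>t \<beta>. z \<sqsubset> y" using family_above[OF _ t(2) z(1)] t(1) by blast
    have fin: "finite (t \<beta>)" using t(1)[OF \<beta>(1)] by blast
    have y: "y \<in> F" "\<delta> \<sqsubset> y" "\<gamma> \<sqsubset> y" if "y \<in> t \<beta>" for y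
      using t(1)[OF \<beta>(1)] \<beta>(3) z that by (auto intro: less_trans)
    have "\<forall>\<^sub>F n in sequentially. w n \<sqsubset> f y n" if "y \<in> t \<beta>" for y
      using \<gamma>(2) f_less[OF y(1,3)[OF that]] by eventually_elim order
    then have "\<forall>\<^sub>F n in sequentially. \<forall>y\<in>t \<beta>. w n \<sqsubset> f y n" by (simp add: eventually_ball_finite fin)
    then obtain m1 where m1: "\<And>n y. n \<ge> m1 \<Longrightarrow> y \<in> t \<beta> \<Longrightarrow> w n \<sqsubset> f y n"
      unfolding eventually_sequentially by blast
    have "\<forall>y\<in>t \<beta>. \<exists>N. \<forall>m\<ge>N. \<forall>x. (\<forall>i\<le>N. omega_seq \<delta> i \<sqsubset> x) \<longrightarrow> x \<sqsubset> \<delta> \<longrightarrow>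
        (\<exists>j. cof_le (node m x y j) (T m) \<and> \<delta> \<in> e (node m x y j))"
      using walk_reaches[OF \<delta>] y(1,2) by blast
    then obtain R where R: "\<And>y m x. y \<in> t \<beta> \<Longrightarrow> m \<ge> R y \<Longrightarrow> \<forall>i\<le>R y. omega_seq \<delta> i \<sqsubset> x \<Longrightarrow> x \<sqsubset> \<delta> \<Longrightarrow>
        \<exists>j. cof_le (node m x y j) (T m) \<and> \<delta> \<in> e (node m x y j)" by metis
    \<comment> \<open>Large enough for the choices \<open>a\<close>, for the domination of
      \<open>w\<close> on \<open>t \<beta>\<close>, and for the walks from every \<open>y\<close> in
      \<open>t \<beta>\<close> to reach \<delta>.\<close>
    define N where "N = n0 + m1 + (\<Sum>y\<in>t \<beta>. R y)"
    have RN: "R y \<le> N" if "y \<in> t \<beta>" for y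
    proof -
      have "R y \<le> (\<Sum>y\<in>t \<beta>. R y)" using that fin by (intro member_le_sum) auto
      then show ?thesis unfolding N_def by simp
    qed
    have "hit b" if m: "m \<ge> N" and b: "b \<in> E" "b \<in> fill D \<delta> m" "\<forall>i\<le>N. omega_seq \<delta> i \<sqsubset> b" "\<not> cof_le b (T m)" for m b
    proof -
      have bF: "b \<in> F" using b(1) unfolding E_def by blast
      have b\<delta>: "b \<sqsubset> \<delta>" using subsetD[OF fill_below[OF \<delta>] b(2)] by simp
      \<comment> \<open>The color arises at level \<open>k\<close>, possibly above \<open>m\<close>:
        there the cofinality of \<open>b\<close> is above \<open>|T k|\<close>, as the walk needs,
        and at most \<open>|T (Suc k)|\<close>, as the definition of \<open>V\<close> needs.\<close>
      obtain k where k: "m \<le> k" "\<not> cof_le b (T k)" "cof_le b (T (Suc k))" using cof_le_level[OF bF b(4)] by blast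
      have bk: "b \<in> fill D \<delta> k" using fill_mono[OF k(1)] b(2) by blast
      have kN: "k \<ge> N" using k(1) m by simp
      have by': "b \<sqsubset> y" if "y \<in> t \<beta>" for y using b\<delta> y(2)[OF that] by order
      have "\<forall>y\<in>t \<beta>. \<exists>\<eta>. \<eta> \<sqsubset> b \<and> (\<forall>x. \<eta> \<sqsubseteq> x \<longrightarrow> x \<sqsubset> b \<longrightarrow>
        (\<forall>i. node k x y i = node k b y i \<and> (cof_le (node k b y i) (T k) \<longrightarrow>
         (\<forall>z\<in>fill_union D k (node k b y i). x \<sqsubseteq> z \<longrightarrow> b \<sqsubseteq> z))))"
        using walk_near[OF by' k(2)] by blast
      then obtain h where h: "\<And>y. y \<in> t \<beta> \<Longrightarrow> h y \<sqsubset> b" "\<And>y x i. y \<in> t \<beta> \<Longrightarrow> h y \<sqsubseteq> x \<Longrightarrow> x \<sqsubset> b \<Longrightarrow>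
        node k x y i = node k b y i \<and> (cof_le (node k b y i) (T k) \<longrightarrow>
         (\<forall>z\<in>fill_union D k (node k b y i). x \<sqsubseteq> z \<longrightarrow> b \<sqsubseteq> z))" by metis
      have "h ` t \<beta> \<subseteq> below b" using h(1) by auto
      from not_cof_le_bound[OF k(2) card_le_finite[OF T_inf finite_imageI[OF fin]] this]
      obtain \<eta>' where \<eta>': "\<eta>' \<sqsubset> b" "\<forall>x\<in>h ` t \<beta>. x \<sqsubset> \<eta>'" by blast
      obtain \<eta> where \<eta>: "\<eta> \<in> e b" "\<eta>' \<sqsubseteq> \<eta>" using ladderD(2)[OF e \<eta>'(1)] by blast
      have \<eta>b: "\<eta> \<sqsubset> b" using ladderD(1)[OF e \<eta>(1)] .
      have "(\<lambda>y. f y k) ` t \<beta> \<subseteq> below (H k)" using f_H[OF y(1)] by auto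
      from not_cof_le_bound[OF H_cofle card_le_finite[OF T_inf finite_imageI[OF fin]] this]
      obtain w0 where w0: "w0 \<sqsubset> H k" "\<forall>x\<in>(\<lambda>y. f y k) ` t \<beta>. x \<sqsubset> w0" by blast
      \<comment> \<open>Being above all \<open>f y k\<close> for \<open>y\<close> in
        \<open>t \<beta>\<close>, \<xi> places the crossing at \<open>k\<close> or later; being in
        \<open>T (Suc k)\<close>, it is accounted for in \<open>V n\<close> for
        \<open>n > k\<close>, which rules out later.\<close>
      obtain \<xi> where \<xi>: "\<xi> \<in> T (Suc k)" "w0 \<sqsubseteq> \<xi>" "\<xi> \<sqsubset> H k" using T_H[OF w0(1)] by blast
      let ?\<alpha> = "a \<eta> k \<xi>"
      have kn0: "n0 \<le> k" using kN unfolding N_def by simp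
      have \<alpha>: "?\<alpha> \<in> F" "\<And>z. z \<in> t ?\<alpha> \<Longrightarrow> \<eta> \<sqsubset> z" "\<And>z. z \<in> t ?\<alpha> \<Longrightarrow> \<xi> \<sqsubset> f z k"
        using a[OF kn0 F_dn[OF bF \<eta>b] \<xi>(3)] by auto
      have gb: "g \<eta> \<sqsubset> b" using b(1) \<eta>b unfolding E_def by blast
      have "insert ?\<alpha> (t ?\<alpha>) \<subseteq> Y \<eta>" unfolding Y_def using \<xi>(1) by blast
      then have below: "x \<sqsubset> b" if "x \<in> insert ?\<alpha> (t ?\<alpha>)" for x
        using g(2)[of x \<eta>] that gb less_trans by blast
      have "x \<sqsubset> y' \<and> color D x y' = b" if xy: "x \<in> t ?\<alpha>" "y' \<in> t \<beta>" for x y'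
      proof -
        have xb: "x \<sqsubset> b" using below xy(1) by blast
        have "h y' \<sqsubset> \<eta>'" using \<eta>'(2) xy(2) by blast
        then have hx: "h y' \<sqsubseteq> x" using \<eta>(2) \<alpha>(2)[OF xy(1)] by order
        have "crossing x y' = k"
        proof (rule crossing_eq)
          have "f y' k \<sqsubset> w0" using w0(2) xy(2) by blast
          then show "\<not> f x k \<sqsubset> f y' k" using \<alpha>(3)[OF xy(1)] \<xi>(2) by order
        next
          fix n assume n: "n > k"
          have "f x n \<in> V n" unfolding V_def using n kn0 bk k(3) \<eta>(1) \<xi>(1) xy(1) by blast
          then have "f x n \<sqsubset> w n" using w(2) by blast
          moreover have "w n \<sqsubset> f y' n" using m1[OF _ xy(2), of n] n kN unfolding N_def by simp
          ultimately show "f x n \<sqsubset> f y' n" by order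
        qed
        moreover obtain j where "cof_le (node k b y' j) (T k)" "\<delta> \<in> e (node k b y' j)"
          using R[OF xy(2), of k b] RN[OF xy(2)] kN b(3) b\<delta> by auto
        ultimately have "color D x y' = b"
          using h(2)[OF xy(2) hx xb] by (intro color_near[OF by'[OF xy(2)] xb _ _ _ \<delta> _ bk]) auto
        then show ?thesis using xb by'[OF xy(2)] less_trans by blast
      qed
      moreover have "?\<alpha> \<sqsubset> \<beta>"
        using below[of ?\<alpha>] b\<delta> z(2) \<beta>(2) by (meson insertI1 less_trans)
      ultimately show "hit b" unfolding hit_def using \<beta>(1) by blast
    qed
    then show ?thesis by blast
  qed
  have "guess_null D {b \<in> F. \<not> hit b} E"
    unfolding guess_null_def
  proof
    fix \<delta> assume "\<delta> \<in> cof_omega \<inter> E"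
    then have "\<delta> \<in> cof_omega" by simp
    from main[OF this] obtain N where
      N: "\<forall>m\<ge>N. \<forall>b\<in>E \<inter> fill D \<delta> m. (\<forall>i\<le>N. omega_seq \<delta> i \<sqsubset> b) \<longrightarrow> \<not> cof_le b (T m) \<longrightarrow> hit b" ..
    have "cof_le b (T m)" if "m \<ge> N" "b \<in> {b \<in> F. \<not> hit b} \<inter> E \<inter> fill D \<delta> m" "\<forall>i\<le>N. omega_seq \<delta> i \<sqsubset> b" for m b
      using N[rule_format, OF that(1), of b] that(2,3) by blast
    then show "\<exists>N. \<forall>m\<ge>N. \<forall>b\<in>{b \<in> F. \<not> hit b} \<inter> E \<inter> fill D \<delta> m.
      (\<forall>i\<le>N. omega_seq \<delta> i \<sqsubset> b) \<longrightarrow> cof_le b (T m)" by blast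
  qed
  then have "{b \<in> F. \<not> hit b} \<in> guess_ideal D" unfolding guess_ideal_def using E by blast
  then show ?thesis unfolding hit_def .
qed

end

section \<open>The main theorem\<close>

text \<open>Otherwise every \<open>n\<close> has an index from which on it is never taken, and these
  countably many indices are cofinal in the regular uncountable \<sigma>.\<close>

lemma regularCard_pigeonhole:
  fixes N :: "'c \<Rightarrow> 'i::countable"
  assumes \<sigma>: "Card_order \<sigma>" "regularCard \<sigma>" "natLeq <o \<sigma>"
  shows "\<exists>n. \<forall>i\<in>Field \<sigma>. \<exists>j\<in>Field \<sigma>. (i, j) \<in> \<sigma> \<and> N j = n"
proof (rule ccontr)
  assume "\<not> ?thesis"
  then have "\<forall>n. \<exists>i\<in>Field \<sigma>. \<forall>j\<in>Field \<sigma>. (i, j) \<in> \<sigma> \<longrightarrow> N j \<noteq> n" by blast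
  then obtain i where i: "\<And>n. i n \<in> Field \<sigma>" "\<And>n j. j \<in> Field \<sigma> \<Longrightarrow> (i n, j) \<in> \<sigma> \<Longrightarrow> N j \<noteq> n" by metis
  have "|range i| \<le>o |UNIV :: nat set|"
    by (intro card_le_image card_le_countable) simp
  then have "|range i| \<le>o natLeq" using card_of_nat ordLeq_ordIso_trans by blast
  then have "\<not> |range i| =o \<sigma>"
    using \<sigma>(3) ordIso_symmetric ordIso_ordLeq_trans not_ordLess_ordLeq by blast
  then have "\<not> cofinal (range i) \<sigma>"
    using \<sigma>(2) i(1) unfolding regularCard_def by blast
  then obtain a where a: "a \<in> Field \<sigma>" "\<And>n. a = i n \<or> (a, i n) \<notin> \<sigma>" unfolding cofinal_def by blast
  have "wo_rel \<sigma>" using \<sigma>(1) card_order_on_well_order_on wo_rel_def by blast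
  then have "(i (N a), a) \<in> \<sigma>"
    using wo_rel.TOTALS[of \<sigma>] a i(1) by metis
  then show False using i(2) a(1) by blast
qed

section \<open>Properties of the guessing ideal\<close>

context scale
begin

lemma guess_nullI:
  assumes "\<And>\<delta>. \<delta> \<in> cof_omega \<Longrightarrow> \<delta> \<in> E \<Longrightarrow> \<exists>N. \<forall>m \<beta>. N \<le> m \<longrightarrow> \<beta> \<in> A \<longrightarrow> \<beta> \<in> E \<longrightarrow> \<beta> \<in> fill D \<delta> m \<longrightarrow>
    (\<forall>i\<le>N. omega_seq \<delta> i \<sqsubset> \<beta>) \<longrightarrow> cof_le \<beta> (T m)"
  shows "guess_null D A E"
  unfolding guess_null_def
proof
  fix \<delta> assume "\<delta> \<in> cof_omega \<inter> E"
  then obtain N where "\<forall>m \<beta>. N \<le> m \<longrightarrow> \<beta> \<in> A \<longrightarrow> \<beta> \<in> E \<longrightarrow> \<beta> \<in> fill D \<delta> m \<longrightarrow>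
    (\<forall>i\<le>N. omega_seq \<delta> i \<sqsubset> \<beta>) \<longrightarrow> cof_le \<beta> (T m)" using assms[of \<delta>] by auto
  then show "\<exists>N. \<forall>m\<ge>N. \<forall>\<beta>\<in>A \<inter> E \<inter> fill D \<delta> m. (\<forall>i\<le>N. omega_seq \<delta> i \<sqsubset> \<beta>) \<longrightarrow> cof_le \<beta> (T m)"
    by (intro exI[of _ N]) simp
qed

lemma guess_nullD:
  assumes "guess_null D A E" "\<delta> \<in> cof_omega" "\<delta> \<in> E"
  shows "\<exists>N. \<forall>m \<beta>. N \<le> m \<longrightarrow> \<beta> \<in> A \<longrightarrow> \<beta> \<in> E \<longrightarrow> \<beta> \<in> fill D \<delta> m \<longrightarrow>
    (\<forall>i\<le>N. omega_seq \<delta> i \<sqsubset> \<beta>) \<longrightarrow> cof_le \<beta> (T m)"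
proof -
  have "\<delta> \<in> cof_omega \<inter> E" using assms(2,3) by simp
  from bspec[OF assms(1)[unfolded guess_null_def] this] obtain N where
    "\<forall>m\<ge>N. \<forall>\<beta>\<in>A \<inter> E \<inter> fill D \<delta> m. (\<forall>i\<le>N. omega_seq \<delta> i \<sqsubset> \<beta>) \<longrightarrow> cof_le \<beta> (T m)" ..
  then show ?thesis by (intro exI[of _ N]) simp
qed

lemma guess_ideal_subset:
  assumes "A \<in> guess_ideal D" "B \<subseteq> A"
  shows "B \<in> guess_ideal D"
proof -
  obtain E where E: "club_on F E" "guess_null D A E" and A: "A \<subseteq> F"
    using assms(1) unfolding guess_ideal_def by blast
  have "guess_null D B E"
  proof (rule guess_nullI)
    fix \<delta> assume "\<delta> \<in> cof_omega" "\<delta> \<in> E"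
    from guess_nullD[OF E(2) this] obtain N where N: "\<forall>m \<beta>. N \<le> m \<longrightarrow> \<beta> \<in> A \<longrightarrow>
      \<beta> \<in> E \<longrightarrow> \<beta> \<in> fill D \<delta> m \<longrightarrow> (\<forall>i\<le>N. omega_seq \<delta> i \<sqsubset> \<beta>) \<longrightarrow> cof_le \<beta> (T m)" ..
    then show "\<exists>N. \<forall>m \<beta>. N \<le> m \<longrightarrow> \<beta> \<in> B \<longrightarrow> \<beta> \<in> E \<longrightarrow> \<beta> \<in> fill D \<delta> m \<longrightarrow>
      (\<forall>i\<le>N. omega_seq \<delta> i \<sqsubset> \<beta>) \<longrightarrow> cof_le \<beta> (T m)"
      using assms(2) by (intro exI[of _ N]) auto
  qed
  then show ?thesis unfolding guess_ideal_def using E(1) A assms(2) by blast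
qed

lemma guess_ideal_disjoint_club:
  assumes "A \<subseteq> F" "club_on F C" "A \<inter> C = {}"
  shows "A \<in> guess_ideal D"
proof -
  have "guess_null D A C" unfolding guess_null_def using assms(3) by blast
  then show ?thesis unfolding guess_ideal_def using assms by blast
qed

lemma guess_ideal_bounded:
  assumes "\<beta> \<in> F" "A \<subseteq> below \<beta>"
  shows "A \<in> guess_ideal D"
proof (rule guess_ideal_disjoint_club[OF _ club_above[OF F_reg assms(1)]])
  show "A \<subseteq> F" using assms F_dn by auto
  show "A \<inter> {p \<in> F. \<beta> \<sqsubset> p} = {}" using assms(2) less_asym by fastforce
qed

lemma guess_ideal_Un:
  assumes "A \<in> guess_ideal D" "B \<in> guess_ideal D"
  shows "A \<union> B \<in> guess_ideal D"
proof -
  obtain E1 E2 where E: "club_on F E1" "guess_null D A E1" "club_on F E2" "guess_null D B E2"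
    using assms unfolding guess_ideal_def by blast
  have "guess_null D (A \<union> B) (E1 \<inter> E2)"
  proof (rule guess_nullI)
    fix \<delta> assume \<delta>: "\<delta> \<in> cof_omega" "\<delta> \<in> E1 \<inter> E2"
    from guess_nullD[OF E(2) \<delta>(1) IntD1[OF \<delta>(2)]] obtain N1 where N1: "\<forall>m \<beta>. N1 \<le> m \<longrightarrow> \<beta> \<in> A \<longrightarrow>
      \<beta> \<in> E1 \<longrightarrow> \<beta> \<in> fill D \<delta> m \<longrightarrow> (\<forall>i\<le>N1. omega_seq \<delta> i \<sqsubset> \<beta>) \<longrightarrow> cof_le \<beta> (T m)" ..
    from guess_nullD[OF E(4) \<delta>(1) IntD2[OF \<delta>(2)]] obtain N2 where N2: "\<forall>m \<beta>. N2 \<le> m \<longrightarrow> \<beta> \<in> B \<longrightarrow>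
      \<beta> \<in> E2 \<longrightarrow> \<beta> \<in> fill D \<delta> m \<longrightarrow> (\<forall>i\<le>N2. omega_seq \<delta> i \<sqsubset> \<beta>) \<longrightarrow> cof_le \<beta> (T m)" ..
    have "cof_le \<beta> (T m)" if "N1 + N2 \<le> m" "\<beta> \<in> A \<union> B" "\<beta> \<in> E1 \<inter> E2" "\<beta> \<in> fill D \<delta> m"
      "\<forall>i\<le>N1 + N2. omega_seq \<delta> i \<sqsubset> \<beta>" for m \<beta>
      using N1[rule_format, of m \<beta>] N2[rule_format, of m \<beta>] that by (cases "\<beta> \<in> A") simp_all
    then show "\<exists>N. \<forall>m \<beta>. N \<le> m \<longrightarrow> \<beta> \<in> A \<union> B \<longrightarrow> \<beta> \<in> E1 \<inter> E2 \<longrightarrow> \<beta> \<in> fill D \<delta> m \<longrightarrow>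
      (\<forall>i\<le>N. omega_seq \<delta> i \<sqsubset> \<beta>) \<longrightarrow> cof_le \<beta> (T m)" by (intro exI[of _ "N1 + N2"]) simp
  qed
  then show ?thesis
    using assms club_Int[OF F_reg E(1,3)] unfolding guess_ideal_def by blast
qed

lemma guess_ideal_indecomposable:
  fixes \<sigma> :: "'c rel"
  assumes \<sigma>: "Card_order \<sigma>" "regularCard \<sigma>" "natLeq <o \<sigma>" "|Field \<sigma>| \<le>o |M|"
  shows "indecomposable \<sigma> (guess_ideal D)"
  unfolding indecomposable_def
proof (intro allI impI)
  fix A assume "relChain \<sigma> A \<and> (\<forall>i\<in>Field \<sigma>. A i \<in> guess_ideal D)"
  then have chain: "\<And>i j. (i, j) \<in> \<sigma> \<Longrightarrow> A i \<subseteq> A j" and AI: "\<And>i. i \<in> Field \<sigma> \<Longrightarrow> A i \<in> guess_ideal D"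
    unfolding relChain_def by blast+
  have "\<forall>i. \<exists>E. i \<in> Field \<sigma> \<longrightarrow> club_on F E \<and> guess_null D (A i) E"
    using AI unfolding guess_ideal_def by blast
  then obtain E where E: "\<And>i. i \<in> Field \<sigma> \<Longrightarrow> club_on F (E i)" "\<And>i. i \<in> Field \<sigma> \<Longrightarrow> guess_null D (A i) (E i)"
    by metis
  let ?E = "F \<inter> (\<Inter>i\<in>Field \<sigma>. E i)"
  have club: "club_on F ?E" by (rule club_INT[OF F_reg \<sigma>(4) E(1)])
  have "guess_null D (\<Union>i\<in>Field \<sigma>. A i) ?E"
  proof (rule guess_nullI)
    fix \<delta> assume \<delta>: "\<delta> \<in> cof_omega" "\<delta> \<in> ?E"
    have "\<exists>N. i \<in> Field \<sigma> \<longrightarrow> (\<forall>m \<beta>. N \<le> m \<longrightarrow> \<beta> \<in> A i \<longrightarrow> \<beta> \<in> E i \<longrightarrow> \<beta> \<in> fill D \<delta> m \<longrightarrow>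
      (\<forall>k\<le>N. omega_seq \<delta> k \<sqsubset> \<beta>) \<longrightarrow> cof_le \<beta> (T m))" for i
    proof (cases "i \<in> Field \<sigma>")
      case True
      then have "\<delta> \<in> E i" using \<delta>(2) by blast
      from guess_nullD[OF E(2)[OF True] \<delta>(1) this] obtain N where "\<forall>m \<beta>. N \<le> m \<longrightarrow> \<beta> \<in> A i \<longrightarrow>
      \<beta> \<in> E i \<longrightarrow> \<beta> \<in> fill D \<delta> m \<longrightarrow> (\<forall>k\<le>N. omega_seq \<delta> k \<sqsubset> \<beta>) \<longrightarrow> cof_le \<beta> (T m)" ..
      then show ?thesis by (intro exI[of _ N]) simp
    qed simp
    from choice[OF allI[OF this]] obtain N where N: "\<forall>i. i \<in> Field \<sigma> \<longrightarrow> (\<forall>m \<beta>. N i \<le> m \<longrightarrow> \<beta> \<in> A i \<longrightarrow>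
      \<beta> \<in> E i \<longrightarrow> \<beta> \<in> fill D \<delta> m \<longrightarrow> (\<forall>k\<le>N i. omega_seq \<delta> k \<sqsubset> \<beta>) \<longrightarrow> cof_le \<beta> (T m))" ..
    \<comment> \<open>As \<open>A\<close> increases, a value that \<open>N\<close> takes cofinally
      often serves for the whole union.\<close>
    obtain n where n: "\<forall>i\<in>Field \<sigma>. \<exists>j\<in>Field \<sigma>. (i, j) \<in> \<sigma> \<and> N j = n"
      using regularCard_pigeonhole[OF \<sigma>(1-3), of N] by blast
    have "cof_le \<beta> (T m)" if \<beta>: "n \<le> m" "\<beta> \<in> (\<Union>i\<in>Field \<sigma>. A i)" "\<beta> \<in> ?E" "\<beta> \<in> fill D \<delta> m"
      "\<forall>k\<le>n. omega_seq \<delta> k \<sqsubset> \<beta>" for m \<beta>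
    proof -
      obtain i where i: "i \<in> Field \<sigma>" "\<beta> \<in> A i" using \<beta>(2) by blast
      obtain j where j: "j \<in> Field \<sigma>" "(i, j) \<in> \<sigma>" "N j = n" using n i(1) by blast
      have "\<beta> \<in> A j" "\<beta> \<in> E j" using chain[OF j(2)] i(2) \<beta>(3) j(1) by auto
      then show ?thesis using N[rule_format, OF j(1), of m \<beta>] \<beta>(1,4,5) j(3) by simp
    qed
    then show "\<exists>N. \<forall>m \<beta>. N \<le> m \<longrightarrow> \<beta> \<in> (\<Union>i\<in>Field \<sigma>. A i) \<longrightarrow> \<beta> \<in> ?E \<longrightarrow> \<beta> \<in> fill D \<delta> m \<longrightarrow>
      (\<forall>i\<le>N. omega_seq \<delta> i \<sqsubset> \<beta>) \<longrightarrow> cof_le \<beta> (T m)" by (intro exI[of _ n]) simp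
  qed
  moreover have "(\<Union>i\<in>Field \<sigma>. A i) \<subseteq> F" using AI unfolding guess_ideal_def by blast
  ultimately show "(\<Union>i\<in>Field \<sigma>. A i) \<in> guess_ideal D" unfolding guess_ideal_def using club by blast
qed

lemma guess_ideal_proper: "\<exists>D. F \<notin> guess_ideal D"
proof -
  from fill_guessing obtain D where D: "\<forall>E. club_on F E \<longrightarrow> (\<exists>\<delta>\<in>cof_omega \<inter> E. \<forall>N. \<exists>\<beta>\<in>E \<inter> fill D \<delta> N.
     (\<forall>i\<le>N. omega_seq \<delta> i \<sqsubset> \<beta>) \<and> \<not> cof_le \<beta> (T N))" by (elim exE conjE)
  have "\<not> guess_null D F E" if E: "club_on F E" for E
  proof
    assume null: "guess_null D F E"
    from D[rule_format, OF E] obtain \<delta> where \<delta>: "\<delta> \<in> cof_omega \<inter> E"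
      "\<forall>N. \<exists>\<beta>\<in>E \<inter> fill D \<delta> N. (\<forall>i\<le>N. omega_seq \<delta> i \<sqsubset> \<beta>) \<and> \<not> cof_le \<beta> (T N)" ..
    from guess_nullD[OF null IntD1[OF \<delta>(1)] IntD2[OF \<delta>(1)]] obtain N where N: "\<forall>m \<beta>. N \<le> m \<longrightarrow> \<beta> \<in> F \<longrightarrow>
      \<beta> \<in> E \<longrightarrow> \<beta> \<in> fill D \<delta> m \<longrightarrow> (\<forall>i\<le>N. omega_seq \<delta> i \<sqsubset> \<beta>) \<longrightarrow> cof_le \<beta> (T m)" ..
    from \<delta>(2)[rule_format, of N] obtain \<beta> where "\<beta> \<in> E \<inter> fill D \<delta> N"
      "(\<forall>i\<le>N. omega_seq \<delta> i \<sqsubset> \<beta>) \<and> \<not> cof_le \<beta> (T N)" ..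
    then show False using N[rule_format, of N \<beta>] subsetD[OF clubD(1)[OF E], of \<beta>] by simp
  qed
  then have "F \<notin> guess_ideal D" unfolding guess_ideal_def by blast
  then show ?thesis ..
qed

text \<open>The color of a pair depends on its order, which \<open>least_of\<close> recovers from the unordered pair.\<close>

definition pair_col :: "'b set \<Rightarrow> 'b set \<Rightarrow> 'b" where
  "pair_col D p = color D (least_of p) (least_of (p - {least_of p}))"

lemma pair_col: "x \<sqsubset> y \<Longrightarrow> pair_col D {x, y} = color D x y"
proof -
  assume xy: "x \<sqsubset> y"
  have "least_of {x, y} = x" using least_of_in[of "{x, y}"] least_of_le[of x "{x, y}"] xy by auto
  moreover have "{x, y} - {x} = {y}" using xy by auto
  moreover have "least_of {y} = y" using least_of_in[of "{y}"] by simp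
  ultimately show ?thesis unfolding pair_col_def by simp
qed

end

section \<open>From cardinals as relations to orders on a whole type\<close>

lemma ordinals_of_wf:
  assumes wf: "wf {(x, y). lt x y}" and total: "\<And>x y. lt x y \<or> x = y \<or> lt y x"
  shows "ordinals (\<lambda>x y. lt x y \<or> x = y) lt"
proof -
  have asym: "\<not> lt y x" if "lt x y" for x y
    using wf_not_sym[OF wf, of x y] that by simp
  have trans: "lt x z" if xyz: "lt x y" "lt y z" for x y z
  proof (rule ccontr)
    assume "\<not> lt x z"
    moreover have "x \<noteq> z" using asym[OF xyz(1)] xyz(2) by auto
    ultimately have zx: "lt z x" using total[of x z] by simp
    have "(x, y) \<in> {(x, y). lt x y}\<^sup>+" by (rule r_into_trancl) (simp add: xyz)
    then have "(x, z) \<in> {(x, y). lt x y}\<^sup>+" by (rule trancl_into_trancl) (simp add: xyz)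
    then have "(x, x) \<in> {(x, y). lt x y}\<^sup>+" by (rule trancl_into_trancl) (simp add: zx)
    then show False using wf_acyclic[OF wf] unfolding acyclic_def by simp
  qed
  show ?thesis
  proof unfold_locales
    fix P a assume "\<And>x. (\<And>y. lt y x \<Longrightarrow> P y) \<Longrightarrow> P x"
    then show "P a" using wf_induct_rule[OF wf, of P a] by auto
  qed (use asym trans total in blast)+
qed

text \<open>The elements outside the field are well-ordered arbitrarily and placed on top, so that
  the field becomes an initial segment.\<close>

lemma ordinals_extension:
  assumes "Well_order r"
  shows "\<exists>le lt. ordinals le lt \<and> (\<forall>x y. y \<in> Field r \<longrightarrow> lt x y = (x \<in> underS r y))"
proof -
  obtain w :: "'a rel" where w: "well_order_on (- Field r) w" using well_order_on by blast
  define s where "s = (r - Id) \<union> ((Field r \<times> (- Field r)) \<union> (w - Id))"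
  have Fw: "Field w = - Field r" "Well_order w" using w well_order_on_Well_order by blast+
  have r_tot: "(x, y) \<in> r - Id \<or> x = y \<or> (y, x) \<in> r - Id" if "x \<in> Field r" "y \<in> Field r" for x y
    using assms that unfolding well_order_on_def linear_order_on_def total_on_def by auto
  have w_tot: "(x, y) \<in> w - Id \<or> x = y \<or> (y, x) \<in> w - Id" if "x \<notin> Field r" "y \<notin> Field r" for x y
    using Fw that unfolding well_order_on_def linear_order_on_def total_on_def by auto
  have Fr: "x \<in> Field r" "y \<in> Field r" if "(x, y) \<in> r" for x y using that by (auto simp: Field_def)
  have Fw': "x \<notin> Field r" "y \<notin> Field r" if "(x, y) \<in> w" for x y
    using that Fw(1) by (auto simp: Field_def)
  have "wf (Field r \<times> (- Field r))" by (rule wfI_min) blast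
  moreover have "wf (w - Id)" using Fw(2) unfolding well_order_on_def by blast
  ultimately have wf1: "wf ((Field r \<times> (- Field r)) \<union> (w - Id))"
    by (rule wf_Un) (use Fw' in auto)
  have wfr: "wf (r - Id)" using assms unfolding well_order_on_def by blast
  have "Domain (r - Id) \<inter> Range ((Field r \<times> (- Field r)) \<union> (w - Id)) = {}" using Fr Fw' by blast
  then have "wf s" unfolding s_def by (rule wf_Un[OF wfr wf1])
  moreover have "(x, y) \<in> s \<or> x = y \<or> (y, x) \<in> s" for x y
    using r_tot[of x y] w_tot[of x y] unfolding s_def by blast
  ultimately have "ordinals (\<lambda>x y. (x, y) \<in> s \<or> x = y) (\<lambda>x y. (x, y) \<in> s)"
    by (intro ordinals_of_wf) auto
  moreover have "(x, y) \<in> s \<longleftrightarrow> x \<in> underS r y" if "y \<in> Field r" for x y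
    using that Fw' unfolding s_def underS_def by auto
  ultimately show ?thesis by blast
qed

lemma singular_filtration:
  fixes \<mu> :: "'a rel"
  assumes "singular_card \<mu>" "cf \<mu> =o natLeq"
  obtains L where "\<And>n::nat. infinite (L n)" "\<And>n. L n \<subseteq> L (Suc n)" "\<And>n. \<not> |L (Suc n)| \<le>o |L n|"
    "(\<Union>n. L n) = Field \<mu>"
proof -
  let ?B = "Field \<mu>"
  have \<mu>: "Card_order \<mu>" "cinfinite \<mu>" "\<not> regularCard \<mu>" using assms(1) unfolding singular_card_def by auto
  have infB: "infinite ?B" using \<mu>(2) unfolding cinfinite_def .
  have \<mu>B: "\<mu> =o |?B|" using card_of_Field_ordIso[OF \<mu>(1)] ordIso_symmetric by blast
  obtain K where K: "K \<subseteq> ?B" "cofinal K \<mu>" "cf \<mu> = |K|" using cf_attained(1)[OF \<mu>(1,2)] by blast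
  have "|K| \<le>o natLeq" using assms(2) K(3) ordIso_imp_ordLeq by simp
  then have "|K| \<le>o |UNIV :: nat set|" using card_of_nat ordIso_symmetric ordLeq_ordIso_trans by blast
  moreover have "K \<noteq> {}" using K(2) infB unfolding cofinal_def by force
  ultimately obtain c :: "nat \<Rightarrow> 'a" where c: "range c = K" using card_of_ordLeq2[of K "UNIV :: nat set"] by blast
  have cB: "c n \<in> ?B" for n using c K(1) by blast
  have small: "|underS \<mu> (c n)| <o |?B|" for n
    using card_of_underS[OF \<mu>(1) cB] \<mu>B ordLess_ordIso_trans by blast
  have sub: "underS \<mu> x \<subseteq> ?B" for x by (auto simp: underS_def Field_def)
  have cover: "?B = (\<Union>n. underS \<mu> (c n))"
  proof
    show "?B \<subseteq> (\<Union>n. underS \<mu> (c n))"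
    proof
      fix x assume "x \<in> ?B"
      then obtain b where "b \<in> K" "x \<noteq> b" "(x, b) \<in> \<mu>" using K(2) unfolding cofinal_def by blast
      then show "x \<in> (\<Union>n. underS \<mu> (c n))" using c by (auto simp: underS_def)
    qed
  qed (use sub in blast)
  have big: "\<exists>n. \<not> |underS \<mu> (c n)| \<le>o |S|" if S: "infinite S" "|S| <o |?B|" for S :: "'a set"
  proof (rule ccontr)
    assume "\<not> ?thesis"
    then have "|\<Union>n. underS \<mu> (c n)| \<le>o |S|"
      by (intro card_le_UN[OF S(1) card_le_countable[OF S(1)]]) blast
    then show False using S(2) unfolding cover[symmetric] card_less_iff by blast
  qed
  define P where "P S \<longleftrightarrow> infinite S \<and> S \<subseteq> ?B \<and> |S| <o |?B|" for S
  \<comment> \<open>The segment at \<open>c k\<close> makes the union exhaust the field; the other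
    one, not of size at most \<open>|S|\<close>, makes the sizes strictly increase.\<close>
  define step where "step k S = S \<union> underS \<mu> (c k) \<union> underS \<mu> (c (SOME n. \<not> |underS \<mu> (c n)| \<le>o |S| ))" for k S
  have "\<exists>S. P S"
  proof -
    \<comment> \<open>A countable set is small enough to start with: \<mu> is not isomorphic to
      \<open>natLeq\<close>, since that is regular.\<close>
    have "natLeq \<le>o \<mu>" using natLeq_ordLeq_cinfinite \<mu> by blast
    moreover have "\<not> natLeq =o \<mu>"
      using regularCard_ordIso[OF _ natLeq_Cinfinite regularCard_natLeq] \<mu>(3) by blast
    ultimately have lt: "natLeq <o \<mu>" using ordLeq_iff_ordLess_or_ordIso by blast
    obtain h :: "nat \<Rightarrow> 'a" where h: "inj h" "range h \<subseteq> ?B"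
      using infB unfolding infinite_iff_countable_subset by blast
    have "|range h| \<le>o natLeq" using card_of_image[of h UNIV] card_of_nat ordLeq_ordIso_trans by blast
    then have "|range h| <o |?B|"
      using ordLeq_ordLess_trans[OF _ lt] ordLess_ordIso_trans[OF _ \<mu>B] by blast
    then show ?thesis unfolding P_def using h by (intro exI[of _ "range h"]) (simp add: range_inj_infinite)
  qed
  then obtain S0 where S0: "P S0" by blast
  have step: "P (step k S)" "S \<subseteq> step k S" "underS \<mu> (c k) \<subseteq> step k S" "\<not> |step k S| \<le>o |S|"
    if S: "P S" for k S
  proof -
    show "S \<subseteq> step k S" "underS \<mu> (c k) \<subseteq> step k S" unfolding step_def by auto
    then show "P (step k S)" using S small sub unfolding P_def step_def
      by (auto intro!: card_of_Un_ordLess_infinite infB dest: finite_subset)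
    have ex: "\<exists>n. \<not> |underS \<mu> (c n)| \<le>o |S|" using big S unfolding P_def by blast
    from someI_ex[OF this] show "\<not> |step k S| \<le>o |S|"
      using card_le_subset[of _ "step k S" S] unfolding step_def by blast
  qed
  define L where "L = rec_nat S0 step"
  have L: "L 0 = S0" "L (Suc n) = step n (L n)" for n unfolding L_def by auto
  have PL: "P (L n)" for n by (induction n) (use S0 step(1) L in auto)
  have "(\<Union>n. L n) = ?B"
  proof
    show "(\<Union>n. L n) \<subseteq> ?B" using PL unfolding P_def by blast
    have "underS \<mu> (c n) \<subseteq> L (Suc n)" for n unfolding L(2) by (rule step(3)[OF PL])
    then show "?B \<subseteq> (\<Union>n. L n)" unfolding cover by blast
  qed
  moreover have "infinite (L n)" for n using PL[of n] unfolding P_def by blast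
  moreover have "L n \<subseteq> L (Suc n)" "\<not> |L (Suc n)| \<le>o |L n|" for n
    unfolding L(2) by (rule step(2)[OF PL], rule step(4)[OF PL])
  ultimately show thesis by (intro that[of L])
qed

theorem theorem1p2:
  fixes \<mu> :: "'a rel"
  assumes "singular_card \<mu>"
    and "cf \<mu> =o natLeq"
  shows "\<exists>(c :: 'a set set \<Rightarrow> 'a set) (I :: 'a set set set).
    c \<in> nsets (Field (cardSuc \<mu>)) 2 \<rightarrow> Field (cardSuc \<mu>) \<and>
    ideal_on (cardSuc \<mu>) I \<and>
    (\<forall>N \<subseteq> Field (cardSuc \<mu>). \<not> stationary (cardSuc \<mu>) N \<longrightarrow> N \<in> I) \<and>
    (\<forall>\<sigma> :: 'a rel. Card_order \<sigma> \<and> regularCard \<sigma> \<and> natLeq <o \<sigma> \<and> \<sigma> <o \<mu> \<longrightarrow>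
       indecomposable \<sigma> I) \<and>
    (\<forall>t :: 'a set \<Rightarrow> 'a set set.
       (\<forall>\<alpha> \<in> Field (cardSuc \<mu>). finite (t \<alpha>) \<and> t \<alpha> \<subseteq> Field (cardSuc \<mu>)) \<and>
       disjoint_family_on t (Field (cardSuc \<mu>)) \<longrightarrow>
       almost_all (cardSuc \<mu>) I (\<lambda>\<beta>'.
         \<exists>\<beta> \<in> Field (cardSuc \<mu>). \<exists>\<alpha> \<in> underS (cardSuc \<mu>) \<beta>.
           \<forall>(x, y) \<in> t \<alpha> \<times> t \<beta>. c {x, y} = \<beta>'))"
proof -
  let ?r = "cardSuc \<mu>"
  define F where "F = Field ?r"
  have \<mu>: "Card_order \<mu>" "infinite (Field \<mu>)"
    using assms(1) unfolding singular_card_def cinfinite_def by auto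
  have \<mu>B: "|Field \<mu>| =o \<mu>" by (rule card_of_Field_ordIso[OF \<mu>(1)])
  have r: "Card_order ?r" "Well_order ?r" "infinite (Field ?r)" "regularCard ?r"
    using cardSuc_Card_order[OF \<mu>(1)] cardSuc_Well_order[OF \<mu>(1)] cardSuc_finite[OF \<mu>(1)] \<mu>(2)
      infinite_cardSuc_regularCard[OF \<mu>(2,1)] by auto
  obtain L where L: "\<And>n::nat. infinite (L n)" "\<And>n. L n \<subseteq> L (Suc n)" "\<And>n. \<not> |L (Suc n)| \<le>o |L n|"
    "(\<Union>n. L n) = Field \<mu>" using singular_filtration[OF assms] by blast
  have "|Field \<mu>| \<le>o |F|"
    unfolding F_def by (rule card_of_mono2[OF cardSuc_ordLeq[OF \<mu>(1)]])
  \<comment> \<open>The filtration consists of sets over \<open>'a\<close>, whereas the successor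
    cardinal lives on \<open>'a set\<close>; an injection copies the former into
    \<open>F\<close>.\<close>
  then obtain \<iota> where \<iota>: "inj_on \<iota> (Field \<mu>)" "\<iota> ` Field \<mu> \<subseteq> F" using card_of_ordLeq[of "Field \<mu>" F] by auto
  define K where "K n = \<iota> ` L n" for n
  have LB: "L n \<subseteq> Field \<mu>" for n using L(4) by blast
  have inj: "inj_on \<iota> (L n)" for n using inj_on_subset[OF \<iota>(1) LB] .
  have M: "(\<Union>n. K n) = \<iota> ` Field \<mu>" unfolding K_def using L(4) by blast
  have M_le: "|\<Union>n. K n| \<le>o \<mu>" unfolding M using card_of_image \<mu>B ordLeq_ordIso_trans by blast
  have le_M: "\<mu> \<le>o |\<Union>n. K n|"
    unfolding M by (rule ordIso_ordLeq_trans[OF ordIso_symmetric[OF \<mu>B] card_of_ordLeqI[OF \<iota>(1)]]) simp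
  from ordinals_extension[OF r(2), folded F_def] obtain le lt where
    "ordinals le lt \<and> (\<forall>x y. y \<in> F \<longrightarrow> lt x y = (x \<in> underS ?r y))" by (elim exE)
  then have lt: "ordinals le lt" "\<And>x y. y \<in> F \<Longrightarrow> lt x y \<longleftrightarrow> x \<in> underS ?r y" by simp_all
  interpret ordinals le lt by (rule lt(1))
  have dnF: "below x = underS ?r x" if "x \<in> F" for x
    by (rule set_eqI) (simp only: below_iff lt(2)[OF that])
  have in_F: "y \<in> F" if "y \<in> underS ?r x" for x y using that unfolding F_def underS_def Field_def by auto
  have above: "\<exists>b\<in>F. lt a b" if "a \<in> F" for a
    using infinite_Card_order_limit[OF r(1,3), of a] that lt(2) unfolding F_def underS_def by auto
  have "regular_on F (\<Union>n. K n)"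
    unfolding regular_on_def
  proof (intro conjI ballI allI impI)
    show "infinite (\<Union>n. K n)" unfolding M using \<mu>(2) \<iota>(1) finite_imageD by blast
  next
    fix x assume x: "x \<in> F"
    show "below x \<subseteq> F" unfolding dnF[OF x] using in_F by blast
    have "|underS ?r x| <o ?r" using card_of_underS[OF r(1)] x unfolding F_def .
    then have "|underS ?r x| \<le>o \<mu>" using cardSuc_ordLeq_ordLess[OF \<mu>(1) card_of_Card_order] by blast
    then show "|below x| \<le>o |\<Union>n. K n|" unfolding dnF[OF x] using le_M by (rule ordLeq_transitive)
  next
    fix X assume X: "X \<subseteq> F" "|X| \<le>o |\<Union>n. K n|"
    show "\<exists>b\<in>F. \<forall>x\<in>X. lt x b"
    proof (rule ccontr)
      assume n: "\<not> ?thesis"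
      have "cofinal X ?r"
        unfolding cofinal_def
      proof
        fix a assume "a \<in> Field ?r"
        then obtain b where b: "b \<in> F" "lt a b" using above unfolding F_def by blast
        then obtain x where x: "x \<in> X" "\<not> lt x b" using n by blast
        then have "lt a x" using b(2) by order
        then show "\<exists>b\<in>X. a \<noteq> b \<and> (a, b) \<in> ?r" using lt(2)[of x a] X(1) x(1) unfolding underS_def by auto
      qed
      then have "|X| =o ?r" using r(4) X(1) unfolding regularCard_def F_def by blast
      moreover have "|X| \<le>o \<mu>" using ordLeq_transitive[OF X(2) M_le] .
      ultimately have "?r \<le>o \<mu>" using ordIso_symmetric ordIso_ordLeq_trans by blast
      then show False using cardSuc_greater[OF \<mu>(1)] not_ordLess_ordLeq by blast
    qed
  qed
  then have "filtered le lt F K"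
  proof unfold_locales
    show "infinite (K n)" for n unfolding K_def using L(1) inj finite_imageD by blast
    show "K n \<subseteq> K (Suc n)" for n unfolding K_def using L(2) by blast
    show "\<not> |K (Suc n)| \<le>o |K n|" for n
    proof
      assume "|K (Suc n)| \<le>o |K n|"
      then have "|K (Suc n)| \<le>o |L n|" using ordLeq_transitive card_of_image unfolding K_def by blast
      moreover have "|L (Suc n)| \<le>o |K (Suc n)|" unfolding K_def by (rule card_of_ordLeqI[OF inj]) simp
      ultimately show False using L(3) ordLeq_transitive by blast
    qed
  qed
  then obtain T e H f where "scale le lt F (\<Union>n. K n) T e H f" using filtered.scale_exists by blast
  then interpret scale le lt F "\<Union>n. K n" T e H f .
  obtain D where D: "F \<notin> guess_ideal D" using guess_ideal_proper by blast
  have "pair_col D \<in> nsets F 2 \<rightarrow> F"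
  proof
    fix p assume "p \<in> nsets F 2"
    then obtain x y where "p = {x, y}" "x \<in> F" "y \<in> F" "x \<noteq> y" by (rule nsets2_E)
    then obtain x y where "p = {x, y}" "y \<in> F" "lt x y" by (metis doubleton_eq_iff neqE)
    then show "pair_col D p \<in> F" using pair_col color_in by simp
  qed
  moreover have "ideal_on ?r (guess_ideal D)"
    unfolding ideal_on_def F_def[symmetric]
  proof (intro conjI allI impI ballI)
    show "guess_ideal D \<subseteq> Pow F" unfolding guess_ideal_def by blast
    show "{} \<in> guess_ideal D"
      by (rule guess_ideal_disjoint_club[OF _ reg_club_self[OF F_reg]]) auto
  next
    fix \<beta> A assume "\<beta> \<in> F" "A \<subseteq> underS ?r \<beta>"
    then show "A \<in> guess_ideal D" using guess_ideal_bounded dnF by simp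
  qed (use D guess_ideal_subset guess_ideal_Un in auto)
  moreover have "N \<in> guess_ideal D" if N: "N \<subseteq> F" "\<not> stationary ?r N" for N
  proof -
    obtain C where C: "club ?r C" "N \<inter> C = {}" using N unfolding stationary_def F_def by blast
    have CF: "C \<subseteq> F" using C(1) unfolding club_def F_def by blast
    have "club_on F C"
      unfolding club_on_def
    proof (intro conjI ballI impI)
      fix x assume "x \<in> F"
      then obtain b where b: "b \<in> C" "x \<noteq> b" "(x, b) \<in> ?r"
        using C(1) unfolding club_def cofinal_def F_def by blast
      then have "lt x b" using lt(2)[of b x] CF unfolding underS_def by blast
      then show "\<exists>c\<in>C. lt x c" using b(1) by blast
    next
      fix d assume d: "d \<in> F" "limit_of C d"
      have "underS ?r d \<noteq> {}" using d unfolding limit_of_def lt(2)[OF d(1)] by blast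
      moreover have "\<exists>\<gamma>\<in>C. \<alpha> \<in> underS ?r \<gamma> \<and> \<gamma> \<in> underS ?r d" if \<alpha>: "\<alpha> \<in> underS ?r d" for \<alpha>
      proof -
        have "lt \<alpha> d" using \<alpha> lt(2)[OF d(1)] by blast
        then obtain c where c: "c \<in> C" "lt \<alpha> c" "lt c d" using limD[OF d(2)] by blast
        then show ?thesis using lt(2)[OF d(1)] lt(2)[of c \<alpha>] CF by blast
      qed
      ultimately show "d \<in> C" using C(1) d(1) unfolding club_def closed_in_def F_def by blast
    qed (rule CF)
    then show ?thesis using guess_ideal_disjoint_club[OF N(1) _ C(2)] by blast
  qed
  moreover have "indecomposable \<sigma> (guess_ideal D)"
    if \<sigma>: "Card_order \<sigma>" "regularCard \<sigma>" "natLeq <o \<sigma>" "\<sigma> <o \<mu>" for \<sigma> :: "'a rel"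
  proof (rule guess_ideal_indecomposable[OF \<sigma>(1-3)])
    have "|Field \<sigma>| \<le>o \<mu>"
      using card_of_Field_ordIso[OF \<sigma>(1)] ordLess_imp_ordLeq[OF \<sigma>(4)] by (rule ordIso_ordLeq_trans)
    then show "|Field \<sigma>| \<le>o |\<Union>n. K n|" using le_M by (rule ordLeq_transitive)
  qed
  moreover have "almost_all ?r (guess_ideal D) (\<lambda>\<beta>'. \<exists>\<beta>\<in>F. \<exists>\<alpha>\<in>underS ?r \<beta>.
      \<forall>(x, y)\<in>t \<alpha> \<times> t \<beta>. pair_col D {x, y} = \<beta>')"
    if t: "\<forall>\<alpha>\<in>F. finite (t \<alpha>) \<and> t \<alpha> \<subseteq> F" "disjoint_family_on t F" for t
  proof -
    \<comment> \<open>The conjunct \<open>lt x y\<close> is carried along because the coloring of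
      unordered pairs agrees with \<open>color\<close> on increasing pairs.\<close>
    let ?Q = "\<lambda>b. \<exists>\<beta>\<in>F. \<exists>\<alpha>. lt \<alpha> \<beta> \<and> (\<forall>x\<in>t \<alpha>. \<forall>y\<in>t \<beta>. lt x y \<and> color D x y = b)"
    have "{b \<in> F. \<not> ?Q b} \<in> guess_ideal D" using coloring_hits[OF _ t(2), of D] t(1) by blast
    moreover have "\<exists>\<beta>\<in>F. \<exists>\<alpha>\<in>underS ?r \<beta>. \<forall>(x, y)\<in>t \<alpha> \<times> t \<beta>. pair_col D {x, y} = b" if Qb: "?Q b" for b
    proof -
      obtain \<beta> \<alpha> where "\<beta> \<in> F" "lt \<alpha> \<beta>" "\<forall>x\<in>t \<alpha>. \<forall>y\<in>t \<beta>. lt x y \<and> color D x y = b" using Qb by blast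
      then show ?thesis using lt(2) pair_col by (intro bexI[of _ \<beta>] bexI[of _ \<alpha>]) auto
    qed
    ultimately show ?thesis unfolding almost_all_def F_def[symmetric]
      by (elim guess_ideal_subset) blast
  qed
  ultimately show ?thesis unfolding F_def by blast
qed

end
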